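(* Let $\psi_{\hbar,\varepsilon}(t)$, $0<\hbar,\varepsilon\le1$, be the solutions of the one-dimensional nonlinear Schrödinger equation $i\hbar\partial_t\psi_{\hbar,\varepsilon}=-\frac12\hbar^2\partial_x^2\psi_{\hbar,\varepsilon}+(V_\varepsilon*|\psi_{\hbar,\varepsilon}|^2)\psi_{\hbar,\varepsilon}$, $\psi_{\hbar,\varepsilon}(0)=\psi_\hbar^{\mathrm{in}}$, with potential and initial data as in the context, and let $\rho_{\hbar,\varepsilon}(t)=|\psi_{\hbar,\varepsilon}(t)|^2$. Then for all $t\ge0$ $$\|\langle x\rangle^2\rho_{\hbar,\varepsilon}(t)\|_{L^1_x}\le C(t),$$ $$\|\langle x\rangle^{\frac12}\hbar^k\partial_x^k\psi_{\hbar,\varepsilon}(t)\|_{L^2_x}\le C(k,t)\qquad\text{for all integers }k\ge1,$$ where the finite constants $C(t)$, $C(k,t)$ are independent of $\hbar,\varepsilon\in(0,1]$.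
   Context: $\langle x\rangle=\sqrt{1+x^2}$. For a fixed sign $\kappa\in\{+1,-1\}$, $V_\varepsilon(x)=\kappa\frac12|x|e^{-\varepsilon|x|}$ on $\mathbb{R}$. The initial data satisfy $\|\psi_\hbar^{\mathrm{in}}\|_{L^2}=1$ and, with a constant $C_0$ independent of $\hbar$, $\||x|\psi_\hbar^{\mathrm{in}}\|_{L^2}\le C_0$ and $\|\hbar^k\partial_x^k\psi_\hbar^{\mathrm{in}}\|_{L^2}\le C_0^kk^k$ for all integers $k\ge0$ (with $0^0=1$). Constants $C(\cdot)$ depend only on the indicated quantities and on $C_0$. *)

theory Defs
  imports "HOL-Analysis.Analysis"
begin

section \<open>Square-integrable functions on the line\<close>

text \<open>Elements of \<open>L\<^sup>2(\<real>)\<close> are represented by Borel functions, equality being equality almost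
  everywhere. Since the Bochner integral of a non-integrable function is \<open>0\<close>, a bound on
  \<open>L2_norm f\<close> is meaningful only together with \<open>square_integrable f\<close>.\<close>

definition square_integrable :: "(real \<Rightarrow> complex) \<Rightarrow> bool" where
  "square_integrable f \<longleftrightarrow>
     f \<in> borel_measurable lborel \<and> integrable lborel (\<lambda>x. (cmod (f x))\<^sup>2)"

definition L2_norm :: "(real \<Rightarrow> complex) \<Rightarrow> real" where
  "L2_norm f = sqrt (LINT x|lborel. (cmod (f x))\<^sup>2)"

definition L2_continuous_on :: "real set \<Rightarrow> (real \<Rightarrow> real \<Rightarrow> complex) \<Rightarrow> bool" where
  "L2_continuous_on T u \<longleftrightarrow>
     (\<forall>t\<in>T. square_integrable (u t)) \<and>
     (\<forall>t\<in>T. ((\<lambda>s. L2_norm (\<lambda>x. u s x - u t x)) \<longlongrightarrow> 0) (at t within T))"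

definition has_L2_derivative_on ::
    "(real \<Rightarrow> real \<Rightarrow> complex) \<Rightarrow> (real \<Rightarrow> real \<Rightarrow> complex) \<Rightarrow> real set \<Rightarrow> bool" where
  "has_L2_derivative_on u u' T \<longleftrightarrow>
     (\<forall>t\<in>T. ((\<lambda>s. L2_norm (\<lambda>x. (u s x - u t x) / of_real (s - t) - u' t x)) \<longlongrightarrow> 0)
               (at t within T))"


section \<open>Weak derivatives\<close>

definition test_function :: "(real \<Rightarrow> real) \<Rightarrow> bool" where
  "test_function \<phi> \<longleftrightarrow>
     (\<forall>n x. ((deriv ^^ n) \<phi>) differentiable (at x)) \<and> compact (closure {x. \<phi> x \<noteq> 0})"

definition locally_integrable :: "(real \<Rightarrow> complex) \<Rightarrow> bool" where
  "locally_integrable f \<longleftrightarrow> (\<forall>a b. set_integrable lborel {a..b} f)"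

definition has_weak_deriv :: "nat \<Rightarrow> (real \<Rightarrow> complex) \<Rightarrow> (real \<Rightarrow> complex) \<Rightarrow> bool" where
  "has_weak_deriv k f g \<longleftrightarrow>
     locally_integrable f \<and> locally_integrable g \<and>
     (\<forall>\<phi>. test_function \<phi> \<longrightarrow>
        (LINT x|lborel. f x * of_real ((deriv ^^ k) \<phi> x)) =
        (-1) ^ k * (LINT x|lborel. g x * of_real (\<phi> x)))"


section \<open>The nonlinear Schroedinger equation\<close>

definition jbracket :: "real \<Rightarrow> real" where
  "jbracket x = sqrt (1 + x\<^sup>2)"

definition potential :: "real \<Rightarrow> real \<Rightarrow> real \<Rightarrow> real" where
  "potential \<kappa> \<epsilon> x = \<kappa> * (1 / 2) * \<bar>x\<bar> * exp (- \<epsilon> * \<bar>x\<bar>)"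

definition convolve :: "(real \<Rightarrow> real) \<Rightarrow> (real \<Rightarrow> real) \<Rightarrow> real \<Rightarrow> real" where
  "convolve f g x = (LINT y|lborel. f (x - y) * g y)"

definition position_density :: "(real \<Rightarrow> complex) \<Rightarrow> real \<Rightarrow> real" where
  "position_density u x = (cmod (u x))\<^sup>2"

text \<open>Strong solutions on \<open>[0,\<infinity>)\<close>, that is, \<open>\<psi> \<in> C([0,\<infinity>); H\<^sup>2) \<inter> C\<^sup>1([0,\<infinity>); L\<^sup>2)\<close> with the equation
  holding in \<open>L\<^sup>2\<close> at every time. This is the class in which \<open>H\<^sup>2\<close> data evolve; no higher
  Sobolev regularity and no spatial decay beyond \<open>L\<^sup>2\<close> is required for positive times.\<close>

definition nls_solution ::
    "real \<Rightarrow> real \<Rightarrow> real \<Rightarrow> (real \<Rightarrow> complex) \<Rightarrow> (real \<Rightarrow> real \<Rightarrow> complex) \<Rightarrow> bool" where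
  "nls_solution \<kappa> h \<epsilon> \<psi>0 \<psi> \<longleftrightarrow>
     (AE x in lborel. \<psi> 0 x = \<psi>0 x) \<and>
     (\<exists>\<psi>t \<psi>x \<psi>xx.
        L2_continuous_on {0..} \<psi> \<and> L2_continuous_on {0..} \<psi>x \<and>
        L2_continuous_on {0..} \<psi>xx \<and> L2_continuous_on {0..} \<psi>t \<and>
        has_L2_derivative_on \<psi> \<psi>t {0..} \<and>
        (\<forall>t\<ge>0. has_weak_deriv 1 (\<psi> t) (\<psi>x t) \<and> has_weak_deriv 2 (\<psi> t) (\<psi>xx t) \<and>
           (AE x in lborel.
              \<i> * of_real h * \<psi>t t x =
                - (1 / 2) * (of_real h)\<^sup>2 * \<psi>xx t x
                + of_real (convolve (potential \<kappa> \<epsilon>) (position_density (\<psi> t)) x) * \<psi> t x)))"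

definition admissible_data :: "real \<Rightarrow> real \<Rightarrow> (real \<Rightarrow> complex) \<Rightarrow> bool" where
  "admissible_data C0 h \<psi>0 \<longleftrightarrow>
     square_integrable \<psi>0 \<and> L2_norm \<psi>0 = 1 \<and>
     square_integrable (\<lambda>x. of_real \<bar>x\<bar> * \<psi>0 x) \<and>
     L2_norm (\<lambda>x. of_real \<bar>x\<bar> * \<psi>0 x) \<le> C0 \<and>
     (\<forall>k::nat. \<exists>g. has_weak_deriv k \<psi>0 g \<and> square_integrable g \<and>
        L2_norm (\<lambda>x. of_real (h ^ k) * g x) \<le> C0 ^ k * real k ^ k)"

end

theory Submission
  imports Defs
begin

text \<open>Write \<open>D\<^sub>y f = (\<hbar> / y) (f(\<cdot> + y) - f)\<close>. Difference quotients \<open>D\<^sub>y\<^sub>1 \<dots> D\<^sub>y\<^sub>n \<psi>(t)\<close> stay in the class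
  where the equation holds, commute with \<open>\<partial>\<^sub>x\<^sup>2\<close>, and satisfy an \<open>L\<^sup>2\<close> energy inequality. The commutator with
  the mean field \<open>V * |\<psi>|\<^sup>2\<close> only involves quotients of order \<open>< n\<close>: one quotient falls on \<open>V\<close>, which is
  Lipschitz with constant \<open>1/2\<close> for every \<open>\<epsilon>\<close> and so produces a factor \<open>\<hbar>\<close> that cancels the \<open>1/\<hbar>\<close> of the
  equation, and the others fall on \<open>|\<psi>|\<^sup>2\<close>, which is measured in \<open>L\<^sup>1\<close>. Induction on \<open>n\<close> bounds all
  difference quotients uniformly in \<open>y\<close>, \<open>\<hbar>\<close>, \<open>\<epsilon>\<close>. The weight \<open>\<langle>x\<rangle>\<close> is propagated by the same energy argument,
  its commutator with the Laplacian costing one difference quotient. At a fixed time, moving all \<open>k\<close> quotients to one side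
  bounds \<open>\<integral> \<langle>x\<rangle> |D\<^sup>k \<psi>|\<^sup>2\<close> by \<open>\<parallel>\<langle>x\<rangle> \<psi>\<parallel>\<close> and unweighted quotients of order up to \<open>2 k\<close>. Letting \<open>y\<close> tend to \<open>0\<close>
  gives the weak derivatives together with their bounds.\<close>


section \<open>Square-integrable functions and translations\<close>

text \<open>At positive times the solution class provides only \<open>H^2\<close> regularity and no
  decay, so the equation can be neither differentiated further nor multiplied by \<open><x>\<close>.
  Everything applied to it is therefore bounded on \<open>L^2\<close>: finite differences, and
  weights cut off at height \<open>n\<close>. Their operator norms, like the bound
  \<open>1/eps\<close> of the potential, only justify manipulations and never enter a final
  constant. Integration by parts is treated alike. Products such as \<open>w^2 psi\<close> are given
  no weak derivative; \<open><v, f''>\<close> is recovered from the increments of \<open>v\<close>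
  and \<open>f\<close>, divided by \<open>y^2\<close>, with an error that vanishes as
  \<open>y -> 0\<close> if \<open>v\<close> is Lipschitz under translations in \<open>L^2\<close>.
  The commutator is cubic, but at order \<open>n\<close> it sees only orders below \<open>n\<close>,
  so each order grows at a rate fixed by the previous ones and no Gronwall argument occurs. The
  exponent 1/2 of the weight comes from the last step: moving \<open>k\<close> quotients across
  pairs \<open><x> psi\<close> with \<open>D^(2k) psi\<close>, so a full weight on
  \<open>psi\<close> is shared by two copies of \<open>D^k psi\<close>.\<close>

lemma borel_measurable_cnj [measurable (raw)]:
  "f \<in> borel_measurable M \<Longrightarrow> (\<lambda>x. cnj (f x)) \<in> borel_measurable M"
  by (rule borel_measurable_continuous_on) (auto intro!: continuous_intros)

lemma square_integrable_measurable [measurable_dest]: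
  "square_integrable f \<Longrightarrow> f \<in> borel_measurable borel"
  by (simp add: square_integrable_def)

lemma square_integrable_integrable:
  "square_integrable f \<Longrightarrow> integrable lborel (\<lambda>x. (cmod (f x))\<^sup>2)"
  by (simp add: square_integrable_def)

lemma L2_norm_nonneg [simp]: "0 \<le> L2_norm f"
  by (simp add: L2_norm_def)

lemma L2_norm_power2: "(L2_norm f)\<^sup>2 = (LINT x|lborel. (cmod (f x))\<^sup>2)"
  by (simp add: L2_norm_def)

lemma
  assumes g: "square_integrable g" and f [measurable]: "f \<in> borel_measurable borel"
    and le: "AE x in lborel. cmod (f x) \<le> c * cmod (g x)" and c: "0 \<le> c"
  shows square_integrable_bound: "square_integrable f"
    and L2_norm_bound: "L2_norm f \<le> c * L2_norm g"
proof -
  have le': "AE x in lborel. (cmod (f x))\<^sup>2 \<le> c\<^sup>2 * (cmod (g x))\<^sup>2"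
    using le by eventually_elim (metis norm_ge_zero power_mono power_mult_distrib)
  have int: "integrable lborel (\<lambda>x. c\<^sup>2 * (cmod (g x))\<^sup>2)"
    using square_integrable_integrable[OF g] by simp
  have "integrable lborel (\<lambda>x. (cmod (f x))\<^sup>2)"
    by (rule Bochner_Integration.integrable_bound[OF int]) (use le' in auto)
  then show si: "square_integrable f" by (simp add: square_integrable_def)
  have "(L2_norm f)\<^sup>2 \<le> (LINT x|lborel. c\<^sup>2 * (cmod (g x))\<^sup>2)"
    unfolding L2_norm_power2
    by (rule integral_mono_AE[OF square_integrable_integrable[OF si] int le'])
  also have "\<dots> = (c * L2_norm g)\<^sup>2"
    by (simp add: L2_norm_power2 power_mult_distrib)
  finally show "L2_norm f \<le> c * L2_norm g"
    by (rule power2_le_imp_le) (simp add: c)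
qed

lemma L2_norm_cong_AE:
  assumes "square_integrable g" "f \<in> borel_measurable borel" "AE x in lborel. f x = g x"
  shows "L2_norm f = L2_norm g"
  unfolding L2_norm_def
  by (rule arg_cong[where f = sqrt], rule integral_cong_AE)
    (use assms square_integrable_measurable[OF assms(1)] in auto)

lemma square_integrable_0 [simp]: "square_integrable (\<lambda>x. 0)"
  by (simp add: square_integrable_def)

lemma L2_norm_0 [simp]: "L2_norm (\<lambda>x. 0) = 0"
  by (simp add: L2_norm_def)

lemma square_integrable_add:
  assumes f: "square_integrable f" and g: "square_integrable g"
  shows "square_integrable (\<lambda>x. f x + g x)"
proof -
  note [measurable] = square_integrable_measurable[OF f] square_integrable_measurable[OF g]
  have int: "integrable lborel (\<lambda>x. 2 * (cmod (f x))\<^sup>2 + 2 * (cmod (g x))\<^sup>2)"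
    using assms[THEN square_integrable_integrable] by simp
  have "(cmod (f x + g x))\<^sup>2 \<le> 2 * (cmod (f x))\<^sup>2 + 2 * (cmod (g x))\<^sup>2" for x
  proof -
    have "(cmod (f x + g x))\<^sup>2 \<le> (cmod (f x) + cmod (g x))\<^sup>2"
      by (intro power_mono norm_triangle_ineq) simp
    also have "\<dots> \<le> 2 * (cmod (f x))\<^sup>2 + 2 * (cmod (g x))\<^sup>2"
      using sum_squares_bound[of "cmod (f x)" "cmod (g x)"] by (simp add: power2_sum)
    finally show ?thesis .
  qed
  then have "integrable lborel (\<lambda>x. (cmod (f x + g x))\<^sup>2)"
    by (intro Bochner_Integration.integrable_bound[OF int]) auto
  then show ?thesis by (simp add: square_integrable_def)
qed

lemma
  assumes f: "square_integrable f"
  shows square_integrable_scale: "square_integrable (\<lambda>x. c * f x)"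
    and L2_norm_scale: "L2_norm (\<lambda>x. c * f x) = cmod c * L2_norm f"
  using assms
  by (auto simp: square_integrable_def L2_norm_def norm_mult power_mult_distrib real_sqrt_mult)

lemma square_integrable_minus:
  "square_integrable f \<Longrightarrow> square_integrable (\<lambda>x. - f x)"
  using square_integrable_scale[of f "-1"] by simp

lemma square_integrable_diff:
  "square_integrable f \<Longrightarrow> square_integrable g \<Longrightarrow> square_integrable (\<lambda>x. f x - g x)"
  using square_integrable_add[OF _ square_integrable_minus] by simp

lemma L2_norm_diff_commute: "L2_norm (\<lambda>x. f x - g x) = L2_norm (\<lambda>x. g x - f x)"
  by (simp add: L2_norm_def norm_minus_commute)

lemma
  assumes f: "square_integrable f"
  shows square_integrable_cnj: "square_integrable (\<lambda>x. cnj (f x))"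
    and L2_norm_cnj: "L2_norm (\<lambda>x. cnj (f x)) = L2_norm f"
  using assms by (auto simp: square_integrable_def L2_norm_def)

lemma
  assumes f: "square_integrable f" and w [measurable]: "w \<in> borel_measurable borel"
    and le: "\<And>x. cmod (w x) \<le> B"
  shows square_integrable_mult_bounded: "square_integrable (\<lambda>x. w x * f x)"
    and L2_norm_mult_bounded: "L2_norm (\<lambda>x. w x * f x) \<le> B * L2_norm f"
proof -
  have B: "0 \<le> B" using order_trans[OF norm_ge_zero le] .
  have m: "(\<lambda>x. w x * f x) \<in> borel_measurable borel"
    using square_integrable_measurable[OF f] by measurable
  have le': "AE x in lborel. cmod (w x * f x) \<le> B * cmod (f x)"
    by (auto simp: norm_mult intro!: mult_right_mono le)
  show "square_integrable (\<lambda>x. w x * f x)" "L2_norm (\<lambda>x. w x * f x) \<le> B * L2_norm f"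
    using square_integrable_bound[OF f m le' B] L2_norm_bound[OF f m le' B] by auto
qed

text \<open>Cauchy-Schwarz from \<open>2 |f g| <= c |f|^2 + |g|^2 / c\<close>, optimised over
  \<open>c\<close> after integration; \<open>c = 1\<close> already gives integrability.\<close>

lemma
  assumes f: "square_integrable f" and g: "square_integrable g"
  shows integrable_mult: "integrable lborel (\<lambda>x. f x * g x)"
    and integral_norm_mult_le: "(LINT x|lborel. cmod (f x * g x)) \<le> L2_norm f * L2_norm g"
proof -
  note [measurable] = square_integrable_measurable[OF f] square_integrable_measurable[OF g]
  let ?a = "L2_norm f" and ?b = "L2_norm g" and ?I = "LINT x|lborel. cmod (f x * g x)"
  have amgm: "2 * cmod (f x * g x) \<le> c * (cmod (f x))\<^sup>2 + (cmod (g x))\<^sup>2 / c" if "0 < c" for c x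
  proof -
    have "0 \<le> (c * cmod (f x) - cmod (g x))\<^sup>2 / c" using that by simp
    also have "\<dots> = c * (cmod (f x))\<^sup>2 + (cmod (g x))\<^sup>2 / c - 2 * cmod (f x * g x)"
      using that by (simp add: norm_mult power2_diff field_simps power2_eq_square)
    finally show ?thesis by simp
  qed
  have int: "integrable lborel (\<lambda>x. c * (cmod (f x))\<^sup>2 + (cmod (g x))\<^sup>2 / c)" for c
    using assms[THEN square_integrable_integrable] by simp
  show intm: "integrable lborel (\<lambda>x. f x * g x)"
  proof (rule Bochner_Integration.integrable_bound[OF int[of 1]])
    have "cmod (f x * g x) \<le> norm ((cmod (f x))\<^sup>2 + (cmod (g x))\<^sup>2)" for x
      using amgm[of 1 x] norm_ge_zero[of "f x * g x"] by (simp del: norm_ge_zero)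
    then show "AE x in lborel. cmod (f x * g x) \<le> norm (1 * (cmod (f x))\<^sup>2 + (cmod (g x))\<^sup>2 / 1)"
      by simp
  qed simp
  have key: "2 * ?I \<le> c * ?a\<^sup>2 + ?b\<^sup>2 / c" if "0 < c" for c
  proof -
    have "2 * ?I = (LINT x|lborel. 2 * cmod (f x * g x))" by simp
    also have "\<dots> \<le> (LINT x|lborel. c * (cmod (f x))\<^sup>2 + (cmod (g x))\<^sup>2 / c)"
      using amgm[OF that] intm int by (intro integral_mono) (auto intro: integrable_norm)
    also have "\<dots> = c * ?a\<^sup>2 + ?b\<^sup>2 / c"
      using assms[THEN square_integrable_integrable] by (simp add: L2_norm_power2)
    finally show ?thesis .
  qed
  show "?I \<le> ?a * ?b"
  proof (cases "?a = 0 \<or> ?b = 0")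
    case False
    then have "0 < ?a" "0 < ?b" using L2_norm_nonneg[of f] L2_norm_nonneg[of g] by linarith+
    then show ?thesis using key[of "?b / ?a"] by (simp add: power2_eq_square)
  next
    case True
    \<comment> \<open>With a vanishing norm there is no optimal \<open>c\<close>: it is sent to
      infinity if \<open>?a = 0\<close> and to 0 if \<open>?b = 0\<close>. The \<open>+ 1\<close>
      keeps \<open>c\<close> positive and finite when both norms vanish.\<close>
    have "?I \<le> e" if e: "0 < e" for e
    proof (cases "?a = 0")
      case True
      have "0 < ?b\<^sup>2 + 1" by (simp add: add_nonneg_pos)
      then have "2 * ?I \<le> ?b\<^sup>2 / ((?b\<^sup>2 + 1) / e)"
        using key[of "(?b\<^sup>2 + 1) / e"] e True by simp
      also have "\<dots> \<le> e" using e \<open>0 < ?b\<^sup>2 + 1\<close> by (simp add: field_simps)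
      finally show ?thesis using e by simp
    next
      case False
      then have b: "?b = 0" using True by simp
      have "0 < ?a\<^sup>2 + 1" by (simp add: add_nonneg_pos)
      then have "2 * ?I \<le> e / (?a\<^sup>2 + 1) * ?a\<^sup>2"
        using key[of "e / (?a\<^sup>2 + 1)"] e b by simp
      also have "\<dots> \<le> e" using e \<open>0 < ?a\<^sup>2 + 1\<close> by (simp add: field_simps)
      finally show ?thesis using e by simp
    qed
    then have "?I \<le> 0" by (meson field_le_epsilon dense_ge)
    then show ?thesis using True by auto
  qed
qed

lemma norm_integral_mult_le:
  assumes "square_integrable f" "square_integrable g"
  shows "cmod (LINT x|lborel. f x * g x) \<le> L2_norm f * L2_norm g"
  by (rule order_trans[OF integral_norm_bound integral_norm_mult_le[OF assms]])

section \<open>The inner product of \<open>L^2\<close>, antilinear in its first argument\<close>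

definition L2_inner :: "(real \<Rightarrow> complex) \<Rightarrow> (real \<Rightarrow> complex) \<Rightarrow> complex" where
  "L2_inner f g = (LINT x|lborel. cnj (f x) * g x)"

lemma integrable_L2_inner:
  "square_integrable f \<Longrightarrow> square_integrable g \<Longrightarrow> integrable lborel (\<lambda>x. cnj (f x) * g x)"
  by (intro integrable_mult square_integrable_cnj)

lemma norm_L2_inner_le:
  "square_integrable f \<Longrightarrow> square_integrable g \<Longrightarrow> cmod (L2_inner f g) \<le> L2_norm f * L2_norm g"
  unfolding L2_inner_def
  using norm_integral_mult_le[OF square_integrable_cnj] L2_norm_cnj by metis

lemma L2_inner_self: "L2_inner f f = of_real ((L2_norm f)\<^sup>2)"
  unfolding L2_inner_def L2_norm_power2 integral_complex_of_real[symmetric]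
  by (intro Bochner_Integration.integral_cong) (auto simp: complex_norm_square mult.commute simp del: of_real_power)

lemma L2_inner_commute: "L2_inner g f = cnj (L2_inner f g)"
  unfolding L2_inner_def Bochner_Integration.integral_cnj[symmetric] by (simp add: mult.commute)

lemma L2_inner_add_right:
  "square_integrable f \<Longrightarrow> square_integrable g \<Longrightarrow> square_integrable k \<Longrightarrow>
    L2_inner f (\<lambda>x. g x + k x) = L2_inner f g + L2_inner f k"
  by (simp add: L2_inner_def distrib_left integrable_L2_inner)

lemma L2_inner_diff_right:
  "square_integrable f \<Longrightarrow> square_integrable g \<Longrightarrow> square_integrable k \<Longrightarrow>
    L2_inner f (\<lambda>x. g x - k x) = L2_inner f g - L2_inner f k"
  by (simp add: L2_inner_def right_diff_distrib integrable_L2_inner)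

lemma L2_inner_diff_left:
  "square_integrable f \<Longrightarrow> square_integrable g \<Longrightarrow> square_integrable k \<Longrightarrow>
    L2_inner (\<lambda>x. g x - k x) f = L2_inner g f - L2_inner k f"
  by (simp add: L2_inner_def left_diff_distrib integrable_L2_inner)

lemma L2_inner_scale_right: "L2_inner f (\<lambda>x. c * g x) = c * L2_inner f g"
  by (simp add: L2_inner_def mult.left_commute[of _ c])

lemma L2_inner_cong_AE:
  assumes "AE x in lborel. g x = k x" "g \<in> borel_measurable borel" "k \<in> borel_measurable borel"
    "f \<in> borel_measurable borel"
  shows "L2_inner f g = L2_inner f k"
proof -
  note [measurable] = assms(2-)
  show ?thesis unfolding L2_inner_def
    by (intro integral_cong_AE) (use assms(1) in auto)
qed

lemma L2_norm_add_power2: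
  assumes "square_integrable f" "square_integrable g"
  shows "(L2_norm (\<lambda>x. f x + g x))\<^sup>2 = (L2_norm f)\<^sup>2 + 2 * Re (L2_inner f g) + (L2_norm g)\<^sup>2"
proof -
  have "(cmod (a + b))\<^sup>2 = (cmod a)\<^sup>2 + 2 * Re (cnj a * b) + (cmod b)\<^sup>2" for a b
    unfolding cmod_power2 by (simp add: power2_eq_square algebra_simps)
  then show ?thesis
    using assms[THEN square_integrable_integrable] integrable_L2_inner[OF assms]
      integrable_Re[OF integrable_L2_inner[OF assms]] integral_Re[OF integrable_L2_inner[OF assms]]
    by (simp add: L2_norm_power2 L2_inner_def del: times_complex.sel)
qed

lemma L2_norm_triangle:
  assumes "square_integrable f" "square_integrable g"
  shows "L2_norm (\<lambda>x. f x + g x) \<le> L2_norm f + L2_norm g"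
proof (rule power2_le_imp_le)
  have "Re (L2_inner f g) \<le> L2_norm f * L2_norm g"
    using norm_L2_inner_le[OF assms] complex_Re_le_cmod order_trans by blast
  then show "(L2_norm (\<lambda>x. f x + g x))\<^sup>2 \<le> (L2_norm f + L2_norm g)\<^sup>2"
    by (simp add: L2_norm_add_power2[OF assms] power2_sum)
qed simp

lemma L2_norm_triangle_diff:
  assumes "square_integrable f" "square_integrable g"
  shows "L2_norm (\<lambda>x. f x - g x) \<le> L2_norm f + L2_norm g"
  using L2_norm_triangle[OF assms(1) square_integrable_minus[OF assms(2)]]
    L2_norm_scale[OF assms(2), of "-1"] by simp

lemma L2_norm_le_add_diff:
  assumes "square_integrable f" "square_integrable g"
  shows "L2_norm f \<le> L2_norm g + L2_norm (\<lambda>x. f x - g x)"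
  using L2_norm_triangle[OF assms(2) square_integrable_diff[OF assms]] by simp

text \<open>Fatou's lemma for \<open>|f n|^2\<close>. Uniform bounds survive a limit this way, both
  when weight cutoffs are removed and when quotients become derivatives; membership of the limit in
  \<open>L^2\<close> is a conclusion.\<close>

lemma L2_fatou:
  assumes f: "\<And>n. square_integrable (f n)" and g [measurable]: "g \<in> borel_measurable borel"
    and lim: "AE x in lborel. (\<lambda>n. f n x) \<longlonglongrightarrow> g x"
    and le: "\<And>n. L2_norm (f n) \<le> B"
  shows "square_integrable g" "L2_norm g \<le> B"
proof -
  note [measurable] = square_integrable_measurable[OF f]
  have B: "0 \<le> B" using L2_norm_nonneg[of "f 0"] le[of 0] by linarith
  have "(\<integral>\<^sup>+x. ennreal ((cmod (g x))\<^sup>2) \<partial>lborel)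
      = (\<integral>\<^sup>+x. liminf (\<lambda>n. ennreal ((cmod (f n x))\<^sup>2)) \<partial>lborel)"
  proof (rule nn_integral_cong_AE)
    show "AE x in lborel. ennreal ((cmod (g x))\<^sup>2) = liminf (\<lambda>n. ennreal ((cmod (f n x))\<^sup>2))"
      using lim
    proof eventually_elim
      case (elim x)
      have "(\<lambda>n. ennreal ((cmod (f n x))\<^sup>2)) \<longlonglongrightarrow> ennreal ((cmod (g x))\<^sup>2)"
        by (intro tendsto_ennrealI tendsto_intros elim)
      then show ?case by (metis lim_imp_Liminf trivial_limit_sequentially)
    qed
  qed
  also have "\<dots> \<le> liminf (\<lambda>n. \<integral>\<^sup>+x. ennreal ((cmod (f n x))\<^sup>2) \<partial>lborel)"
    by (rule nn_integral_liminf) simp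
  also have "\<dots> \<le> liminf (\<lambda>n::nat. ennreal (B\<^sup>2))"
  proof (rule Liminf_mono, rule always_eventually, rule allI)
    fix n
    have "(\<integral>\<^sup>+x. ennreal ((cmod (f n x))\<^sup>2) \<partial>lborel) = ennreal ((L2_norm (f n))\<^sup>2)"
      unfolding L2_norm_power2
      by (rule nn_integral_eq_integral) (auto intro: square_integrable_integrable f)
    also have "\<dots> \<le> ennreal (B\<^sup>2)"
      by (intro ennreal_leI power_mono le) simp
    finally show "(\<integral>\<^sup>+x. ennreal ((cmod (f n x))\<^sup>2) \<partial>lborel) \<le> ennreal (B\<^sup>2)" .
  qed
  also have "\<dots> = ennreal (B\<^sup>2)" by (simp add: Liminf_const)
  finally have *: "(\<integral>\<^sup>+x. ennreal ((cmod (g x))\<^sup>2) \<partial>lborel) \<le> ennreal (B\<^sup>2)" .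
  then have int: "integrable lborel (\<lambda>x. (cmod (g x))\<^sup>2)"
    by (intro integrableI_bounded) (auto simp: top_unique less_top[symmetric] power2_eq_square)
  then show "square_integrable g" by (simp add: square_integrable_def)
  have "ennreal ((L2_norm g)\<^sup>2) \<le> ennreal (B\<^sup>2)"
    unfolding L2_norm_power2 using nn_integral_eq_integral[OF int] * by simp
  then have "(L2_norm g)\<^sup>2 \<le> B\<^sup>2" by (simp add: ennreal_le_iff)
  then show "L2_norm g \<le> B" using B by (rule power2_le_imp_le)
qed

section \<open>Translations and the invariance of Lebesgue measure\<close>

definition shift :: "real \<Rightarrow> (real \<Rightarrow> 'a) \<Rightarrow> real \<Rightarrow> 'a" where
  "shift y f = (\<lambda>x. f (x + y))"

lemma shift_apply [simp]: "shift y f x = f (x + y)"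
  by (simp add: shift_def)

lemma measurable_shift [measurable (raw)]:
  "f \<in> borel_measurable borel \<Longrightarrow> shift y f \<in> borel_measurable borel"
  unfolding shift_def by simp

lemma integral_lborel_shift:
  fixes f :: "real \<Rightarrow> 'a::{banach, second_countable_topology}"
  shows "(LINT x|lborel. f (x + y)) = (LINT x|lborel. f x)"
  using lborel_integral_real_affine[of 1 f y] by (simp add: add.commute)

lemma integrable_lborel_shift:
  fixes f :: "real \<Rightarrow> 'a::{banach, second_countable_topology}"
  shows "integrable lborel (\<lambda>x. f (x + y)) \<longleftrightarrow> integrable lborel f"
  using lborel_integrable_real_affine_iff[of 1 f y] by (simp add: add.commute)

lemma AE_lborel_shift:
  assumes "AE x in lborel. P x"
  shows "AE x in lborel. P (x + y)"
proof -
  have "AE x in distr lborel borel (\<lambda>x. y + x). P x"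
    unfolding lborel_distr_plus by (rule assms)
  then have "AE x in lborel. P (y + x)"
    by (rule AE_distrD[rotated]) simp
  then show ?thesis by (simp add: add.commute)
qed

lemma
  assumes "square_integrable f"
  shows square_integrable_shift: "square_integrable (shift y f)"
    and L2_norm_shift: "L2_norm (shift y f) = L2_norm f"
  using assms integral_lborel_shift[of "\<lambda>x. (cmod (f x))\<^sup>2" y]
    integrable_lborel_shift[of "\<lambda>x. (cmod (f x))\<^sup>2" y]
  by (auto simp: square_integrable_def L2_norm_def)

lemma L2_inner_shift: "L2_inner (shift y f) (shift y g) = L2_inner f g"
  using integral_lborel_shift[of "\<lambda>x. cnj (f x) * g x" y] by (simp add: L2_inner_def)

lemma L2_inner_shift_left: "L2_inner (shift y f) g = L2_inner f (shift (- y) g)"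
  using L2_inner_shift[of "-y" "shift y f" g] by (simp add: shift_def)

lemma
  assumes "a \<le> b"
  shows square_integrable_indicator: "square_integrable (\<lambda>x. of_real (indicator {a..b} x))"
    and L2_norm_indicator: "L2_norm (\<lambda>x. of_real (indicator {a..b} x)) = sqrt (b - a)"
proof -
  have "(\<lambda>x. (cmod (of_real (indicator {a..b} x)))\<^sup>2) = (\<lambda>x. indicator {a..b} x :: real)"
    by (auto simp: indicator_def)
  then show "square_integrable (\<lambda>x. of_real (indicator {a..b} x))"
    "L2_norm (\<lambda>x. of_real (indicator {a..b} x)) = sqrt (b - a)"
    using assms by (simp_all add: square_integrable_def L2_norm_def emeasure_lborel_Icc_eq)
qed

lemma set_integrable_square_integrable:
  assumes f: "square_integrable f"
  shows "set_integrable lborel {a..b} f"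
proof (cases "a \<le> b")
  case True
  from integrable_mult[OF square_integrable_indicator[OF this] f] show ?thesis
    by (simp add: set_integrable_def scaleR_conv_of_real)
qed (simp add: set_integrable_def)

lemma locally_integrable_square_integrable: "square_integrable f \<Longrightarrow> locally_integrable f"
  by (simp add: locally_integrable_def set_integrable_square_integrable)


section \<open>Test functions\<close>

text \<open>The smoothness condition of \<open>test_function\<close>, truncated at order
  \<open>n\<close> and peeled from the first derivative, so that closure under sums, products and
  affine substitutions follows by induction on \<open>n\<close> for all functions at once.\<close>

primrec times_differentiable :: "nat \<Rightarrow> (real \<Rightarrow> real) \<Rightarrow> bool" where
  "times_differentiable 0 f \<longleftrightarrow> True"
| "times_differentiable (Suc n) f \<longleftrightarrow>
     (\<forall>x. f differentiable (at x)) \<and> times_differentiable n (deriv f)"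

lemma times_differentiable_iff:
  "times_differentiable n f \<longleftrightarrow> (\<forall>m<n. \<forall>x. (deriv ^^ m) f differentiable (at x))"
  by (induction n arbitrary: f)
    (auto simp: All_less_Suc2 funpow_swap1)

lemma times_differentiable_Suc_D:
  "times_differentiable (Suc n) f \<Longrightarrow> times_differentiable n f"
  by (simp add: times_differentiable_iff)

lemma real_differentiable_DERIV:
  fixes f :: "real \<Rightarrow> real"
  shows "f differentiable (at x) \<Longrightarrow> (f has_field_derivative deriv f x) (at x)"
  by (simp add: DERIV_deriv_iff_real_differentiable)

lemma times_differentiable_add:
  "times_differentiable n f \<Longrightarrow> times_differentiable n g \<Longrightarrow>
    times_differentiable n (\<lambda>x. f x + g x)"
proof (induction n arbitrary: f g)
  case (Suc n)
  then have "((\<lambda>x. f x + g x) has_field_derivative deriv f x + deriv g x) (at x)" for x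
    by (auto intro!: DERIV_add real_differentiable_DERIV)
  from DERIV_imp_deriv[OF this] have "deriv (\<lambda>x. f x + g x) = (\<lambda>x. deriv f x + deriv g x)" by auto
  with Suc show ?case by auto
qed simp

lemma times_differentiable_mult:
  "times_differentiable n f \<Longrightarrow> times_differentiable n g \<Longrightarrow>
    times_differentiable n (\<lambda>x. f x * g x)"
proof (induction n arbitrary: f g)
  case (Suc n)
  then have "((\<lambda>x. f x * g x) has_field_derivative deriv f x * g x + f x * deriv g x) (at x)" for x
    by (auto intro!: derivative_eq_intros real_differentiable_DERIV)
  from DERIV_imp_deriv[OF this]
  have "deriv (\<lambda>x. f x * g x) = (\<lambda>x. deriv f x * g x + f x * deriv g x)" by auto
  moreover have "times_differentiable n (\<lambda>x. deriv f x * g x)" "times_differentiable n (\<lambda>x. f x * deriv g x)"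
    using Suc.prems times_differentiable_Suc_D by (auto intro!: Suc.IH)
  ultimately show ?case using Suc.prems by (auto intro: times_differentiable_add)
qed simp

lemma times_differentiable_affine:
  "times_differentiable n f \<Longrightarrow> times_differentiable n (\<lambda>x. c * f (a * x + b))"
proof (induction n arbitrary: f c)
  case (Suc n)
  have *: "((\<lambda>x. c * f (a * x + b)) has_field_derivative (c * a) * deriv f (a * x + b)) (at x)" for x
  proof -
    have "((\<lambda>x. f (a * x + b)) has_field_derivative deriv f (a * x + b) * a) (at x)"
      using Suc.prems
      by (intro DERIV_chain2[of f] real_differentiable_DERIV) (auto intro!: derivative_eq_intros)
    from DERIV_cmult[OF this, of c] show ?thesis by (simp add: mult_ac)
  qed
  from DERIV_imp_deriv[OF *]
  have "deriv (\<lambda>x. c * f (a * x + b)) = (\<lambda>x. (c * a) * deriv f (a * x + b))" by auto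
  moreover have "(\<lambda>x. c * f (a * x + b)) differentiable (at x)" for x
    using *[of x] by (auto simp: real_differentiable_def)
  ultimately show ?case using Suc by auto
qed simp

lemma test_function_iff:
  "test_function \<phi> \<longleftrightarrow> (\<forall>n. times_differentiable n \<phi>) \<and> (\<exists>a. \<forall>x. \<phi> x \<noteq> 0 \<longrightarrow> \<bar>x\<bar> \<le> a)"
proof -
  have "(\<forall>n x. (deriv ^^ n) \<phi> differentiable (at x)) \<longleftrightarrow> (\<forall>n. times_differentiable n \<phi>)"
    by (auto simp: times_differentiable_iff)
  moreover have "compact (closure {x. \<phi> x \<noteq> 0}) \<longleftrightarrow> (\<exists>a. \<forall>x. \<phi> x \<noteq> 0 \<longrightarrow> \<bar>x\<bar> \<le> a)"
    by (simp add: compact_closure bounded_iff)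
  ultimately show ?thesis by (simp add: test_function_def)
qed

lemma test_function_DERIV:
  "test_function \<phi> \<Longrightarrow> (\<phi> has_field_derivative deriv \<phi> x) (at x)"
  unfolding test_function_def
  by (intro real_differentiable_DERIV) (metis funpow_0)

lemma test_function_continuous: "test_function \<phi> \<Longrightarrow> continuous_on A \<phi>"
  by (meson DERIV_continuous continuous_at_imp_continuous_on test_function_DERIV)

lemma test_function_measurable [measurable_dest]:
  "test_function \<phi> \<Longrightarrow> \<phi> \<in> borel_measurable borel"
  by (intro borel_measurable_continuous_onI test_function_continuous)

lemma test_function_support:
  assumes "test_function \<phi>"
  obtains a where "0 < a" "\<And>x. a < \<bar>x\<bar> \<Longrightarrow> \<phi> x = 0"
proof -
  obtain a where "\<And>x. \<phi> x \<noteq> 0 \<Longrightarrow> \<bar>x\<bar> \<le> a" using assms by (auto simp: test_function_iff)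
  then show ?thesis by (intro that[of "max a 1"]) force+
qed

lemma test_function_deriv:
  assumes "test_function \<phi>"
  shows "test_function (deriv \<phi>)"
proof -
  obtain a where a: "0 < a" "\<And>x. a < \<bar>x\<bar> \<Longrightarrow> \<phi> x = 0" using test_function_support[OF assms] by blast
  have "deriv \<phi> x = 0" if "a < \<bar>x\<bar>" for x
  proof -
    have ev: "eventually (\<lambda>y. a < \<bar>y\<bar>) (nhds x)"
      using that by (intro order_tendstoD) (auto intro!: tendsto_intros filterlim_ident)
    have "(\<phi> has_field_derivative 0) (at x)"
      by (subst DERIV_cong_ev[OF refl _ refl, where g = "\<lambda>_. 0"])
        (use ev a in \<open>auto elim: eventually_mono\<close>)
    then show ?thesis by (rule DERIV_imp_deriv)
  qed
  then have "\<forall>x. deriv \<phi> x \<noteq> 0 \<longrightarrow> \<bar>x\<bar> \<le> a" by (meson not_le)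
  moreover have "times_differentiable n (deriv \<phi>)" for n
    using assms unfolding test_function_iff by (metis times_differentiable.simps(2))
  ultimately show ?thesis unfolding test_function_iff by blast
qed

lemma test_function_shift:
  assumes "test_function \<phi>"
  shows "test_function (\<lambda>x. \<phi> (x + y))"
proof -
  obtain a where a: "0 < a" "\<And>x. a < \<bar>x\<bar> \<Longrightarrow> \<phi> x = 0" using test_function_support[OF assms] by blast
  have "\<phi> (x + y) \<noteq> 0 \<longrightarrow> \<bar>x\<bar> \<le> a + \<bar>y\<bar>" for x
    using a(2)[of "x + y"] abs_triangle_ineq2[of x "- y"] by fastforce
  moreover have "times_differentiable n (\<lambda>x. \<phi> (x + y))" for n
    using times_differentiable_affine[of n \<phi> 1 1 y] assms by (simp add: test_function_iff)
  ultimately show ?thesis unfolding test_function_iff by blast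
qed

lemma test_function_bounded:
  assumes "test_function \<phi>"
  obtains M where "0 \<le> M" "\<And>x. \<bar>\<phi> x\<bar> \<le> M"
proof -
  obtain a where a: "0 < a" "\<And>x. a < \<bar>x\<bar> \<Longrightarrow> \<phi> x = 0" using test_function_support[OF assms] by blast
  have "bounded (\<phi> ` {-a..a})"
    by (intro compact_imp_bounded compact_continuous_image test_function_continuous assms) simp
  then obtain M where M: "\<And>x. x \<in> {-a..a} \<Longrightarrow> \<bar>\<phi> x\<bar> \<le> M" unfolding bounded_iff real_norm_def by blast
  have "0 \<le> M" using M[of 0] a(1) by auto
  moreover have "\<bar>\<phi> x\<bar> \<le> M" for x
  proof (cases "a < \<bar>x\<bar>")
    case False
    then show ?thesis by (intro M) auto
  qed (simp add: a(2) \<open>0 \<le> M\<close>)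
  ultimately show ?thesis by (rule that)
qed

lemma square_integrable_test_function:
  assumes "test_function \<phi>"
  shows "square_integrable (\<lambda>x. of_real (\<phi> x))"
proof -
  obtain a where a: "0 < a" "\<And>x. a < \<bar>x\<bar> \<Longrightarrow> \<phi> x = 0" using test_function_support[OF assms] by blast
  obtain M where M: "0 \<le> M" "\<And>x. \<bar>\<phi> x\<bar> \<le> M" using test_function_bounded[OF assms] by blast
  have "square_integrable (\<lambda>x. of_real (indicator {-a..a} x))"
    using a(1) by (intro square_integrable_indicator) simp
  then show ?thesis
    by (rule square_integrable_bound[where c = M])
      (use M a(2) test_function_measurable[OF assms] in \<open>auto simp: indicator_def\<close>)
qed

text \<open>The classical smooth flat function \<open>exp (- 1/t)\<close>, enlarged to a family with
  polynomial factors in \<open>1/t\<close> because this family is closed under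
  differentiation.\<close>

definition bump :: "real poly \<Rightarrow> real \<Rightarrow> real" where
  "bump p t = (if 0 < t then poly p (1 / t) * exp (- (1 / t)) else 0)"

text \<open>The extra power \<open>u ^ k\<close> absorbs the factor \<open>u\<close> released by
  each coefficient of the polynomial, which is why \<open>k\<close> varies in the induction.\<close>

lemma poly_exp_tendsto_0:
  "((\<lambda>u::real. u ^ k * poly p u * exp (- u)) \<longlongrightarrow> 0) at_top"
proof (induction p arbitrary: k)
  case (pCons a p)
  have "((\<lambda>u::real. a * (u ^ k / exp u) + u ^ Suc k * poly p u * exp (- u)) \<longlongrightarrow> a * 0 + 0) at_top"
    by (intro tendsto_intros tendsto_power_div_exp_0 pCons.IH)
  then show ?case by (simp add: field_simps exp_minus)
qed simp

text \<open>This is the difference quotient at 0, the only point where smoothness is in question;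
  the substitution \<open>u = 1/t\<close> turns it into decay at infinity.\<close>

lemma bump_over_id_tendsto_0: "((\<lambda>t. bump p t / t) \<longlongrightarrow> 0) (at 0)"
proof -
  have "((\<lambda>t::real. (1/t) ^ 1 * poly p (1/t) * exp (- (1/t))) \<longlongrightarrow> 0) (at_right 0)"
    by (rule filterlim_compose[OF poly_exp_tendsto_0])
      (simp add: filterlim_inverse_at_top_right inverse_eq_divide[symmetric])
  then have "((\<lambda>t. bump p t / t) \<longlongrightarrow> 0) (at_right 0)"
    by (rule Lim_transform_eventually)
      (auto simp: bump_def eventually_at_filter intro!: always_eventually)
  moreover have "((\<lambda>t. bump p t / t) \<longlongrightarrow> 0) (at_left 0)"
    by (rule Lim_transform_eventually[OF tendsto_const])
      (auto simp: bump_def eventually_at_filter intro!: always_eventually)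
  ultimately show ?thesis using filterlim_split_at_real by blast
qed

text \<open>With \<open>u = 1/t\<close> one has \<open>d/dt = - u^2 d/du\<close>, which sends
  \<open>p(u) exp(-u)\<close> to \<open>u^2 (p - p')(u) exp(-u)\<close>; this is the polynomial in
  the statement.\<close>

lemma DERIV_bump: "(bump p has_field_derivative bump (monom 1 2 * (p - pderiv p)) t) (at t)"
proof (cases "t = 0")
  case True
  then show ?thesis
    using bump_over_id_tendsto_0[of p] by (simp add: has_field_derivative_iff bump_def)
next
  case False
  show ?thesis
  proof (cases "0 < t")
    case True
    have ev: "eventually (\<lambda>s. (0::real) < s) (nhds t)"
      using True by (intro order_tendstoD) (auto intro: filterlim_ident)
    have "((\<lambda>t. poly p (1 / t) * exp (- (1 / t))) has_field_derivative
        bump (monom 1 2 * (p - pderiv p)) t) (at t)"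
      using True
      by (auto intro!: derivative_eq_intros simp: bump_def poly_monom field_simps power2_eq_square)
    moreover have "eventually (\<lambda>s. bump p s = poly p (1 / s) * exp (- (1 / s))) (nhds t)"
      using ev by eventually_elim (simp add: bump_def)
    ultimately show ?thesis by (simp add: DERIV_cong_ev)
  next
    case f: False
    then have ev: "eventually (\<lambda>s. s < (0::real)) (nhds t)"
      using False by (intro order_tendstoD) (auto intro: filterlim_ident)
    have "eventually (\<lambda>s. bump p s = 0) (nhds t)"
      using ev by eventually_elim (simp add: bump_def)
    then show ?thesis using f by (simp add: DERIV_cong_ev bump_def)
  qed
qed

lemma times_differentiable_bump: "times_differentiable n (bump p)"
proof (induction n arbitrary: p)
  case (Suc n)
  have "deriv (bump p) = bump (monom 1 2 * (p - pderiv p))"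
    using DERIV_imp_deriv[OF DERIV_bump] by auto
  then show ?case using Suc DERIV_bump by (auto simp: real_differentiable_def)
qed simp

text \<open>A product of two copies of \<open>exp (- 1/t)\<close>, one facing inwards at each end,
  with slopes \<open>n + 1\<close> that steepen. The limit is the open interval while domination
  uses the closed one; the two differ by a null set.\<close>

lemma indicator_test_function_approx:
  fixes a b :: real
  obtains \<phi> :: "nat \<Rightarrow> real \<Rightarrow> real" where
    "\<And>n. test_function (\<phi> n)" "\<And>n x. \<bar>\<phi> n x\<bar> \<le> indicator {a..b} x"
    "\<And>x. (\<lambda>n. \<phi> n x) \<longlonglongrightarrow> indicator {a<..<b} x"
proof
  define \<phi> where "\<phi> n x = bump 1 (real (Suc n) * x + (- a * real (Suc n)))
    * bump 1 (- real (Suc n) * x + b * real (Suc n))" for n x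
  have \<phi>_eq: "\<phi> n x = bump 1 (real (Suc n) * (x - a)) * bump 1 (real (Suc n) * (b - x))" for n x
    by (simp add: \<phi>_def algebra_simps)
  have zero: "\<phi> n x = 0" if "x \<notin> {a<..<b}" for n x
    using that by (auto simp: \<phi>_eq bump_def zero_less_mult_iff)
  show "test_function (\<phi> n)" for n
  proof -
    have "times_differentiable m (\<phi> n)" for m
      unfolding \<phi>_def
      using times_differentiable_affine[OF times_differentiable_bump, of m 1] 
      by (intro times_differentiable_mult) (metis (no_types, lifting) ext mult_1)+
    moreover have "\<phi> n x \<noteq> 0 \<longrightarrow> \<bar>x\<bar> \<le> \<bar>a\<bar> + \<bar>b\<bar>" for x using zero[of x n] by fastforce
    ultimately show ?thesis unfolding test_function_iff by blast
  qed
  have "0 \<le> bump 1 t \<and> bump 1 t \<le> 1" for t by (auto simp: bump_def)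
  then have "\<bar>\<phi> n x\<bar> \<le> 1" for n x
    unfolding \<phi>_eq abs_mult by (intro mult_le_one) auto
  then show "\<bar>\<phi> n x\<bar> \<le> indicator {a..b} x" for n x
    using zero[of x n] by (auto simp: indicator_def)
  have lim: "(\<lambda>n. bump 1 (real (Suc n) * t)) \<longlonglongrightarrow> 1" if "0 < t" for t
  proof -
    have "(\<lambda>n. exp (- ((1 / t) * (1 / real (Suc n))))) \<longlonglongrightarrow> exp (- ((1 / t) * 0))"
      by (intro tendsto_intros LIMSEQ_Suc[OF lim_1_over_n])
    moreover have "0 < real (Suc n) * t" for n using that by simp
    ultimately show ?thesis by (simp add: bump_def mult.commute del: of_nat_Suc)
  qed
  show "(\<lambda>n. \<phi> n x) \<longlonglongrightarrow> indicator {a<..<b} x" for x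
  proof (cases "x \<in> {a<..<b}")
    case True
    then have "(\<lambda>n. \<phi> n x) \<longlonglongrightarrow> 1 * 1"
      unfolding \<phi>_eq by (intro tendsto_mult lim) auto
    with True show ?thesis by simp
  qed (simp add: zero)
qed

text \<open>The sets over which \<open>k\<close> integrates to 0 are closed under complements and
  disjoint unions, hence include all Borel sets; testing with the sets where the real or imaginary
  part has a fixed sign finishes the proof.\<close>

lemma integral_interval_eq_0_imp_AE_0:
  fixes k :: "real \<Rightarrow> complex"
  assumes k: "integrable lborel k" and 0: "\<And>a b. (LINT x|lborel. indicator {a..b} x *\<^sub>R k x) = 0"
  shows "AE x in lborel. k x = 0"
proof -
  have seg: "(\<lambda>n. LINT x|lborel. indicator {- real n..real n} x *\<^sub>R k x) \<longlonglongrightarrow> (LINT x|lborel. k x)"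
  proof (rule integral_dominated_convergence[where w = "\<lambda>x. norm (k x)"])
    show "AE x in lborel. (\<lambda>n. indicator {- real n..real n} x *\<^sub>R k x) \<longlonglongrightarrow> k x"
    proof (rule AE_I2)
      fix x
      obtain N where N: "\<bar>x\<bar> \<le> real N" using real_arch_simple by blast
      have "eventually (\<lambda>n. indicator {- real n..real n} x *\<^sub>R k x = k x) sequentially"
        using eventually_ge_at_top[of N] by eventually_elim (use N in \<open>auto simp: indicator_def\<close>)
      then show "(\<lambda>n. indicator {- real n..real n} x *\<^sub>R k x) \<longlonglongrightarrow> k x" by (rule tendsto_eventually)
    qed
  qed (use k in \<open>auto simp: indicator_def\<close>)
  \<comment> \<open>Complements require the integral over the whole line, which is not an interval
    of the assumption but a limit of such intervals.\<close>
  then have total: "(LINT x|lborel. k x) = 0" using 0 by (simp add: LIMSEQ_const_iff)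
  have int: "integrable lborel (\<lambda>x. indicator A x *\<^sub>R k x)" if "A \<in> sets borel" for A
    using k that by (intro integrable_mult_indicator) auto
  have all: "(LINT x|lborel. indicator A x *\<^sub>R k x) = 0" if "A \<in> sets borel" for A
    using that
  proof (induction rule: borel_set_induct)
    case (compl A)
    have "(LINT x|lborel. indicator (- A) x *\<^sub>R k x) = (LINT x|lborel. k x - indicator A x *\<^sub>R k x)"
      by (intro Bochner_Integration.integral_cong) (auto simp: indicator_def)
    also have "\<dots> = 0" using k int[OF compl(1)] compl total by simp
    finally show ?case .
  next
    case (union f)
    have "set_lebesgue_integral lborel (\<Union>i. f i) k = (\<Sum>i. set_lebesgue_integral lborel (f i) k)"
    proof (rule lebesgue_integral_countable_add)
      show "f i \<inter> f j = {}" if "i \<noteq> j" for i j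
        using union(1) that by (auto simp: disjoint_family_on_def)
      show "set_integrable lborel (\<Union>i. f i) k"
        unfolding set_integrable_def using union by (intro int) auto
    qed (use union in auto)
    then show ?case using union by (simp add: set_lebesgue_integral_def)
  qed (use 0 in auto)
  have real: "AE x in lborel. r x = 0"
    if r: "integrable lborel r" and r0: "\<And>A. A \<in> sets borel \<Longrightarrow> (LINT x|lborel. indicator A x * r x) = 0"
    for r :: "real \<Rightarrow> real"
  proof -
    note [measurable] = borel_measurable_integrable[OF r]
    have "(LINT x|lborel. \<bar>r x\<bar>) = (LINT x|lborel. indicator {x. 0 \<le> r x} x * r x - indicator {x. r x < 0} x * r x)"
      by (intro Bochner_Integration.integral_cong) (auto simp: indicator_def)
    also have "\<dots> = 0"
      using r0[of "{x. 0 \<le> r x}"] r0[of "{x. r x < 0}"]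
        integrable_mult_indicator[OF _ r, of "{x. 0 \<le> r x}"] integrable_mult_indicator[OF _ r, of "{x. r x < 0}"]
      by simp
    finally have "AE x in lborel. \<bar>r x\<bar> = 0"
      using r by (subst (asm) integral_nonneg_eq_0_iff_AE) auto
    then show ?thesis by simp
  qed
  have "AE x in lborel. Re (k x) = 0"
    using k all integral_Re[OF int] by (intro real) (auto simp: integrable_Re)
  moreover have "AE x in lborel. Im (k x) = 0"
    using k all integral_Im[OF int] by (intro real) (auto simp: integrable_Im)
  ultimately show ?thesis by eventually_elim (simp add: complex_eq_iff)
qed

lemma fundamental_lemma:
  assumes k: "square_integrable k"
    and 0: "\<And>\<phi>. test_function \<phi> \<Longrightarrow> (LINT x|lborel. k x * of_real (\<phi> x)) = 0"
  shows "AE x in lborel. k x = 0"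
proof -
  note [measurable] = square_integrable_measurable[OF k]
  have seg: "(LINT x|lborel. indicator {a..b} x *\<^sub>R k x) = 0" for a b
  proof -
    obtain \<phi> :: "nat \<Rightarrow> real \<Rightarrow> real" where \<phi>: "\<And>n. test_function (\<phi> n)"
      "\<And>n x. \<bar>\<phi> n x\<bar> \<le> indicator {a..b} x" "\<And>x. (\<lambda>n. \<phi> n x) \<longlonglongrightarrow> indicator {a<..<b} x"
      using indicator_test_function_approx[of a b] by blast
    note [measurable] = test_function_measurable[OF \<phi>(1)]
    have "(\<lambda>n. LINT x|lborel. k x * of_real (\<phi> n x))
        \<longlonglongrightarrow> (LINT x|lborel. k x * of_real (indicator {a<..<b} x))"
    proof (rule integral_dominated_convergence[where w = "\<lambda>x. indicator {a..b} x * norm (k x)"])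
      show "integrable lborel (\<lambda>x. indicator {a..b} x * norm (k x))"
        using integrable_norm[OF set_integrable_square_integrable[OF k, of a b, unfolded set_integrable_def]]
        by (simp add: indicator_def)
      show "AE x in lborel. (\<lambda>n. k x * of_real (\<phi> n x)) \<longlonglongrightarrow> k x * of_real (indicator {a<..<b} x)"
        by (intro AE_I2 tendsto_intros \<phi>)
      show "AE x in lborel. norm (k x * of_real (\<phi> n x)) \<le> indicator {a..b} x * norm (k x)" for n
        using \<phi>(2)[of n] by (auto simp: norm_mult mult.commute intro!: AE_I2 mult_left_mono)
    qed auto
    then have "(LINT x|lborel. k x * of_real (indicator {a<..<b} x)) = 0"
      using 0[OF \<phi>(1)] by (simp add: LIMSEQ_const_iff)
    moreover have "AE x in lborel. x \<noteq> a" "AE x in lborel. x \<noteq> b"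
      using AE_lborel_singleton by auto
    then have "AE x in lborel. indicator {a..b} x *\<^sub>R k x = k x * of_real (indicator {a<..<b} x)"
      by eventually_elim (auto simp: indicator_def)
    then have "(LINT x|lborel. indicator {a..b} x *\<^sub>R k x) = (LINT x|lborel. k x * of_real (indicator {a<..<b} x))"
      by (intro integral_cong_AE) auto
    ultimately show ?thesis by simp
  qed
  \<comment> \<open>\<open>k\<close> is only square integrable, so the interval criterion is applied
    to its restrictions to \<open>[-n, n]\<close>; the intersection of two intervals is again an
    interval.\<close>
  have "AE x in lborel. indicator {- real n..real n} x *\<^sub>R k x = 0" for n
  proof (rule integral_interval_eq_0_imp_AE_0)
    show "integrable lborel (\<lambda>x. indicator {- real n..real n} x *\<^sub>R k x)"
      using set_integrable_square_integrable[OF k] by (simp add: set_integrable_def)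
    have "indicator {a..b} x *\<^sub>R indicator {- real n..real n} x *\<^sub>R k x
        = indicator {max a (- real n)..min b (real n)} x *\<^sub>R k x" for a b x
      by (auto simp: indicator_def)
    then show "(LINT x|lborel. indicator {a..b} x *\<^sub>R indicator {- real n..real n} x *\<^sub>R k x) = 0" for a b
      by (simp only: seg)
  qed
  then have "AE x in lborel. \<forall>n::nat. indicator {- real n..real n} x *\<^sub>R k x = 0"
    unfolding AE_all_countable by blast
  then show ?thesis
  proof eventually_elim
    case (elim x)
    obtain N where "\<bar>x\<bar> \<le> real N" using real_arch_simple by blast
    with elim[rule_format, of N] show ?case by (auto simp: indicator_def)
  qed
qed


section \<open>Weak derivatives and increments\<close>

text \<open>If \<open>g\<close> is the weak derivative of \<open>f\<close>, this is the increment
  \<open>f(x + y) - f(x)\<close>. It lets weak derivatives be used through integrals, without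
  choosing an absolutely continuous representative.\<close>

definition window :: "real \<Rightarrow> (real \<Rightarrow> complex) \<Rightarrow> real \<Rightarrow> complex" where
  "window y g x = (LINT s|lborel. indicator {0..y} s *\<^sub>R g (x + s))"

lemma measurable_window [measurable (raw)]:
  assumes [measurable]: "g \<in> borel_measurable borel"
  shows "window y g \<in> borel_measurable borel"
  unfolding window_def by measurable

lemma window_shift: "window y (shift z g) x = window y g (x + z)"
  by (simp add: window_def add_ac)

lemma integrable_window:
  assumes "square_integrable g"
  shows "integrable lborel (\<lambda>s. indicator {0..y} s *\<^sub>R g (x + s))"
  using set_integrable_square_integrable[OF square_integrable_shift[OF assms, of x], of 0 y]
  by (simp add: set_integrable_def add.commute)

lemma window_diff:
  assumes "square_integrable f" "square_integrable g"
  shows "window y (\<lambda>x. f x - g x) x = window y f x - window y g x"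
  using assms[THEN integrable_window] by (simp add: window_def scaleR_diff_right)

lemma window_cong_AE:
  assumes [measurable]: "f \<in> borel_measurable borel" "g \<in> borel_measurable borel"
    and AE: "AE x in lborel. f x = g x"
  shows "window y f x = window y g x"
proof -
  have "AE s in lborel. f (x + s) = g (x + s)"
    using AE_lborel_shift[OF AE, of x] by (simp add: add.commute)
  then show ?thesis unfolding window_def
    by (intro integral_cong_AE) auto
qed

text \<open>Cauchy-Schwarz in \<open>s\<close> gives \<open>|window y g x|^2 <= y * (integral of
  |g(x + s)|^2 over 0 <= s <= y)\<close>; integrating in \<open>x\<close> by Fubini gives the second
  factor \<open>y\<close>.\<close>

lemma
  assumes g: "square_integrable g" and y: "0 \<le> y"
  shows square_integrable_window: "square_integrable (window y g)"
    and L2_norm_window_le: "L2_norm (window y g) \<le> y * L2_norm g"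
proof -
  note [measurable] = square_integrable_measurable[OF g]
  let ?h = "\<lambda>(s, x). indicator {0..y} s * (cmod (g (x + s)))\<^sup>2"
  have int2: "integrable lborel (\<lambda>x. (cmod (g (x + s)))\<^sup>2)"
    "(LINT x|lborel. (cmod (g (x + s)))\<^sup>2) = (L2_norm g)\<^sup>2" for s
    using square_integrable_integrable[OF g] integral_lborel_shift[of "\<lambda>x. (cmod (g x))\<^sup>2" s]
    by (simp_all add: integrable_lborel_shift[of "\<lambda>x. (cmod (g x))\<^sup>2"] L2_norm_power2)
  have h: "integrable (lborel \<Otimes>\<^sub>M lborel) ?h"
  proof (rule lborel_pair.Fubini_integrable)
    show "integrable lborel (\<lambda>s. LINT x|lborel. norm (?h (s, x)))"
      by (simp add: int2 abs_mult emeasure_lborel_Icc_eq)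
    show "AE s in lborel. integrable lborel (\<lambda>x. ?h (s, x))" by (simp add: int2)
  qed measurable
  have h_int: "integrable lborel (\<lambda>x. LINT s|lborel. ?h (s, x))"
    using lborel_pair.integrable_snd[OF h] by simp
  have h_eq: "(LINT x|lborel. LINT s|lborel. ?h (s, x)) = y * (L2_norm g)\<^sup>2"
    using lborel_pair.Fubini_integral[OF h] y by (simp add: int2)
  have pw: "(cmod (window y g x))\<^sup>2 \<le> y * (LINT s|lborel. ?h (s, x))" for x
  proof -
    let ?k = "\<lambda>s. of_real (indicator {0..y} s) * g (x + s)"
    have gx: "square_integrable (\<lambda>s. g (x + s))"
      using square_integrable_shift[OF g, of x] by (simp add: shift_def add.commute)
    have ind: "square_integrable (\<lambda>s. complex_of_real (indicator {0..y} s))"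
      using y by (rule square_integrable_indicator)
    have k: "square_integrable ?k"
      by (rule square_integrable_mult_bounded[OF gx, of _ 1]) (auto simp: indicator_def)
    have kn: "(L2_norm ?k)\<^sup>2 = (LINT s|lborel. ?h (s, x))"
      unfolding L2_norm_power2
      by (intro Bochner_Integration.integral_cong) (auto simp: indicator_def)
    \<comment> \<open>The indicator equals its square: one copy contributes \<open>sqrt y\<close>,
      the other keeps the norm of \<open>g\<close> local to the window.\<close>
    have "window y g x = (LINT s|lborel. of_real (indicator {0..y} s) * ?k s)"
      unfolding window_def
      by (intro Bochner_Integration.integral_cong) (auto simp: indicator_def)
    also have "cmod \<dots> \<le> sqrt y * L2_norm ?k"
      using norm_integral_mult_le[OF ind k] y by (simp add: L2_norm_indicator)
    finally have "(cmod (window y g x))\<^sup>2 \<le> (sqrt y * L2_norm ?k)\<^sup>2"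
      by (rule power_mono) simp
    then show ?thesis using y by (simp add: power_mult_distrib kn)
  qed
  have nn: "0 \<le> (LINT s|lborel. ?h (s, x))" for x
    by (rule Bochner_Integration.integral_nonneg) simp
  have int: "integrable lborel (\<lambda>x. (cmod (window y g x))\<^sup>2)"
    by (rule Bochner_Integration.integrable_bound[OF integrable_mult_right[OF h_int, of y]])
      (use pw y nn in auto)
  then show "square_integrable (window y g)" by (simp add: square_integrable_def)
  have "(L2_norm (window y g))\<^sup>2 \<le> (LINT x|lborel. y * (LINT s|lborel. ?h (s, x)))"
    unfolding L2_norm_power2
    by (intro integral_mono int pw integrable_mult_right h_int)
  also have "\<dots> = (y * L2_norm g)\<^sup>2"
    using h_eq by (simp add: power_mult_distrib power2_eq_square)
  finally show "L2_norm (window y g) \<le> y * L2_norm g"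
    by (rule power2_le_imp_le) (simp add: y)
qed

lemma
  assumes v: "square_integrable v" and g: "square_integrable g" and y: "0 \<le> y"
  shows integrable_L2_inner_shift: "integrable lborel (\<lambda>s. indicator {0..y} s *\<^sub>R L2_inner v (shift s g))"
    and L2_inner_window: "L2_inner v (window y g) = (LINT s|lborel. indicator {0..y} s *\<^sub>R L2_inner v (shift s g))"
proof -
  note [measurable] = square_integrable_measurable[OF g] square_integrable_measurable[OF v]
  let ?h = "\<lambda>(s, x). indicator {0..y} s *\<^sub>R (cnj (v x) * g (x + s))"
  have i: "integrable lborel (\<lambda>x. cnj (v x) * g (x + s))" for s
    using integrable_L2_inner[OF v square_integrable_shift[OF g, of s]] by simp
  have le: "(LINT x|lborel. cmod (cnj (v x) * g (x + s))) \<le> L2_norm v * L2_norm g" for s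
    using integral_norm_mult_le[OF square_integrable_cnj[OF v] square_integrable_shift[OF g, of s]]
    by (simp add: L2_norm_cnj[OF v] L2_norm_shift[OF g])
  have h: "integrable (lborel \<Otimes>\<^sub>M lborel) ?h"
  proof (rule lborel_pair.Fubini_integrable)
    have "integrable lborel (\<lambda>s. indicator {0..y} s * (L2_norm v * L2_norm g))"
      by (simp add: emeasure_lborel_Icc_eq)
    then show "integrable lborel (\<lambda>s. LINT x|lborel. norm (?h (s, x)))"
    proof (rule Bochner_Integration.integrable_bound)
      have "(LINT x|lborel. norm (?h (s, x))) = indicator {0..y} s * (LINT x|lborel. cmod (cnj (v x) * g (x + s)))" for s
        by simp
      then show "AE s in lborel. norm (LINT x|lborel. norm (?h (s, x))) \<le>
          norm (indicator {0..y} s * (L2_norm v * L2_norm g))"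
        using le by (auto simp: abs_mult indicator_def)
    qed measurable
    show "AE s in lborel. integrable lborel (\<lambda>x. ?h (s, x))" using i by simp
  qed measurable
  show "integrable lborel (\<lambda>s. indicator {0..y} s *\<^sub>R L2_inner v (shift s g))"
    using lborel_pair.integrable_fst[OF h] by (simp add: L2_inner_def)
  have "L2_inner v (window y g) = (LINT x|lborel. LINT s|lborel. ?h (s, x))"
    unfolding L2_inner_def window_def
    by (intro Bochner_Integration.integral_cong) (simp_all flip: integral_mult_right_zero)
  also have "\<dots> = (LINT s|lborel. LINT x|lborel. ?h (s, x))"
    using lborel_pair.Fubini_integral[OF h] by simp
  finally show "L2_inner v (window y g) = (LINT s|lborel. indicator {0..y} s *\<^sub>R L2_inner v (shift s g))"
    by (simp add: L2_inner_def)
qed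

text \<open>To first order \<open>window y g\<close> is \<open>y g\<close>. As \<open>g\<close> need
  not be continuous under translation at any rate, each translation is moved to \<open>v\<close>,
  whose Lipschitz constant then controls the error.\<close>

lemma L2_inner_window_approx:
  assumes v: "square_integrable v" and g: "square_integrable g" and y: "0 \<le> y"
    and L: "\<And>s. 0 \<le> s \<Longrightarrow> L2_norm (\<lambda>x. v (x + s) - v x) \<le> L * s"
  shows "cmod (L2_inner v (window y g) - of_real y * L2_inner v g) \<le> L * y\<^sup>2 * L2_norm g"
proof -
  have L0: "0 \<le> L" using order_trans[OF L2_norm_nonneg L[of 1]] by simp
  have diff: "cmod (L2_inner v (shift s g) - L2_inner v g) \<le> L * y * L2_norm g" if s: "0 \<le> s" "s \<le> y" for s
  proof -
    have sv: "square_integrable (shift (- s) v)" by (rule square_integrable_shift[OF v])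
    have "L2_inner v (shift s g) - L2_inner v g = L2_inner (\<lambda>x. shift (- s) v x - v x) g"
      using L2_inner_diff_left[OF g sv v] L2_inner_shift_left[of "- s" v g] by simp
    also have "cmod \<dots> \<le> L2_norm (\<lambda>x. shift (- s) v x - v x) * L2_norm g"
      by (intro norm_L2_inner_le square_integrable_diff sv v g)
    also have "L2_norm (\<lambda>x. shift (- s) v x - v x) = L2_norm (\<lambda>x. v (x + s) - v x)"
      using L2_norm_shift[OF square_integrable_diff[OF sv v], of s] L2_norm_diff_commute[of v "shift s v"]
      by (simp add: shift_def)
    also have "\<dots> \<le> L * y" using L[OF s(1)] s L0 by (meson mult_left_mono order_trans)
    finally show ?thesis by (simp add: mult_right_mono del: shift_apply)
  qed
  have "L2_inner v (window y g) - of_real y * L2_inner v g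
      = (LINT s|lborel. indicator {0..y} s *\<^sub>R L2_inner v (shift s g) - indicator {0..y} s *\<^sub>R L2_inner v g)"
    using integrable_L2_inner_shift[OF v g y] y
    by (simp add: L2_inner_window[OF v g y] scaleR_conv_of_real emeasure_lborel_Icc_eq)
  also have "cmod \<dots> \<le> (LINT s|lborel. indicator {0..y} s * (L * y * L2_norm g))"
  proof (rule Bochner_Integration.integral_norm_bound_integral)
    show "cmod (indicator {0..y} s *\<^sub>R L2_inner v (shift s g) - indicator {0..y} s *\<^sub>R L2_inner v g)
      \<le> indicator {0..y} s * (L * y * L2_norm g)" for s
      using diff[of s] by (auto simp: indicator_def)
  qed (use integrable_L2_inner_shift[OF v g y] y in \<open>simp_all add: emeasure_lborel_Icc_eq\<close>)
  also have "\<dots> = L * y\<^sup>2 * L2_norm g" using y by (simp add: power2_eq_square)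
  finally show ?thesis .
qed

section \<open>Weak derivatives read off from translates of test functions\<close>

lemma has_vector_derivative_quotient_limit:
  fixes F :: "real \<Rightarrow> 'a::real_normed_vector"
  assumes "((\<lambda>s. (F (x + s) - F x) /\<^sub>R s) \<longlongrightarrow> D) (at 0)"
  shows "(F has_vector_derivative D) (at x)"
  unfolding has_vector_derivative_def has_derivative_at
proof (intro conjI bounded_linear_scaleR_left)
  have lim: "((\<lambda>s. norm ((F (x + s) - F x) /\<^sub>R s - D)) \<longlongrightarrow> 0) (at 0)"
    using assms by (simp add: LIM_zero tendsto_norm_zero)
  have "norm ((F (x + s) - F x) /\<^sub>R s - D) = norm (F (x + s) - F x - s *\<^sub>R D) / norm s"
    if "s \<noteq> 0" for s
  proof -
    have "(F (x + s) - F x) /\<^sub>R s - D = (F (x + s) - F x - s *\<^sub>R D) /\<^sub>R s"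
      using that by (simp add: scaleR_diff_right)
    then show ?thesis by (simp add: divide_inverse mult.commute)
  qed
  then show "(\<lambda>s. norm (F (x + s) - F x - s *\<^sub>R D) / norm s) \<midarrow>0\<rightarrow> 0"
    by (intro Lim_transform_eventually[OF lim]) (simp add: eventually_at_filter)
qed

lemma test_function_quotient_limit:
  assumes f: "square_integrable f" and \<phi>: "test_function \<phi>"
  shows "((\<lambda>s. LINT x|lborel. f x * of_real ((\<phi> (x - s) - \<phi> x) / s))
    \<longlongrightarrow> - (LINT x|lborel. f x * of_real (deriv \<phi> x))) (at 0)"
  unfolding tendsto_at_iff_sequentially
proof (intro allI impI)
  fix X :: "nat \<Rightarrow> real"
  assume X0: "\<forall>i. X i \<in> UNIV - {0}" and X: "X \<longlonglongrightarrow> 0"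
  note [measurable] = square_integrable_measurable[OF f] test_function_measurable[OF \<phi>]
    test_function_measurable[OF test_function_deriv[OF \<phi>]]
  obtain a where a: "0 < a" "\<And>x. a < \<bar>x\<bar> \<Longrightarrow> \<phi> x = 0" using test_function_support[OF \<phi>] by blast
  obtain M where M: "0 \<le> M" "\<And>x. \<bar>deriv \<phi> x\<bar> \<le> M"
    using test_function_bounded[OF test_function_deriv[OF \<phi>]] by blast
  \<comment> \<open>Since \<open>X\<close> is bounded, all translates by \<open>X n\<close> are
    supported in \<open>[-(a + B), a + B]\<close>; there \<open>M |f|\<close>, with \<open>M\<close>
    from the mean value theorem, dominates.\<close>
  obtain B where B: "\<And>n. \<bar>X n\<bar> \<le> B"
    using convergent_imp_Bseq[OF convergentI[OF X]] by (auto simp: Bseq_def)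
  have lip: "\<bar>\<phi> u - \<phi> v\<bar> \<le> M * \<bar>u - v\<bar>" for u v
    using field_differentiable_bound[of UNIV \<phi> "deriv \<phi>" M u v] test_function_DERIV[OF \<phi>] M(2) by simp
  have "(\<lambda>n. LINT x|lborel. f x * of_real ((\<phi> (x - X n) - \<phi> x) / X n))
    \<longlonglongrightarrow> (LINT x|lborel. f x * of_real (- deriv \<phi> x))"
  proof (rule integral_dominated_convergence[where w = "\<lambda>x. M * norm (indicator {-(a + B)..a + B} x *\<^sub>R f x)"])
    show "integrable lborel (\<lambda>x. M * norm (indicator {-(a + B)..a + B} x *\<^sub>R f x))"
      using set_integrable_square_integrable[OF f] unfolding set_integrable_def
      by (intro integrable_mult_right integrable_norm)
    show "AE x in lborel. (\<lambda>n. f x * of_real ((\<phi> (x - X n) - \<phi> x) / X n)) \<longlonglongrightarrow> f x * of_real (- deriv \<phi> x)"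
    proof (intro AE_I2 tendsto_intros)
      fix x
      have "((\<lambda>h. (\<phi> (x + h) - \<phi> x) / h) \<longlongrightarrow> deriv \<phi> x) (at 0)"
        using test_function_DERIV[OF \<phi>] by (simp add: DERIV_def)
      moreover have "filterlim (\<lambda>n. - X n) (at 0) sequentially"
        using X0 tendsto_minus[OF X] by (auto simp: filterlim_at)
      ultimately have "(\<lambda>n. (\<phi> (x + - X n) - \<phi> x) / - X n) \<longlonglongrightarrow> deriv \<phi> x"
        by (rule filterlim_compose)
      from tendsto_minus[OF this] show "(\<lambda>n. (\<phi> (x - X n) - \<phi> x) / X n) \<longlonglongrightarrow> - deriv \<phi> x" by simp
    qed
    show "AE x in lborel. norm (f x * of_real ((\<phi> (x - X n) - \<phi> x) / X n))
      \<le> M * norm (indicator {-(a + B)..a + B} x *\<^sub>R f x)" for n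
    proof (rule AE_I2)
      fix x
      show "norm (f x * of_real ((\<phi> (x - X n) - \<phi> x) / X n))
        \<le> M * norm (indicator {-(a + B)..a + B} x *\<^sub>R f x)"
      proof (cases "x \<in> {-(a + B)..a + B}")
        case True
        have "\<bar>(\<phi> (x - X n) - \<phi> x) / X n\<bar> \<le> M"
          using lip[of "x - X n" x] X0 by (simp add: field_simps)
        then have "norm (f x) * \<bar>(\<phi> (x - X n) - \<phi> x) / X n\<bar> \<le> norm (f x) * M"
          by (intro mult_left_mono) auto
        with True show ?thesis by (simp add: norm_mult mult.commute del: of_real_divide of_real_diff)
      next
        case False
        then have "a < \<bar>x\<bar>" "a < \<bar>x - X n\<bar>" using B[of n] by (auto simp: abs_if split: if_splits)
        then show ?thesis using M(1) by (simp add: a(2))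
      qed
    qed
  qed measurable
  then show "((\<lambda>s. LINT x|lborel. f x * of_real ((\<phi> (x - s) - \<phi> x) / s)) \<circ> X)
    \<longlonglongrightarrow> - (LINT x|lborel. f x * of_real (deriv \<phi> x))"
    by (simp add: o_def)
qed

lemma integral_mult_test_function_eq:
  "(LINT x|lborel. f x * of_real (\<phi> x)) = L2_inner (\<lambda>x. of_real (\<phi> x)) f"
  by (simp add: L2_inner_def mult.commute)

lemma integral_translate_has_vector_derivative:
  assumes f: "square_integrable f" and \<phi>: "test_function \<phi>"
  shows "((\<lambda>r. LINT x|lborel. f x * of_real (\<phi> (x - r)))
    has_vector_derivative - (LINT x|lborel. f x * of_real (deriv (\<lambda>x. \<phi> (x - r)) x))) (at r)"
proof (rule has_vector_derivative_quotient_limit)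
  have t: "test_function (\<lambda>x. \<phi> (x - r))" for r
    using test_function_shift[OF \<phi>, of "- r"] by simp
  have i: "integrable lborel (\<lambda>x. f x * of_real (\<phi> (x - r)))" for r
    by (intro integrable_mult f square_integrable_test_function t)
  have "(LINT x|lborel. f x * of_real (\<phi> (x - (r + s)))) - (LINT x|lborel. f x * of_real (\<phi> (x - r)))
      = (LINT x|lborel. f x * of_real (\<phi> (x - (r + s))) - f x * of_real (\<phi> (x - r)))" for s
    by (rule Bochner_Integration.integral_diff[OF i i, symmetric])
  then have "((LINT x|lborel. f x * of_real (\<phi> (x - (r + s)))) - (LINT x|lborel. f x * of_real (\<phi> (x - r)))) /\<^sub>R s
      = (LINT x|lborel. f x * of_real ((\<phi> (x - s - r) - \<phi> (x - r)) / s))" for s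
    by (simp flip: integral_scaleR_right) (simp add: scaleR_conv_of_real field_simps)
  then show "((\<lambda>s. ((LINT x|lborel. f x * of_real (\<phi> (x - (r + s)))) - (LINT x|lborel. f x * of_real (\<phi> (x - r)))) /\<^sub>R s)
      \<longlongrightarrow> - (LINT x|lborel. f x * of_real (deriv (\<lambda>x. \<phi> (x - r)) x))) (at 0)"
    using test_function_quotient_limit[OF f t[of r]] by simp
qed

lemma has_weak_deriv_1D:
  "has_weak_deriv (Suc 0) f g \<Longrightarrow> test_function \<phi> \<Longrightarrow>
    (LINT x|lborel. f x * of_real (deriv \<phi> x)) = - (LINT x|lborel. g x * of_real (\<phi> x))"
  by (auto simp: has_weak_deriv_def)

text \<open>The pairing of \<open>f\<close> with \<open>\<phi>(. - r)\<close> is differentiable in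
  \<open>r\<close>, and its derivative is the pairing of \<open>g\<close> with
  \<open>\<phi>(. - r)\<close>. Integrating from 0 to \<open>y\<close>, exchanging integrals and
  applying \<open>fundamental_lemma\<close> gives the increment almost everywhere.\<close>

lemma weak_deriv_increment:
  assumes f: "square_integrable f" and g: "square_integrable g"
    and wd: "has_weak_deriv (Suc 0) f g" and y: "0 \<le> y"
  shows "AE x in lborel. f (x + y) - f x = window y g x"
proof -
  have w: "square_integrable (window y g)" by (rule square_integrable_window[OF g y])
  have sf: "square_integrable (shift y f)" by (rule square_integrable_shift[OF f])
  have d: "square_integrable (\<lambda>x. shift y f x - f x)" by (rule square_integrable_diff[OF sf f])
  have "AE x in lborel. shift y f x - f x - window y g x = 0"
  proof (rule fundamental_lemma)
    show "square_integrable (\<lambda>x. shift y f x - f x - window y g x)"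
      by (rule square_integrable_diff[OF d w])
    fix \<phi> assume \<phi>: "test_function \<phi>"
    let ?\<phi> = "\<lambda>x. complex_of_real (\<phi> x)"
    have \<phi>2: "square_integrable ?\<phi>" by (rule square_integrable_test_function[OF \<phi>])
    have t: "test_function (\<lambda>x. \<phi> (x - r))" for r
      using test_function_shift[OF \<phi>, of "- r"] by simp
    define P where "P r = (LINT x|lborel. f x * of_real (\<phi> (x - r)))" for r
    define Q where "Q r = (LINT x|lborel. g x * of_real (\<phi> (x - r)))" for r
    have sh: "(LINT x|lborel. k x * of_real (\<phi> (x - r))) = L2_inner ?\<phi> (shift r k)" for k r
      using integral_lborel_shift[of "\<lambda>x. k x * of_real (\<phi> (x - r))" r]
      by (simp add: L2_inner_def mult.commute)
    have "(P has_vector_derivative Q r) (at r)" for r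
      using integral_translate_has_vector_derivative[OF f \<phi>, of r] has_weak_deriv_1D[OF wd t[of r]]
      unfolding P_def Q_def by simp
    moreover have "continuous_on {0..y} Q"
      unfolding Q_def
      using has_vector_derivative_continuous[OF integral_translate_has_vector_derivative[OF g \<phi>]]
      by (simp add: continuous_at_imp_continuous_on)
    ultimately have "has_bochner_integral lborel (\<lambda>r. indicator {0..y} r *\<^sub>R Q r) (P y - P 0)"
      by (intro has_bochner_integral_FTC_Icc y) (auto intro: has_vector_derivative_at_within)
    then have "P y - P 0 = (LINT r|lborel. indicator {0..y} r *\<^sub>R L2_inner ?\<phi> (shift r g))"
      by (simp add: has_bochner_integral_integral_eq Q_def sh)
    also have "\<dots> = L2_inner ?\<phi> (window y g)" by (rule L2_inner_window[OF \<phi>2 g y, symmetric])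
    finally have "L2_inner ?\<phi> (shift y f) - L2_inner ?\<phi> (shift 0 f) = L2_inner ?\<phi> (window y g)"
      by (simp only: P_def sh)
    moreover have "shift 0 f = f" by (simp add: shift_def)
    ultimately show "(LINT x|lborel. (shift y f x - f x - window y g x) * of_real (\<phi> x)) = 0"
      unfolding integral_mult_test_function_eq
        L2_inner_diff_right[OF \<phi>2 d w] L2_inner_diff_right[OF \<phi>2 sf f] by simp
  qed
  then show ?thesis by simp
qed

lemma L2_norm_increment_le:
  assumes f: "square_integrable f" and g: "square_integrable g"
    and wd: "has_weak_deriv (Suc 0) f g" and y: "0 \<le> y"
  shows "L2_norm (\<lambda>x. f (x + y) - f x) \<le> y * L2_norm g"
proof -
  have "L2_norm (\<lambda>x. f (x + y) - f x) = L2_norm (window y g)"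
    using square_integrable_measurable[OF square_integrable_diff[OF square_integrable_shift[OF f, of y] f]]
    by (intro L2_norm_cong_AE square_integrable_window g y weak_deriv_increment f wd) simp
  then show ?thesis using L2_norm_window_le[OF g y] by simp
qed

text \<open>Windows commute with translations, so the increment of \<open>window y g\<close> is the
  window of the increment of \<open>g\<close>.\<close>

lemma weak_deriv_second_increment:
  assumes f: "square_integrable f" and g: "square_integrable g" and k: "square_integrable k"
    and wf: "has_weak_deriv (Suc 0) f g" and wg: "has_weak_deriv (Suc 0) g k" and y: "0 \<le> y"
  shows "AE x in lborel. (f (x + y + y) - f (x + y)) - (f (x + y) - f x) = window y (window y k) x"
proof -
  note f1 = weak_deriv_increment[OF f g wf y]
  have sg: "square_integrable (shift y g)" by (rule square_integrable_shift[OF g])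
  have "window y g (x + y) - window y g x = window y (window y k) x" for x
  proof -
    have "window y g (x + y) - window y g x = window y (\<lambda>x. shift y g x - g x) x"
      by (simp only: window_diff[OF sg g] window_shift)
    also have "\<dots> = window y (window y k) x"
      using weak_deriv_increment[OF g k wg y] square_integrable_measurable[OF k]
        square_integrable_measurable[OF square_integrable_diff[OF sg g]]
      by (intro window_cong_AE) (auto intro: measurable_window)
    finally show ?thesis .
  qed
  note * = this
  from f1 AE_lborel_shift[OF f1, of y] show ?thesis
    by eventually_elim (simp only: *)
qed

lemma L2_norm_increment_shift:
  assumes "square_integrable v"
  shows "L2_norm (\<lambda>x. shift y v (x + s) - shift y v x) = L2_norm (\<lambda>x. v (x + s) - v x)"
  using L2_norm_shift[OF square_integrable_diff[OF square_integrable_shift[OF assms, of s] assms], of y]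
  by (simp add: shift_def add_ac)

text \<open>Integration by parts \<open>\<langle>v, f''\<rangle> = - \<langle>v', f'\<rangle>\<close> with difference quotients in place of derivatives.\<close>

lemma Green_increment:
  assumes f: "square_integrable f" and g: "square_integrable g" and k: "square_integrable k"
    and wf: "has_weak_deriv (Suc 0) f g" and wg: "has_weak_deriv (Suc 0) g k" and y: "0 \<le> y"
    and v: "square_integrable v" and L: "\<And>s. 0 \<le> s \<Longrightarrow> L2_norm (\<lambda>x. v (x + s) - v x) \<le> L * s"
  shows "cmod (L2_inner (\<lambda>x. v (x + y) - v x) (\<lambda>x. f (x + y) - f x) + of_real (y\<^sup>2) * L2_inner v k)
    \<le> 3 * L * L2_norm k * y ^ 3"
proof -
  let ?W = "window y k" and ?v = "shift y v" and ?d = "\<lambda>x. f (x + y) - f x"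
  have L0: "0 \<le> L" using order_trans[OF L2_norm_nonneg L[of 1]] by simp
  have W: "square_integrable ?W" by (rule square_integrable_window[OF k y])
  have WW: "square_integrable (window y ?W)" by (rule square_integrable_window[OF W y])
  have sv: "square_integrable ?v" by (rule square_integrable_shift[OF v])
  have d: "square_integrable ?d"
    using square_integrable_diff[OF square_integrable_shift[OF f, of y] f] by simp
  have sd: "square_integrable (shift y ?d)" by (rule square_integrable_shift[OF d])
  \<comment> \<open>Exact summation by parts: by translation invariance, pairing the shifted
    \<open>v\<close> with the second increment of \<open>f\<close> is minus the pairing of the first
    increments.\<close>
  have "L2_inner ?v (window y ?W) = L2_inner ?v (\<lambda>x. shift y ?d x - ?d x)"
    using weak_deriv_second_increment[OF f g k wf wg y] square_integrable_measurable[OF WW]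
      square_integrable_measurable[OF square_integrable_diff[OF sd d]] square_integrable_measurable[OF sv]
    by (intro L2_inner_cong_AE) (auto elim: eventually_mono)
  also have "\<dots> = L2_inner v ?d - L2_inner ?v ?d"
    by (simp add: L2_inner_diff_right[OF sv sd d] L2_inner_shift del: shift_apply)
  also have "\<dots> = - L2_inner (\<lambda>x. v (x + y) - v x) ?d"
    using L2_inner_diff_left[OF d sv v] by simp
  finally have eq: "L2_inner (\<lambda>x. v (x + y) - v x) ?d = - L2_inner ?v (window y ?W)" by simp
  have Lv: "L2_norm (\<lambda>x. ?v (x + s) - ?v x) \<le> L * s" if "0 \<le> s" for s
    using L[OF that] unfolding L2_norm_increment_shift[OF v] .
  \<comment> \<open>Three errors of size \<open>L * L2_norm k * y ^ 3\<close> make up the constant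
    3: replacing the outer window by \<open>y\<close>, replacing the inner window by
    \<open>y\<close>, and undoing the shift of \<open>v\<close>.\<close>
  have 1: "cmod (L2_inner ?v (window y ?W) - of_real y * L2_inner ?v ?W) \<le> L * y\<^sup>2 * L2_norm ?W"
    by (rule L2_inner_window_approx[OF sv W y Lv])
  also have "\<dots> \<le> L * y\<^sup>2 * (y * L2_norm k)"
    using L2_norm_window_le[OF k y] L0 by (intro mult_left_mono) auto
  finally have 1: "cmod (L2_inner ?v (window y ?W) - of_real y * L2_inner ?v ?W) \<le> L * L2_norm k * y ^ 3"
    by (simp add: power3_eq_cube power2_eq_square mult_ac)
  have "cmod (of_real y * (L2_inner ?v ?W - of_real y * L2_inner ?v k)) \<le> y * (L * y\<^sup>2 * L2_norm k)"
    unfolding norm_mult using L2_inner_window_approx[OF sv k y Lv] y by (intro mult_mono) (auto simp del: shift_apply)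
  then have 2: "cmod (of_real y * L2_inner ?v ?W - of_real (y\<^sup>2) * L2_inner ?v k) \<le> L * L2_norm k * y ^ 3"
    by (simp add: power3_eq_cube power2_eq_square algebra_simps)
  have "cmod (of_real (y\<^sup>2) * L2_inner (\<lambda>x. ?v x - v x) k) \<le> y\<^sup>2 * (L2_norm (\<lambda>x. ?v x - v x) * L2_norm k)"
    unfolding norm_mult using norm_L2_inner_le[OF square_integrable_diff[OF sv v] k]
    by (intro mult_mono) (auto simp: norm_power)
  also have "\<dots> \<le> y\<^sup>2 * ((L * y) * L2_norm k)"
    using L[OF y] by (intro mult_left_mono mult_right_mono) auto
  finally have 3: "cmod (of_real (y\<^sup>2) * L2_inner ?v k - of_real (y\<^sup>2) * L2_inner v k) \<le> L * L2_norm k * y ^ 3"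
    unfolding L2_inner_diff_left[OF k sv v]
    by (simp add: power3_eq_cube power2_eq_square algebra_simps del: shift_apply)
  have "- (a::complex) + d = - ((a - b) + (b - c) + (c - d))" for a b c d by simp
  then have "L2_inner (\<lambda>x. v (x + y) - v x) ?d + of_real (y\<^sup>2) * L2_inner v k
    = - ((L2_inner ?v (window y ?W) - of_real y * L2_inner ?v ?W)
       + (of_real y * L2_inner ?v ?W - of_real (y\<^sup>2) * L2_inner ?v k)
       + (of_real (y\<^sup>2) * L2_inner ?v k - of_real (y\<^sup>2) * L2_inner v k))"
    unfolding eq .
  also have "cmod \<dots> \<le> L * L2_norm k * y ^ 3 + L * L2_norm k * y ^ 3 + L * L2_norm k * y ^ 3"
    unfolding norm_minus_cancel by (intro norm_triangle_le add_mono 1 2 3)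
  finally show ?thesis by simp
qed

text \<open>Divide \<open>Green_increment\<close> by \<open>y^2\<close> and let \<open>y\<close>
  decrease to 0. Only \<open>A\<close> survives, so \<open>L\<close> and \<open>B\<close> may be
  arbitrarily bad constants; this is what allows crude bounds for unbounded weights later.\<close>

lemma Im_L2_inner_second_deriv_le:
  assumes f: "square_integrable f" and g: "square_integrable g" and k: "square_integrable k"
    and wf: "has_weak_deriv (Suc 0) f g" and wg: "has_weak_deriv (Suc 0) g k"
    and v: "square_integrable v" and L: "\<And>s. 0 \<le> s \<Longrightarrow> L2_norm (\<lambda>x. v (x + s) - v x) \<le> L * s"
    and AB: "\<And>y. 0 < y \<Longrightarrow> \<bar>Im (L2_inner (\<lambda>x. v (x + y) - v x) (\<lambda>x. f (x + y) - f x))\<bar> \<le> y\<^sup>2 * (A + B * y)"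
  shows "\<bar>Im (L2_inner v k)\<bar> \<le> A"
proof -
  have "\<bar>Im (L2_inner v k)\<bar> \<le> A + (B + 3 * L * L2_norm k) * y" if y: "0 < y" for y
  proof -
    let ?I = "L2_inner (\<lambda>x. v (x + y) - v x) (\<lambda>x. f (x + y) - f x)"
    have "\<bar>Im (?I + of_real (y\<^sup>2) * L2_inner v k)\<bar> \<le> 3 * L * L2_norm k * y ^ 3"
      by (rule order_trans[OF abs_Im_le_cmod Green_increment[OF f g k wf wg _ v L]]) (use y in auto)
    moreover have "Im (?I + of_real (y\<^sup>2) * L2_inner v k) = Im ?I + y\<^sup>2 * Im (L2_inner v k)"
      by (simp del: of_real_power)
    ultimately have "y\<^sup>2 * \<bar>Im (L2_inner v k)\<bar> \<le> 3 * L * L2_norm k * y ^ 3 + y\<^sup>2 * (A + B * y)"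
      using AB[OF y] y by (simp add: abs_mult flip: abs_mult) 
    also have "\<dots> = y\<^sup>2 * (A + (B + 3 * L * L2_norm k) * y)"
      by (simp add: power3_eq_cube power2_eq_square algebra_simps)
    finally show ?thesis using y by simp
  qed
  moreover have "((\<lambda>y. A + (B + 3 * L * L2_norm k) * y) \<longlongrightarrow> A + (B + 3 * L * L2_norm k) * 0) (at_right 0)"
    by (intro tendsto_intros)
  ultimately show ?thesis
    by (intro tendsto_lowerbound[where F = "at_right 0" and f = "\<lambda>y. A + (B + 3 * L * L2_norm k) * y"])
      (auto simp: eventually_at_right_less intro: eventually_mono[OF eventually_at_right_less])
qed

text \<open>Symmetry of the second derivative: for \<open>v = f\<close> the increments are paired
  with themselves, which is real.\<close>

lemma Im_L2_inner_second_deriv_self: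
  assumes f: "square_integrable f" and g: "square_integrable g" and k: "square_integrable k"
    and wf: "has_weak_deriv (Suc 0) f g" and wg: "has_weak_deriv (Suc 0) g k"
  shows "Im (L2_inner f k) = 0"
proof -
  have "\<bar>Im (L2_inner f k)\<bar> \<le> 0"
  proof (rule Im_L2_inner_second_deriv_le[OF f g k wf wg f])
    show "L2_norm (\<lambda>x. f (x + s) - f x) \<le> L2_norm g * s" if "0 \<le> s" for s
      using L2_norm_increment_le[OF f g wf that] by (simp add: mult.commute)
    show "\<bar>Im (L2_inner (\<lambda>x. f (x + y) - f x) (\<lambda>x. f (x + y) - f x))\<bar> \<le> y\<^sup>2 * (0 + 0 * y)" for y
      by (simp add: L2_inner_self)
  qed
  then show ?thesis by simp
qed

text \<open>Testing the order \<open>k\<close> relation with \<open>deriv \<phi>\<close> links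
  consecutive derivatives. The data and the equation specify every derivative relative to the
  original function, whereas increments are iterated one derivative at a time.\<close>

lemma has_weak_deriv_1_of_Suc:
  assumes "has_weak_deriv k f g" "has_weak_deriv (Suc k) f g'"
  shows "has_weak_deriv (Suc 0) g g'"
proof -
  have "(LINT x|lborel. g x * of_real (deriv \<phi> x)) = - (LINT x|lborel. g' x * of_real (\<phi> x))"
    if \<phi>: "test_function \<phi>" for \<phi>
  proof -
    have "(-1) ^ k * (LINT x|lborel. g x * of_real (deriv \<phi> x)) = (LINT x|lborel. f x * of_real ((deriv ^^ k) (deriv \<phi>) x))"
      using assms(1) test_function_deriv[OF \<phi>] by (simp add: has_weak_deriv_def)
    also have "\<dots> = (LINT x|lborel. f x * of_real ((deriv ^^ Suc k) \<phi> x))"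
      by (simp add: funpow_swap1)
    also have "\<dots> = (-1) ^ Suc k * (LINT x|lborel. g' x * of_real (\<phi> x))"
      using assms(2) \<phi> unfolding has_weak_deriv_def by blast
    finally have "(-1) ^ k * (LINT x|lborel. g x * of_real (deriv \<phi> x)) = (-1) ^ k * - (LINT x|lborel. g' x * of_real (\<phi> x))"
      by simp
    then show ?thesis by (simp only: mult_cancel_left) simp
  qed
  then show ?thesis using assms by (auto simp: has_weak_deriv_def)
qed

lemma has_weak_deriv_Suc:
  assumes "has_weak_deriv k f g" "has_weak_deriv (Suc 0) g g'"
  shows "has_weak_deriv (Suc k) f g'"
proof -
  have "(LINT x|lborel. f x * of_real ((deriv ^^ Suc k) \<phi> x)) = (-1) ^ Suc k * (LINT x|lborel. g' x * of_real (\<phi> x))"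
    if \<phi>: "test_function \<phi>" for \<phi>
  proof -
    have "(LINT x|lborel. f x * of_real ((deriv ^^ Suc k) \<phi> x)) = (LINT x|lborel. f x * of_real ((deriv ^^ k) (deriv \<phi>) x))"
      by (simp add: funpow_swap1)
    also have "\<dots> = (-1) ^ k * (LINT x|lborel. g x * of_real (deriv \<phi> x))"
      using assms(1) test_function_deriv[OF \<phi>] by (simp add: has_weak_deriv_def)
    finally show ?thesis by (simp only: has_weak_deriv_1D[OF assms(2) \<phi>]) simp
  qed
  then show ?thesis using assms unfolding has_weak_deriv_def by blast
qed

lemma has_weak_deriv_0:
  "locally_integrable f \<Longrightarrow> has_weak_deriv 0 f f"
  by (simp add: has_weak_deriv_def)


section \<open>Difference quotients of products and of the mean field\<close>

lemma has_weak_deriv_shift: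
  assumes f: "square_integrable f" and g: "square_integrable g" and wd: "has_weak_deriv (Suc 0) f g"
  shows "has_weak_deriv (Suc 0) (shift y f) (shift y g)"
proof -
  have "(LINT x|lborel. shift y f x * of_real (deriv \<phi> x)) = - (LINT x|lborel. shift y g x * of_real (\<phi> x))"
    if \<phi>: "test_function \<phi>" for \<phi>
  proof -
    have t: "test_function (\<lambda>x. \<phi> (x - y))"
      using test_function_shift[OF \<phi>, of "- y"] by simp
    have "((\<lambda>x. \<phi> (x - y)) has_field_derivative deriv \<phi> (x - y) * 1) (at x)" for x
      by (rule DERIV_chain2[OF test_function_DERIV[OF \<phi>]]) (auto intro!: derivative_eq_intros)
    then have d: "deriv (\<lambda>x. \<phi> (x - y)) x = deriv \<phi> (x - y)" for x
      using DERIV_imp_deriv by fastforce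
    show ?thesis
      using has_weak_deriv_1D[OF wd t]
        integral_lborel_shift[of "\<lambda>x. f x * of_real (deriv \<phi> (x - y))" y]
        integral_lborel_shift[of "\<lambda>x. g x * of_real (\<phi> (x - y))" y]
      by (simp add: d)
  qed
  then show ?thesis
    by (auto simp: has_weak_deriv_def intro!: locally_integrable_square_integrable square_integrable_shift f g
        simp del: shift_apply)
qed

lemma has_weak_deriv_diff:
  assumes f: "square_integrable f" "square_integrable f'" and g: "square_integrable g" "square_integrable g'"
    and wd: "has_weak_deriv (Suc 0) f f'" "has_weak_deriv (Suc 0) g g'"
  shows "has_weak_deriv (Suc 0) (\<lambda>x. f x - g x) (\<lambda>x. f' x - g' x)"
proof -
  have i: "integrable lborel (\<lambda>x. k x * of_real (\<phi> x))" if "test_function \<phi>" "square_integrable k" for k \<phi>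
    using integrable_mult[OF that(2) square_integrable_test_function[OF that(1)]] .
  have "(LINT x|lborel. (f x - g x) * of_real (deriv \<phi> x)) = - (LINT x|lborel. (f' x - g' x) * of_real (\<phi> x))"
    if \<phi>: "test_function \<phi>" for \<phi>
    using i[OF \<phi>] i[OF test_function_deriv[OF \<phi>]] f g has_weak_deriv_1D[OF _ \<phi>] wd
    by (simp add: left_diff_distrib)
  then show ?thesis
    by (auto simp: has_weak_deriv_def intro!: locally_integrable_square_integrable square_integrable_diff f g)
qed

lemma has_weak_deriv_scale:
  assumes f: "square_integrable f" "square_integrable f'" and wd: "has_weak_deriv (Suc 0) f f'"
  shows "has_weak_deriv (Suc 0) (\<lambda>x. c * f x) (\<lambda>x. c * f' x)"
  using has_weak_deriv_1D[OF wd]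
  by (auto simp: has_weak_deriv_def mult.assoc
      intro!: locally_integrable_square_integrable square_integrable_scale f)

section \<open>Difference quotients scaled to approximate \<open>h\<close> times the
  derivative\<close>

definition diff_quot :: "real \<Rightarrow> real \<Rightarrow> (real \<Rightarrow> complex) \<Rightarrow> real \<Rightarrow> complex" where
  "diff_quot h y f = (\<lambda>x. of_real (h / y) * (f (x + y) - f x))"

text \<open>Each quotient has its own step, because the Leibniz rule distributes the steps over the
  factors and the later limits send them to 0 one at a time; all bounds depend on the list only
  through its length.\<close>

primrec diff_quots :: "real \<Rightarrow> real list \<Rightarrow> (real \<Rightarrow> complex) \<Rightarrow> real \<Rightarrow> complex" where
  "diff_quots h [] f = f"
| "diff_quots h (y # ys) f = diff_quot h y (diff_quots h ys f)"

lemma diff_quot_commute: "diff_quot h y (diff_quot h z f) = diff_quot h z (diff_quot h y f)"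
  by (simp add: diff_quot_def algebra_simps)

text \<open>Quotients commute, so the head of the list may also act first. The Leibniz inductions
  peel it off in this form.\<close>

lemma diff_quots_diff_quot: "diff_quots h ys (diff_quot h y f) = diff_quots h (y # ys) f"
  by (induction ys) (simp_all add: diff_quot_commute[of _ y])

lemma diff_quots_shift: "diff_quots h ys (shift z f) = shift z (diff_quots h ys f)"
  by (induction ys) (simp_all add: diff_quot_def shift_def add_ac)

lemma diff_quots_add: "diff_quots h ys (\<lambda>x. f x + g x) = (\<lambda>x. diff_quots h ys f x + diff_quots h ys g x)"
  by (induction ys) (simp_all add: diff_quot_def algebra_simps)

lemma diff_quots_diff: "diff_quots h ys (\<lambda>x. f x - g x) = (\<lambda>x. diff_quots h ys f x - diff_quots h ys g x)"
  by (induction ys) (simp_all add: diff_quot_def algebra_simps)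

lemma diff_quots_scale: "diff_quots h ys (\<lambda>x. c * f x) = (\<lambda>x. c * diff_quots h ys f x)"
  by (induction ys) (simp_all add: diff_quot_def algebra_simps)

lemma diff_quots_cnj: "diff_quots h ys (\<lambda>x. cnj (f x)) = (\<lambda>x. cnj (diff_quots h ys f x))"
  by (induction ys) (simp_all add: diff_quot_def)

lemma
  assumes f: "square_integrable f"
  shows square_integrable_diff_quot: "square_integrable (diff_quot h y f)"
    and L2_norm_diff_quot: "L2_norm (diff_quot h y f) = \<bar>h / y\<bar> * L2_norm (\<lambda>x. f (x + y) - f x)"
proof -
  have d: "square_integrable (\<lambda>x. f (x + y) - f x)"
    using square_integrable_diff[OF square_integrable_shift[OF f] f] by simp
  show "square_integrable (diff_quot h y f)"
    "L2_norm (diff_quot h y f) = \<bar>h / y\<bar> * L2_norm (\<lambda>x. f (x + y) - f x)"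
    unfolding diff_quot_def by (simp_all only: square_integrable_scale[OF d] L2_norm_scale[OF d] norm_of_real)
qed

lemma square_integrable_diff_quots:
  "square_integrable f \<Longrightarrow> square_integrable (diff_quots h ys f)"
  by (induction ys) (auto intro: square_integrable_diff_quot)

lemma measurable_diff_quots [measurable (raw)]:
  "f \<in> borel_measurable borel \<Longrightarrow> diff_quots h ys f \<in> borel_measurable borel"
  by (induction ys) (auto simp: diff_quot_def)

lemma AE_diff_quots_cong:
  "AE x in lborel. f x = g x \<Longrightarrow> AE x in lborel. diff_quots h ys f x = diff_quots h ys g x"
proof (induction ys)
  case (Cons y ys)
  show ?case
    using Cons.IH[OF Cons.prems] AE_lborel_shift[OF Cons.IH[OF Cons.prems], of y]
    by eventually_elim (simp add: diff_quot_def)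
qed simp

lemma has_weak_deriv_diff_quots:
  assumes f: "square_integrable f" and g: "square_integrable g" and wd: "has_weak_deriv (Suc 0) f g"
  shows "has_weak_deriv (Suc 0) (diff_quots h ys f) (diff_quots h ys g)"
proof (induction ys)
  case (Cons y ys)
  note s = square_integrable_diff_quots[OF f, of h ys] square_integrable_diff_quots[OF g, of h ys]
  note ss = s[THEN square_integrable_shift, of y]
  show ?case
    using has_weak_deriv_scale[OF square_integrable_diff[OF ss(1) s(1)] square_integrable_diff[OF ss(2) s(2)]
        has_weak_deriv_diff[OF ss s has_weak_deriv_shift[OF s Cons] Cons]]
    by (simp add: diff_quot_def del: of_real_divide)
qed (simp add: wd)

lemma L2_norm_diff_quot_le:
  assumes f: "square_integrable f" and g: "square_integrable g" and wd: "has_weak_deriv (Suc 0) f g"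
    and h: "0 \<le> h" and y: "0 < y"
  shows "L2_norm (diff_quot h y f) \<le> h * L2_norm g"
proof -
  have "L2_norm (diff_quot h y f) \<le> h / y * (y * L2_norm g)"
    unfolding L2_norm_diff_quot[OF f]
    using L2_norm_increment_le[OF f g wd, of y] h y by (simp add: abs_of_nonneg mult_left_mono del: times_divide_eq_left)
  then show ?thesis using y by simp
qed

text \<open>Each quotient is traded for \<open>h\<close> times one derivative, moving one step along
  the chain \<open>G\<close>.\<close>

lemma L2_norm_diff_quots_le:
  assumes "\<And>j. j \<le> length ys \<Longrightarrow> square_integrable (G j)"
    and "\<And>j. j < length ys \<Longrightarrow> has_weak_deriv (Suc 0) (G j) (G (Suc j))"
    and h: "0 \<le> h" and ys: "set ys \<subseteq> {0<..}"
  shows "L2_norm (diff_quots h ys (G 0)) \<le> h ^ length ys * L2_norm (G (length ys))"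
  using assms(1,2) ys
proof (induction ys arbitrary: G)
  case (Cons y ys)
  have G: "square_integrable (G 0)" "square_integrable (G 1)" "has_weak_deriv (Suc 0) (G 0) (G 1)"
    using Cons.prems(1)[of 0] Cons.prems(1)[of 1] Cons.prems(2)[of 0] by auto
  have "L2_norm (diff_quots h (y # ys) (G 0)) \<le> h * L2_norm (diff_quots h ys (G 1))"
    using Cons.prems h
    by (auto intro!: L2_norm_diff_quot_le square_integrable_diff_quots has_weak_deriv_diff_quots G)
  also have "L2_norm (diff_quots h ys (G 1)) \<le> h ^ length ys * L2_norm (G (Suc (length ys)))"
    using Cons.IH[of "\<lambda>j. G (Suc j)"] Cons.prems by auto
  finally show ?case using h by (simp add: mult_left_mono mult.assoc)
qed simp

text \<open>The three predicates share one shape, so that a single Leibniz lemma covers both a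
  bounded function times an \<open>L^2\<close> function and the \<open>L^1\<close> product of two
  \<open>L^2\<close> functions.\<close>

definition sup_bounded :: "(real \<Rightarrow> complex) \<Rightarrow> real \<Rightarrow> bool" where
  "sup_bounded f a \<longleftrightarrow> f \<in> borel_measurable borel \<and> (\<forall>x. cmod (f x) \<le> a)"

definition L2_bounded :: "(real \<Rightarrow> complex) \<Rightarrow> real \<Rightarrow> bool" where
  "L2_bounded f a \<longleftrightarrow> square_integrable f \<and> L2_norm f \<le> a"

definition L1_bounded :: "(real \<Rightarrow> complex) \<Rightarrow> real \<Rightarrow> bool" where
  "L1_bounded f a \<longleftrightarrow> integrable lborel f \<and> (LINT x|lborel. cmod (f x)) \<le> a"

lemma L2_bounded_shift: "L2_bounded f a \<Longrightarrow> L2_bounded (shift y f) a"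
  by (simp add: L2_bounded_def square_integrable_shift L2_norm_shift del: shift_apply)

lemma sup_bounded_shift: "sup_bounded f a \<Longrightarrow> sup_bounded (shift y f) a"
  by (simp add: sup_bounded_def measurable_shift)

lemma sup_bounded_nonneg: "sup_bounded f a \<Longrightarrow> 0 \<le> a"
  unfolding sup_bounded_def using norm_ge_zero order_trans by blast

lemma L2_bounded_nonneg: "L2_bounded f a \<Longrightarrow> 0 \<le> a"
  unfolding L2_bounded_def using L2_norm_nonneg order_trans by blast

lemma L2_bounded_mono: "L2_bounded f a \<Longrightarrow> a \<le> b \<Longrightarrow> L2_bounded f b"
  by (auto simp: L2_bounded_def)

lemma L2_bounded_add: "L2_bounded f a \<Longrightarrow> L2_bounded g b \<Longrightarrow> L2_bounded (\<lambda>x. f x + g x) (a + b)"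
  unfolding L2_bounded_def using L2_norm_triangle[of f g] square_integrable_add[of f g] by force

lemma L1_bounded_add: "L1_bounded f a \<Longrightarrow> L1_bounded g b \<Longrightarrow> L1_bounded (\<lambda>x. f x + g x) (a + b)"
proof -
  assume *: "L1_bounded f a" "L1_bounded g b"
  then have "(LINT x|lborel. cmod (f x + g x)) \<le> (LINT x|lborel. cmod (f x) + cmod (g x))"
    by (intro integral_mono) (auto simp: L1_bounded_def norm_triangle_ineq)
  then show ?thesis using * by (auto simp: L1_bounded_def)
qed

lemma sup_bounded_mult_L2_bounded:
  assumes f: "sup_bounded f a" and g: "L2_bounded g b"
  shows "L2_bounded (\<lambda>x. f x * g x) (a * b)"
proof -
  have "a * L2_norm g \<le> a * b"
    using g sup_bounded_nonneg[OF f] by (intro mult_left_mono) (auto simp: L2_bounded_def)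
  then show ?thesis
    using f g square_integrable_mult_bounded[of g f a] L2_norm_mult_bounded[of g f a]
    by (auto simp: L2_bounded_def sup_bounded_def)
qed

lemma L2_bounded_mult_L2_bounded:
  assumes f: "L2_bounded f a" and g: "L2_bounded g b"
  shows "L1_bounded (\<lambda>x. f x * g x) (a * b)"
proof -
  have "L2_norm f * L2_norm g \<le> a * b"
    using f g L2_bounded_nonneg[OF f] by (intro mult_mono) (auto simp: L2_bounded_def)
  then show ?thesis
    using f g integrable_mult[of f g] integral_norm_mult_le[of f g]
    by (auto simp: L1_bounded_def L2_bounded_def)
qed

text \<open>By \<open>D_y (f g) = (D_y f) g + f(. + y) (D_y g)\<close> every quotient doubles the
  number of terms, whence \<open>2 ^ length ys\<close>. Invariance of \<open>P\<close> under shifts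
  absorbs the translated factor.\<close>

lemma diff_quots_mult_bound:
  fixes P Q R :: "(real \<Rightarrow> complex) \<Rightarrow> real \<Rightarrow> bool"
  assumes shift: "\<And>f a y. P f a \<Longrightarrow> P (shift y f) a"
    and mult: "\<And>f g a b. P f a \<Longrightarrow> Q g b \<Longrightarrow> R (\<lambda>x. f x * g x) (a * b)"
    and add: "\<And>f g a b. R f a \<Longrightarrow> R g b \<Longrightarrow> R (\<lambda>x. f x + g x) (a + b)"
    and f: "\<And>zs. length zs \<le> length ys \<Longrightarrow> set zs \<subseteq> {0<..} \<Longrightarrow> P (diff_quots h zs f) a"
    and g: "\<And>zs. length zs \<le> length ys \<Longrightarrow> set zs \<subseteq> {0<..} \<Longrightarrow> Q (diff_quots h zs g) b"
    and ys: "set ys \<subseteq> {0<..}"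
  shows "R (diff_quots h ys (\<lambda>x. f x * g x)) (2 ^ length ys * (a * b))"
  using f g ys
proof (induction ys arbitrary: f g)
  case Nil
  show ?case using Nil(1)[of "[]"] Nil(2)[of "[]"] mult by simp
next
  case (Cons y ys)
  have y: "0 < y" using Cons.prems(3) by simp
  have "diff_quot h y (\<lambda>x. f x * g x)
      = (\<lambda>x. diff_quot h y f x * g x + shift y f x * diff_quot h y g x)"
    by (auto simp: diff_quot_def algebra_simps)
  then have eq: "diff_quots h (y # ys) (\<lambda>x. f x * g x)
      = (\<lambda>x. diff_quots h ys (\<lambda>x. diff_quot h y f x * g x) x + diff_quots h ys (\<lambda>x. shift y f x * diff_quot h y g x) x)"
    unfolding diff_quots_diff_quot[symmetric] by (simp only: diff_quots_add)
  have "R (diff_quots h ys (\<lambda>x. diff_quot h y f x * g x)) (2 ^ length ys * (a * b))"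
    using Cons.prems y by (intro Cons.IH) (auto simp: diff_quots_diff_quot simp del: diff_quots.simps)
  moreover have "R (diff_quots h ys (\<lambda>x. shift y f x * diff_quot h y g x)) (2 ^ length ys * (a * b))"
    using Cons.prems y
    by (intro Cons.IH) (auto simp: diff_quots_diff_quot diff_quots_shift shift simp del: diff_quots.simps shift_apply)
  ultimately have "R (\<lambda>x. diff_quots h ys (\<lambda>x. diff_quot h y f x * g x) x + diff_quots h ys (\<lambda>x. shift y f x * diff_quot h y g x) x)
      (2 ^ length ys * (a * b) + 2 ^ length ys * (a * b))"
    by (rule add)
  moreover have "2 ^ length ys * (a * b) + 2 ^ length ys * (a * b) = 2 ^ length (y # ys) * (a * b)"
    by simp
  ultimately show ?case unfolding eq by (simp only:)
qed

text \<open>In the remainder at least one quotient falls on \<open>\<Phi>\<close>, so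
  \<open>u\<close> carries fewer than \<open>length ys\<close>. The principal term keeps
  \<open>\<Phi>\<close> itself, which for real \<open>\<Phi>\<close> cancels in the energy
  identity.\<close>

lemma diff_quots_commutator:
  assumes A: "\<And>zs. zs \<noteq> [] \<Longrightarrow> length zs \<le> length ys \<Longrightarrow> set zs \<subseteq> {0<..} \<Longrightarrow> sup_bounded (diff_quots h zs \<Phi>) A"
    and B: "\<And>zs. length zs < length ys \<Longrightarrow> set zs \<subseteq> {0<..} \<Longrightarrow> L2_bounded (diff_quots h zs u) B"
    and ys: "set ys \<subseteq> {0<..}"
  shows "\<exists>R. L2_bounded R (real (length ys) * 2 ^ length ys * (A * B)) \<and>
    (\<forall>x. diff_quots h ys (\<lambda>x. \<Phi> x * u x) x = \<Phi> x * diff_quots h ys u x + R x)"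
  using A B ys
proof (induction ys arbitrary: u)
  case Nil
  then show ?case by (intro exI[of _ "\<lambda>x. 0"]) (simp add: L2_bounded_def)
next
  case (Cons y ys)
  have y: "0 < y" using Cons.prems(3) by simp
  have AB: "0 \<le> A * B"
    using sup_bounded_nonneg[OF Cons.prems(1)[of "[y]"]] L2_bounded_nonneg[OF Cons.prems(2)[of "[]"]] y by simp
  \<comment> \<open>Here the translation is put on \<open>u\<close>, the opposite choice to
    \<open>diff_quots_mult_bound\<close>: the principal coefficient must stay untranslated.\<close>
  have "diff_quot h y (\<lambda>x. \<Phi> x * u x)
      = (\<lambda>x. \<Phi> x * diff_quot h y u x + diff_quot h y \<Phi> x * shift y u x)"
    by (auto simp: diff_quot_def algebra_simps)
  then have eq: "diff_quots h (y # ys) (\<lambda>x. \<Phi> x * u x)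
      = (\<lambda>x. diff_quots h ys (\<lambda>x. \<Phi> x * diff_quot h y u x) x + diff_quots h ys (\<lambda>x. diff_quot h y \<Phi> x * shift y u x) x)"
    unfolding diff_quots_diff_quot[symmetric] by (simp only: diff_quots_add)
  have "\<exists>R. L2_bounded R (real (length ys) * 2 ^ length ys * (A * B)) \<and>
    (\<forall>x. diff_quots h ys (\<lambda>x. \<Phi> x * diff_quot h y u x) x = \<Phi> x * diff_quots h ys (diff_quot h y u) x + R x)"
  proof (rule Cons.IH)
    show "sup_bounded (diff_quots h zs \<Phi>) A" if "zs \<noteq> []" "length zs \<le> length ys" "set zs \<subseteq> {0<..}" for zs
      using Cons.prems(1)[of zs] that by simp
    show "L2_bounded (diff_quots h zs (diff_quot h y u)) B" if "length zs < length ys" "set zs \<subseteq> {0<..}" for zs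
      using Cons.prems(2)[of "y # zs"] that y by (simp add: diff_quots_diff_quot)
    show "set ys \<subseteq> {0<..}" using Cons.prems(3) by simp
  qed
  then obtain R where R: "L2_bounded R (real (length ys) * 2 ^ length ys * (A * B))"
    "\<And>x. diff_quots h ys (\<lambda>x. \<Phi> x * diff_quot h y u x) x = \<Phi> x * diff_quots h ys (diff_quot h y u) x + R x"
    by blast
  have S: "L2_bounded (diff_quots h ys (\<lambda>x. diff_quot h y \<Phi> x * shift y u x)) (2 ^ length ys * (A * B))"
  proof (rule diff_quots_mult_bound[where P = sup_bounded and Q = L2_bounded and R = L2_bounded])
    show "sup_bounded (diff_quots h zs (diff_quot h y \<Phi>)) A" if "length zs \<le> length ys" "set zs \<subseteq> {0<..}" for zs
      using Cons.prems(1)[of "y # zs"] that y by (simp add: diff_quots_diff_quot)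
    show "L2_bounded (diff_quots h zs (shift y u)) B" if "length zs \<le> length ys" "set zs \<subseteq> {0<..}" for zs
      using Cons.prems(2)[of zs] that by (simp add: diff_quots_shift L2_bounded_shift)
    show "set ys \<subseteq> {0<..}" using Cons.prems(3) by simp
  qed (auto intro: sup_bounded_shift sup_bounded_mult_L2_bounded L2_bounded_add)
  \<comment> \<open>Each peeled quotient adds one Leibniz expansion of at most
    \<open>2 ^ length ys\<close> terms, which accounts for the factor \<open>length ys\<close> in
    the constant.\<close>
  have "real (length ys) * 2 ^ length ys * (A * B) + 2 ^ length ys * (A * B)
      = real (length (y # ys)) * 2 ^ length ys * (A * B)"
    by (simp add: algebra_simps)
  also have "\<dots> \<le> real (length (y # ys)) * 2 ^ length (y # ys) * (A * B)"
    by (intro mult_right_mono mult_left_mono power_increasing) (auto simp: AB)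
  finally have "L2_bounded (\<lambda>x. R x + diff_quots h ys (\<lambda>x. diff_quot h y \<Phi> x * shift y u x) x)
      (real (length (y # ys)) * 2 ^ length (y # ys) * (A * B))"
    by (rule L2_bounded_mono[OF L2_bounded_add[OF R(1) S]])
  then show ?case
    unfolding eq using R(2) by (intro exI conjI) (auto simp: diff_quots_diff_quot)
qed

text \<open>A complex-valued copy of \<open>convolve\<close>, since \<open>diff_quots\<close> acts
  on complex functions and is to be applied to the mean field and to its density.\<close>

definition complex_convolve :: "(real \<Rightarrow> real) \<Rightarrow> (real \<Rightarrow> complex) \<Rightarrow> real \<Rightarrow> complex" where
  "complex_convolve V r x = (LINT z|lborel. of_real (V (x - z)) * r z)"

lemma of_real_convolve: "of_real (convolve V r x) = complex_convolve V (\<lambda>x. of_real (r x)) x"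
  unfolding convolve_def complex_convolve_def integral_complex_of_real[symmetric] by simp

text \<open>For the actual potential \<open>K\<close> is \<open>1 / \<epsilon>\<close>, which blows
  up; it guarantees that the convolutions exist, while the uniform estimates rest on the Lipschitz
  constant.\<close>

context
  fixes V :: "real \<Rightarrow> real" and K :: real
  assumes V [measurable]: "V \<in> borel_measurable borel" and V_bound: "\<And>x. \<bar>V x\<bar> \<le> K"
begin

lemma integrable_complex_convolve:
  fixes r :: "real \<Rightarrow> complex"
  assumes r: "integrable lborel r"
  shows "integrable lborel (\<lambda>z. of_real (V (x - z)) * r z)"
proof -
  note [measurable] = borel_measurable_integrable[OF r]
  show ?thesis
    by (rule Bochner_Integration.integrable_bound[OF integrable_mult_right[OF integrable_norm[OF r], of K]])
      (use V_bound order_trans[OF _ abs_ge_self] in \<open>auto simp: norm_mult abs_mult intro!: AE_I2 mult_right_mono\<close>)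
qed

lemma measurable_complex_convolve:
  assumes [measurable]: "r \<in> borel_measurable borel"
  shows "complex_convolve V r \<in> borel_measurable borel"
  unfolding complex_convolve_def by measurable

lemma sup_bounded_complex_convolve:
  assumes r: "L1_bounded r a"
  shows "sup_bounded (complex_convolve V r) (K * a)"
proof -
  have i: "integrable lborel r" using r by (simp add: L1_bounded_def)
  have K: "0 \<le> K" using V_bound[of 0] by linarith
  have "cmod (complex_convolve V r x) \<le> K * a" for x
  proof -
    have "cmod (complex_convolve V r x) \<le> (LINT z|lborel. K * cmod (r z))"
      unfolding complex_convolve_def
      by (rule Bochner_Integration.integral_norm_bound_integral)
        (use integrable_complex_convolve[OF i] i V_bound in \<open>auto simp: norm_mult intro!: mult_right_mono\<close>)
    also have "\<dots> \<le> K * a" using r K by (simp add: L1_bounded_def mult_left_mono)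
    finally show ?thesis .
  qed
  then show ?thesis
    using measurable_complex_convolve borel_measurable_integrable[OF i] by (simp add: sup_bounded_def)
qed

text \<open>Convolution commutes with translation, so each quotient can be placed on either
  factor.\<close>

lemma diff_quot_complex_convolve:
  assumes r: "integrable lborel r"
  shows "integrable lborel (diff_quot h y r)"
    and "diff_quot h y (complex_convolve V r) = complex_convolve V (diff_quot h y r)"
proof -
  have ry: "integrable lborel (\<lambda>x. r (x + y))" using r by (simp add: integrable_lborel_shift)
  show "integrable lborel (diff_quot h y r)" unfolding diff_quot_def using r ry by simp
  have "complex_convolve V r (x + y) = complex_convolve V (\<lambda>x. r (x + y)) x" for x
    using integral_lborel_shift[of "\<lambda>z. of_real (V (x + y - z)) * r z" y]
    by (simp add: complex_convolve_def)
  then show "diff_quot h y (complex_convolve V r) = complex_convolve V (diff_quot h y r)"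
    using integrable_complex_convolve[OF r] integrable_complex_convolve[OF ry]
    by (simp add: diff_quot_def complex_convolve_def fun_eq_iff mult.left_commute[of "of_real (V _)"]
        flip: right_diff_distrib Bochner_Integration.integral_diff)
qed

lemma
  assumes r: "integrable lborel r"
  shows integrable_diff_quots: "integrable lborel (diff_quots h ys r)"
    and diff_quots_complex_convolve: "diff_quots h ys (complex_convolve V r) = complex_convolve V (diff_quots h ys r)"
proof (induction ys)
  case (Cons y ys)
  case 1 show ?case using diff_quot_complex_convolve(1)[OF Cons(1)] by simp
  case 2 show ?case using diff_quot_complex_convolve(2)[OF Cons(1)] Cons(2) by simp
qed (simp_all add: r)

text \<open>The quotient is left on \<open>V\<close>: an increment of \<open>V\<close> is at most
  \<open>y / 2\<close>, and the prefactor \<open>h / y\<close> turns this into \<open>h / 2\<close>,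
  free of \<open>y\<close>.\<close>

lemma sup_bounded_diff_quot_complex_convolve:
  assumes lip: "\<And>x y. \<bar>V x - V y\<bar> \<le> 1 / 2 * \<bar>x - y\<bar>" and r: "L1_bounded r a" and h: "0 \<le> h" and y: "0 < y"
  shows "sup_bounded (diff_quot h y (complex_convolve V r)) (h / 2 * a)"
proof -
  have i: "integrable lborel r" using r by (simp add: L1_bounded_def)
  have "cmod (diff_quot h y (complex_convolve V r) x) \<le> h / 2 * a" for x
  proof -
    have "complex_convolve V r (x + y) - complex_convolve V r x
        = (LINT z|lborel. of_real (V (x + y - z) - V (x - z)) * r z)"
      using integrable_complex_convolve[OF i]
      by (simp add: complex_convolve_def left_diff_distrib)
    also have "cmod \<dots> \<le> (LINT z|lborel. y / 2 * cmod (r z))"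
    proof (rule Bochner_Integration.integral_norm_bound_integral)
      show "integrable lborel (\<lambda>z. of_real (V (x + y - z) - V (x - z)) * r z)"
        using Bochner_Integration.integrable_diff[OF integrable_complex_convolve[OF i, of "x + y"] integrable_complex_convolve[OF i, of x]]
        by (simp add: left_diff_distrib)
      show "cmod (of_real (V (x + y - z) - V (x - z)) * r z) \<le> y / 2 * cmod (r z)" for z
        using lip[of "x + y - z" "x - z"] y
        unfolding norm_mult norm_of_real by (intro mult_right_mono) auto
    qed (use i in auto)
    also have "\<dots> \<le> y / 2 * a" using r y by (simp add: L1_bounded_def)
    finally have "h / y * cmod (complex_convolve V r (x + y) - complex_convolve V r x) \<le> h / y * (y / 2 * a)"
      using h y by (intro mult_left_mono) auto
    then show ?thesis using h y by (simp add: diff_quot_def norm_mult norm_divide)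
  qed
  then show ?thesis
    using measurable_complex_convolve borel_measurable_integrable[OF i]
    by (simp add: sup_bounded_def diff_quot_def)
qed

text \<open>The increment of \<open>V * \<bar>u\<bar>\<^sup>2\<close> puts one difference quotient on \<open>V\<close> and the remaining ones on
  \<open>\<bar>u\<bar>\<^sup>2\<close>, so the commutator only sees difference quotients of \<open>u\<close> of strictly lower order, and it carries
  the factor \<open>h\<close> that cancels the \<open>1/h\<close> of the equation.\<close>

lemma Hartree_commutator:
  assumes lip: "\<And>x y. \<bar>V x - V y\<bar> \<le> 1 / 2 * \<bar>x - y\<bar>"
    and B: "\<And>zs. length zs < length ys \<Longrightarrow> set zs \<subseteq> {0<..} \<Longrightarrow> L2_bounded (diff_quots h zs u) B"
    and u: "square_integrable u" and ys: "set ys \<subseteq> {0<..}" and h: "0 \<le> h"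
  shows "\<exists>R. L2_bounded R (h * (real (length ys) * 4 ^ length ys * B ^ 3)) \<and>
    (\<forall>x. diff_quots h ys (\<lambda>x. complex_convolve V (\<lambda>x. u x * cnj (u x)) x * u x) x =
      complex_convolve V (\<lambda>x. u x * cnj (u x)) x * diff_quots h ys u x + R x)"
proof (cases "ys = []")
  case True
  then show ?thesis by (intro exI[of _ "\<lambda>x. 0"]) (simp add: L2_bounded_def)
next
  case False
  let ?n = "length ys" and ?r = "\<lambda>x. u x * cnj (u x)"
  have B0: "0 \<le> B" using L2_bounded_nonneg[OF B[of "[]"]] False by simp
  have r: "integrable lborel ?r" by (intro integrable_mult u square_integrable_cnj)
  have sup: "sup_bounded (diff_quots h zs (complex_convolve V ?r)) (h / 2 * (2 ^ ?n * (B * B)))"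
    if zs: "zs \<noteq> []" "length zs \<le> ?n" "set zs \<subseteq> {0<..}" for zs
  proof -
    \<comment> \<open>The quotient with step \<open>y\<close> is reserved for \<open>V\<close>; the
      remaining ones, fewer than \<open>?n\<close>, go to \<open>|u|^2\<close>, so the assumption on
      lower orders covers both factors there.\<close>
    obtain y ws where zs_eq: "zs = y # ws" using zs(1) by (cases zs) auto
    have "L1_bounded (diff_quots h ws ?r) (2 ^ length ws * (B * B))"
    proof (rule diff_quots_mult_bound[where P = L2_bounded and Q = L2_bounded and R = L1_bounded])
      show "L2_bounded (diff_quots h vs u) B" if "length vs \<le> length ws" "set vs \<subseteq> {0<..}" for vs
        using B[of vs] zs zs_eq that by simp
      then show "L2_bounded (diff_quots h vs (\<lambda>x. cnj (u x))) B" if "length vs \<le> length ws" "set vs \<subseteq> {0<..}" for vs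
        using that by (simp add: diff_quots_cnj L2_bounded_def square_integrable_cnj L2_norm_cnj)
      show "set ws \<subseteq> {0<..}" using zs zs_eq by simp
    qed (auto intro: L2_bounded_shift L2_bounded_mult_L2_bounded L1_bounded_add)
    moreover have "2 ^ length ws * (B * B) \<le> 2 ^ ?n * (B * B)"
      using zs zs_eq B0 by (intro mult_right_mono power_increasing) auto
    ultimately have "L1_bounded (diff_quots h ws ?r) (2 ^ ?n * (B * B))"
      by (auto simp: L1_bounded_def)
    then have "sup_bounded (diff_quot h y (complex_convolve V (diff_quots h ws ?r))) (h / 2 * (2 ^ ?n * (B * B)))"
      using zs zs_eq h by (intro sup_bounded_diff_quot_complex_convolve lip) auto
    then show ?thesis
      unfolding zs_eq diff_quots.simps by (subst diff_quots_complex_convolve[OF r])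
  qed
  obtain R where R: "L2_bounded R (real ?n * 2 ^ ?n * (h / 2 * (2 ^ ?n * (B * B)) * B))"
    "\<forall>x. diff_quots h ys (\<lambda>x. complex_convolve V ?r x * u x) x = complex_convolve V ?r x * diff_quots h ys u x + R x"
    using diff_quots_commutator[OF sup B ys] by blast
  \<comment> \<open>One power of 2 comes from the commutator and one from expanding
    \<open>|u|^2\<close>, hence \<open>4 ^ ?n\<close>; two factors \<open>B\<close> come from the
    density and one from \<open>u\<close>.\<close>
  have "real ?n * 2 ^ ?n * (h / 2 * (2 ^ ?n * (B * B)) * B) = h * (real ?n * 4 ^ ?n * B ^ 3) / 2"
    by (simp add: power3_eq_cube power_mult_distrib[symmetric] flip: power_mult_distrib)
  also have "\<dots> \<le> h * (real ?n * 4 ^ ?n * B ^ 3)" using h B0 by simp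
  finally show ?thesis using R L2_bounded_mono by blast
qed

end

section \<open>The screened potential\<close>

lemma measurable_potential [measurable]: "potential \<kappa> \<epsilon> \<in> borel_measurable borel"
  unfolding potential_def[abs_def] by measurable

text \<open>On the half line \<open>F a = a exp (- \<epsilon> a)\<close> has slope
  \<open>(1 - \<epsilon> a) exp (- \<epsilon> a)\<close>, and
  \<open>|1 - \<epsilon> a| <= exp (\<epsilon> a)\<close> bounds it by 1 for every
  \<open>\<epsilon>\<close>. The reverse triangle inequality extends this to \<open>F |x|\<close>,
  and the prefactor gives 1/2.\<close>

lemma
  assumes \<kappa>: "\<kappa> \<in> {1, -1}" and \<epsilon>: "0 < \<epsilon>"
  shows potential_bound: "\<bar>potential \<kappa> \<epsilon> x\<bar> \<le> 1 / \<epsilon>"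
    and potential_lipschitz: "\<bar>potential \<kappa> \<epsilon> x - potential \<kappa> \<epsilon> y\<bar> \<le> 1 / 2 * \<bar>x - y\<bar>"
proof -
  define F where "F a = a * exp (- \<epsilon> * a)" for a :: real
  have p: "potential \<kappa> \<epsilon> x = \<kappa> * (1 / 2) * F \<bar>x\<bar>" for x by (simp add: potential_def F_def)
  have "F a \<le> 1 / \<epsilon>" for a
  proof -
    have "\<epsilon> * a \<le> exp (\<epsilon> * a)" using exp_ge_add_one_self[of "\<epsilon> * a"] by linarith
    then show ?thesis using \<epsilon> by (simp add: F_def exp_minus field_simps)
  qed
  moreover have "0 \<le> F \<bar>x\<bar>" for x by (simp add: F_def)
  ultimately have "\<bar>F \<bar>x\<bar>\<bar> \<le> 1 / \<epsilon>" by simp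
  moreover have "\<bar>potential \<kappa> \<epsilon> x\<bar> = 1 / 2 * \<bar>F \<bar>x\<bar>\<bar>" using \<kappa> by (auto simp: p abs_mult)
  ultimately show "\<bar>potential \<kappa> \<epsilon> x\<bar> \<le> 1 / \<epsilon>" by linarith
  have der: "(F has_field_derivative (1 - \<epsilon> * a) * exp (- \<epsilon> * a)) (at a within {0..})" for a
    unfolding F_def by (auto intro!: derivative_eq_intros simp: algebra_simps)
  have "norm ((1 - \<epsilon> * a) * exp (- \<epsilon> * a)) \<le> 1" if "0 \<le> a" for a
  proof -
    have "\<bar>1 - \<epsilon> * a\<bar> \<le> exp (\<epsilon> * a)"
      using exp_ge_add_one_self[of "\<epsilon> * a"] that \<epsilon> by (auto simp: abs_le_iff intro: order_trans[OF _ exp_ge_add_one_self])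
    then show ?thesis by (simp add: abs_mult exp_minus field_simps)
  qed
  then have "\<bar>F a - F b\<bar> \<le> 1 * \<bar>a - b\<bar>" if "0 \<le> a" "0 \<le> b" for a b
    using field_differentiable_bound[of "{0..}" F _ 1 b a, OF _ der] that by simp
  then have "\<bar>F \<bar>x\<bar> - F \<bar>y\<bar>\<bar> \<le> \<bar>x - y\<bar>"
    using abs_triangle_ineq3[of x y] by (smt (verit) abs_ge_zero)
  moreover have "\<bar>potential \<kappa> \<epsilon> x - potential \<kappa> \<epsilon> y\<bar> = 1 / 2 * \<bar>F \<bar>x\<bar> - F \<bar>y\<bar>\<bar>"
  proof -
    have "\<bar>potential \<kappa> \<epsilon> x - potential \<kappa> \<epsilon> y\<bar> = \<bar>\<kappa> * (1 / 2) * (F \<bar>x\<bar> - F \<bar>y\<bar>)\<bar>"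
      by (simp only: p right_diff_distrib)
    also have "\<dots> = 1 / 2 * \<bar>F \<bar>x\<bar> - F \<bar>y\<bar>\<bar>" unfolding abs_mult using \<kappa> by auto
    finally show ?thesis .
  qed
  ultimately show "\<bar>potential \<kappa> \<epsilon> x - potential \<kappa> \<epsilon> y\<bar> \<le> 1 / 2 * \<bar>x - y\<bar>" by simp
qed


section \<open>Energy estimates\<close>

lemma L2_norm_power2_has_derivative:
  assumes u: "\<And>t. 0 \<le> t \<Longrightarrow> square_integrable (u t)" and u': "\<And>t. 0 \<le> t \<Longrightarrow> square_integrable (u' t)"
    and d: "has_L2_derivative_on u u' {0..}" and t: "0 \<le> t"
  shows "((\<lambda>t. (L2_norm (u t))\<^sup>2) has_field_derivative 2 * Re (L2_inner (u t) (u' t))) (at t within {0..})"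
proof -
  let ?e = "\<lambda>s. L2_norm (\<lambda>x. (u s x - u t x) / of_real (s - t) - u' t x)"
  let ?b = "\<lambda>s. 2 * L2_norm (u t) * ?e s + \<bar>s - t\<bar> * (L2_norm (u' t) + ?e s)\<^sup>2"
  have e: "(?e \<longlongrightarrow> 0) (at t within {0..})" using d t by (simp add: has_L2_derivative_on_def)
  have "(?b \<longlongrightarrow> 2 * L2_norm (u t) * 0 + \<bar>t - t\<bar> * (L2_norm (u' t) + 0)\<^sup>2) (at t within {0..})"
    by (intro tendsto_intros e)
  then have b: "(?b \<longlongrightarrow> 0) (at t within {0..})" by simp
  have "\<forall>\<^sub>F s in at t within {0..}.
      norm (((L2_norm (u s))\<^sup>2 - (L2_norm (u t))\<^sup>2) / (s - t) - 2 * Re (L2_inner (u t) (u' t))) \<le> ?b s"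
    unfolding eventually_at_filter
  proof (rule always_eventually, intro allI impI)
    fix s assume st: "s \<noteq> t" and s: "s \<in> {0..}"
    define w where "w x = (u s x - u t x) / of_real (s - t)" for x
    have us: "square_integrable (u s)" and ut: "square_integrable (u t)" and u't: "square_integrable (u' t)"
      using s t u u' by auto
    have w: "square_integrable w"
      using square_integrable_scale[OF square_integrable_diff[OF us ut], of "1 / of_real (s - t)"]
      by (simp add: w_def[abs_def] del: of_real_diff)
    have ws: "square_integrable (\<lambda>x. of_real (s - t) * w x)" by (rule square_integrable_scale[OF w])
    have dw: "square_integrable (\<lambda>x. w x - u' t x)" by (rule square_integrable_diff[OF w u't])
    have eq: "u s = (\<lambda>x. u t x + of_real (s - t) * w x)"
      using st by (simp add: w_def)
    have "(L2_norm (u s))\<^sup>2 - (L2_norm (u t))\<^sup>2 = 2 * Re (of_real (s - t) * L2_inner (u t) w) + (\<bar>s - t\<bar> * L2_norm w)\<^sup>2"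
      unfolding eq L2_norm_add_power2[OF ut ws] L2_inner_scale_right L2_norm_scale[OF w] norm_of_real by simp
    also have "\<dots> = (s - t) * (2 * Re (L2_inner (u t) w) + (s - t) * (L2_norm w)\<^sup>2)"
      unfolding power_mult_distrib power2_abs by (simp add: power2_eq_square algebra_simps del: of_real_diff)
    finally have q: "((L2_norm (u s))\<^sup>2 - (L2_norm (u t))\<^sup>2) / (s - t) = 2 * Re (L2_inner (u t) w) + (s - t) * (L2_norm w)\<^sup>2"
      using st by simp
    have q2: "((L2_norm (u s))\<^sup>2 - (L2_norm (u t))\<^sup>2) / (s - t) - 2 * Re (L2_inner (u t) (u' t))
        = 2 * Re (L2_inner (u t) (\<lambda>x. w x - u' t x)) + (s - t) * (L2_norm w)\<^sup>2"
      unfolding q L2_inner_diff_right[OF ut w u't] by simp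
    have "norm (2 * Re (L2_inner (u t) (\<lambda>x. w x - u' t x)) + (s - t) * (L2_norm w)\<^sup>2)
        \<le> 2 * (L2_norm (u t) * ?e s) + \<bar>s - t\<bar> * (L2_norm (u' t) + ?e s)\<^sup>2"
    proof (rule norm_triangle_le, rule add_mono)
      have "\<bar>Re (L2_inner (u t) (\<lambda>x. w x - u' t x))\<bar> \<le> L2_norm (u t) * L2_norm (\<lambda>x. w x - u' t x)"
        using abs_Re_le_cmod norm_L2_inner_le[OF ut dw] by (rule order_trans)
      then show "norm (2 * Re (L2_inner (u t) (\<lambda>x. w x - u' t x))) \<le> 2 * (L2_norm (u t) * ?e s)"
        by (simp add: w_def)
      have "L2_norm w \<le> L2_norm (u' t) + ?e s"
        using L2_norm_le_add_diff[OF w u't] by (simp add: w_def)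
      then show "norm ((s - t) * (L2_norm w)\<^sup>2) \<le> \<bar>s - t\<bar> * (L2_norm (u' t) + ?e s)\<^sup>2"
        by (auto simp: abs_mult intro!: mult_left_mono power_mono)
    qed
    then show "norm (((L2_norm (u s))\<^sup>2 - (L2_norm (u t))\<^sup>2) / (s - t) - 2 * Re (L2_inner (u t) (u' t))) \<le> ?b s"
      unfolding q2 by (simp only: mult.assoc)
  qed
  from LIM_zero_cancel[OF Lim_null_comparison[OF this b]] show ?thesis
    by (simp only: has_field_derivative_iff)
qed

text \<open>The hypothesis says formally that the norm grows at rate at most \<open>B\<close>;
  dividing by the norm is what needs care, since it may vanish.\<close>

lemma L2_norm_growth:
  assumes u: "\<And>t. 0 \<le> t \<Longrightarrow> square_integrable (u t)" and u': "\<And>t. 0 \<le> t \<Longrightarrow> square_integrable (u' t)"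
    and d: "has_L2_derivative_on u u' {0..}" and T: "0 \<le> T" and B: "0 \<le> B"
    and le: "\<And>t. 0 < t \<Longrightarrow> t < T \<Longrightarrow> Re (L2_inner (u t) (u' t)) \<le> L2_norm (u t) * B"
  shows "L2_norm (u T) \<le> L2_norm (u 0) + T * B"
proof (cases "T = 0")
  case False
  then have T: "0 < T" using assms(4) by simp
  define N where "N t = (L2_norm (u t))\<^sup>2" for t
  have N': "(N has_field_derivative 2 * Re (L2_inner (u t) (u' t))) (at t within {0..})" if "0 \<le> t" for t
    unfolding N_def by (rule L2_norm_power2_has_derivative[OF u u' d that])
  have cont: "continuous_on {0..T} N"
    using DERIV_continuous_on[of "{0..}" N, OF N'] by (auto intro: continuous_on_subset)
  have "L2_norm (u T) \<le> L2_norm (u 0) + T * B + e" if e: "0 < e" for e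
  proof -
    \<comment> \<open>Adding \<open>e^2\<close> under the root makes it differentiable where the
      norm is 0, at the cost of an error \<open>e\<close> that is sent to 0 at the end.\<close>
    let ?G = "\<lambda>t. sqrt (N t + e\<^sup>2) - B * t"
    have pos: "0 < N t + e\<^sup>2" for t using e by (simp add: N_def add_nonneg_pos)
    have "?G 0 \<ge> ?G T"
    proof (rule DERIV_nonpos_imp_decreasing_open[OF less_imp_le[OF T]])
      show "continuous_on {0..T} ?G" by (intro continuous_intros cont)
      fix t assume t: "0 < t" "t < T"
      have at: "at t within {0..} = at t" by (rule at_within_open_subset[of t "{0<..}"]) (use t in auto)
      let ?D = "2 * Re (L2_inner (u t) (u' t))"
      have "((\<lambda>t. N t + e\<^sup>2) has_field_derivative ?D + 0) (at t)"
        using N'[of t] t unfolding at by (intro DERIV_add DERIV_const) simp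
      from DERIV_diff[OF DERIV_chain2[OF DERIV_real_sqrt[OF pos] this] DERIV_cmult_Id[of B]]
      have "(?G has_field_derivative inverse (sqrt (N t + e\<^sup>2)) / 2 * (?D + 0) - B) (at t)" .
      then have "(?G has_field_derivative ?D / (2 * sqrt (N t + e\<^sup>2)) - B) (at t)"
        by (simp only: add_0_right divide_inverse inverse_mult_distrib mult_ac)
      moreover have "?D / (2 * sqrt (N t + e\<^sup>2)) \<le> B"
      proof -
        have "L2_norm (u t) \<le> sqrt (N t + e\<^sup>2)" by (rule real_le_rsqrt) (simp add: N_def)
        then have "L2_norm (u t) * B \<le> sqrt (N t + e\<^sup>2) * B" using B by (rule mult_right_mono)
        then have "?D \<le> B * (2 * sqrt (N t + e\<^sup>2))" using le[OF t] by (simp add: mult.commute)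
        then show ?thesis using pos[of t] by (simp add: divide_le_eq)
      qed
      ultimately show "\<exists>y. (?G has_field_derivative y) (at t) \<and> y \<le> 0" by force
    qed
    moreover have "L2_norm (u T) \<le> sqrt (N T + e\<^sup>2)" by (rule real_le_rsqrt) (simp add: N_def)
    moreover have "sqrt (N 0 + e\<^sup>2) \<le> L2_norm (u 0) + e"
      using sqrt_add_le_add_sqrt[of "N 0" "e\<^sup>2"] e by (simp add: N_def)
    ultimately show ?thesis by (simp add: mult.commute)
  qed
  then show ?thesis by (rule field_le_epsilon)
qed simp

text \<open>Used for iterated quotients and for multiplication by a bounded weight. \<open>K\<close>
  may depend on \<open>h\<close>, the steps and the cutoff, because only its existence matters
  here.\<close>

lemma has_L2_derivative_on_bounded_operator:
  assumes u: "\<And>t. 0 \<le> t \<Longrightarrow> square_integrable (u t)" and u': "\<And>t. 0 \<le> t \<Longrightarrow> square_integrable (u' t)"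
    and d: "has_L2_derivative_on u u' {0..}"
    and A: "\<And>f. square_integrable f \<Longrightarrow> L2_norm (A f) \<le> K * L2_norm f"
    and lin: "\<And>f g k c. A (\<lambda>x. (f x - g x) / c - k x) = (\<lambda>x. (A f x - A g x) / c - A k x)"
  shows "has_L2_derivative_on (\<lambda>t. A (u t)) (\<lambda>t. A (u' t)) {0..}"
  unfolding has_L2_derivative_on_def
proof
  fix t :: real assume t: "t \<in> {0..}"
  let ?e = "\<lambda>s x. (u s x - u t x) / of_real (s - t) - u' t x"
  have "((\<lambda>s. K * L2_norm (?e s)) \<longlongrightarrow> K * 0) (at t within {0..})"
    using d t unfolding has_L2_derivative_on_def by (intro tendsto_mult_left) auto
  then have K: "((\<lambda>s. K * L2_norm (?e s)) \<longlongrightarrow> 0) (at t within {0..})" by simp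
  have "\<forall>\<^sub>F s in at t within {0..}. norm (L2_norm (A (?e s))) \<le> K * L2_norm (?e s)"
    unfolding eventually_at_filter
  proof (rule always_eventually, intro allI impI)
    fix s :: real assume "s \<in> {0..}"
    then have "square_integrable (?e s)"
      using square_integrable_diff[OF square_integrable_scale[OF square_integrable_diff[OF u[of s] u[of t]], of "1 / of_real (s - t)"] u'[of t]] t
      by simp
    then show "norm (L2_norm (A (?e s))) \<le> K * L2_norm (?e s)" using A by simp
  qed
  from Lim_null_comparison[OF this K]
  show "((\<lambda>s. L2_norm (\<lambda>x. (A (u s) x - A (u t) x) / of_real (s - t) - A (u' t) x)) \<longlongrightarrow> 0) (at t within {0..})"
    by (simp only: lin)
qed

lemma L2_norm_diff_quots_bounded:
  "\<exists>K\<ge>0. \<forall>f. square_integrable f \<longrightarrow> L2_norm (diff_quots h ys f) \<le> K * L2_norm f"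
proof (induction ys)
  case (Cons y ys)
  then obtain K where K: "0 \<le> K" "\<And>f. square_integrable f \<Longrightarrow> L2_norm (diff_quots h ys f) \<le> K * L2_norm f" by blast
  have "L2_norm (diff_quots h (y # ys) f) \<le> \<bar>h / y\<bar> * (2 * K) * L2_norm f" if f: "square_integrable f" for f
  proof -
    let ?g = "diff_quots h ys f"
    have g: "square_integrable ?g" by (rule square_integrable_diff_quots[OF f])
    have "L2_norm (\<lambda>x. ?g (x + y) - ?g x) \<le> 2 * L2_norm ?g"
      using L2_norm_triangle_diff[OF square_integrable_shift[OF g, of y] g] by (simp add: L2_norm_shift[OF g])
    also have "\<dots> \<le> 2 * K * L2_norm f" using K(2)[OF f] by simp
    finally have "\<bar>h / y\<bar> * L2_norm (\<lambda>x. ?g (x + y) - ?g x) \<le> \<bar>h / y\<bar> * (2 * K * L2_norm f)"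
      by (rule mult_left_mono) simp
    then show ?thesis by (simp add: L2_norm_diff_quot[OF g] mult.assoc)
  qed
  moreover have "0 \<le> \<bar>h / y\<bar> * (2 * K)" using K(1) by simp
  ultimately show ?case by blast
next
  case Nil
  show ?case by (rule exI[of _ 1]) simp
qed

lemma has_L2_derivative_on_diff_quots:
  assumes "\<And>t. 0 \<le> t \<Longrightarrow> square_integrable (u t)" "\<And>t. 0 \<le> t \<Longrightarrow> square_integrable (u' t)"
    and "has_L2_derivative_on u u' {0..}"
  shows "has_L2_derivative_on (\<lambda>t. diff_quots h ys (u t)) (\<lambda>t. diff_quots h ys (u' t)) {0..}"
proof -
  obtain K where K: "\<And>f. square_integrable f \<Longrightarrow> L2_norm (diff_quots h ys f) \<le> K * L2_norm f"
    using L2_norm_diff_quots_bounded by blast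
  have lin: "diff_quots h ys (\<lambda>x. (f x - g x) / c - k x)
      = (\<lambda>x. (diff_quots h ys f x - diff_quots h ys g x) / c - diff_quots h ys k x)" for f g k c
  proof -
    have "(\<lambda>x. (f x - g x) / c - k x) = (\<lambda>x. inverse c * (f x - g x) - k x)"
      by (auto simp: divide_inverse)
    then show ?thesis
      by (simp only: diff_quots_diff diff_quots_scale) (auto simp: divide_inverse)
  qed
  show ?thesis
    by (rule has_L2_derivative_on_bounded_operator[OF assms K lin])
qed

text \<open>This removes the mean field from the energy identities, where it acts as a real
  multiplier, and the leading term of the weighted increment.\<close>

lemma Im_L2_inner_real_multiplier:
  assumes "\<And>x. Im (w x) = 0" "\<And>x. Im (v x) = 0"
  shows "Im (L2_inner (\<lambda>x. w x * f x) (\<lambda>x. v x * f x)) = 0"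
proof -
  have "cnj (w x) = w x" "cnj (v x) = v x" for x using assms by (auto simp: complex_eq_iff)
  then have "cnj (L2_inner (\<lambda>x. w x * f x) (\<lambda>x. v x * f x)) = L2_inner (\<lambda>x. w x * f x) (\<lambda>x. v x * f x)"
    unfolding L2_inner_def Bochner_Integration.integral_cnj[symmetric] by (simp add: mult_ac)
  then show ?thesis by (simp add: complex_eq_iff)
qed

lemma Re_Schroedinger:
  "Re (\<i> * of_real (h / 2) * a + (- \<i> / of_real h) * b) = - (h / 2) * Im a + Im b / h"
  by simp

text \<open>Order 0 is conservation of mass. Higher orders add the bound on the data and
  \<open>t\<close> times the commutator bound with the previous constant inserted; keeping the
  previous constant as a summand makes one value control all orders up to \<open>n\<close>.\<close>

primrec diff_quot_bound :: "real \<Rightarrow> nat \<Rightarrow> real \<Rightarrow> real" where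
  "diff_quot_bound C 0 t = 1"
| "diff_quot_bound C (Suc n) t = diff_quot_bound C n t + C ^ Suc n * real (Suc n) ^ Suc n
     + t * (real (Suc n) * 4 ^ Suc n * diff_quot_bound C n t ^ 3)"

lemma diff_quot_bound_nonneg: "0 \<le> C \<Longrightarrow> 0 \<le> t \<Longrightarrow> 0 \<le> diff_quot_bound C n t"
  by (induction n) auto

lemma diff_quot_bound_mono_nat:
  assumes "0 \<le> C" "0 \<le> t" "m \<le> n"
  shows "diff_quot_bound C m t \<le> diff_quot_bound C n t"
  using assms(3)
proof (induction rule: dec_induct)
  case (step n)
  have "0 \<le> C ^ Suc n * real (Suc n) ^ Suc n" "0 \<le> t * (real (Suc n) * 4 ^ Suc n * diff_quot_bound C n t ^ 3)"
    using assms diff_quot_bound_nonneg[of C t n] by simp_all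
  then show ?case using step by simp
qed simp

lemma diff_quot_bound_mono:
  assumes "0 \<le> C" "0 \<le> s" "s \<le> t"
  shows "diff_quot_bound C n s \<le> diff_quot_bound C n t"
proof (induction n)
  case (Suc n)
  then show ?case
    using assms diff_quot_bound_nonneg[of C s n]
    by (auto intro!: add_mono mult_mono power_mono)
qed simp

text \<open>The witnesses of \<open>nls_solution\<close> fixed once, with \<open>\<psi>xx\<close>
  attached to \<open>\<psi>x\<close> by a first-order weak derivative, the form in which increments
  can be taken twice.\<close>

locale Hartree_solution =
  fixes \<kappa> h \<epsilon> :: real and \<psi> \<psi>t \<psi>x \<psi>xx :: "real \<Rightarrow> real \<Rightarrow> complex"
  assumes \<kappa>: "\<kappa> \<in> {1, -1}" and h: "0 < h" and \<epsilon>: "0 < \<epsilon>"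
    and \<psi>: "\<And>t. 0 \<le> t \<Longrightarrow> square_integrable (\<psi> t)" and \<psi>t: "\<And>t. 0 \<le> t \<Longrightarrow> square_integrable (\<psi>t t)"
    and \<psi>x: "\<And>t. 0 \<le> t \<Longrightarrow> square_integrable (\<psi>x t)" and \<psi>xx: "\<And>t. 0 \<le> t \<Longrightarrow> square_integrable (\<psi>xx t)"
    and deriv_t: "has_L2_derivative_on \<psi> \<psi>t {0..}"
    and deriv_x: "\<And>t. 0 \<le> t \<Longrightarrow> has_weak_deriv (Suc 0) (\<psi> t) (\<psi>x t)"
    and deriv_xx: "\<And>t. 0 \<le> t \<Longrightarrow> has_weak_deriv (Suc 0) (\<psi>x t) (\<psi>xx t)"
    and equation: "\<And>t. 0 \<le> t \<Longrightarrow> AE x in lborel. \<i> * of_real h * \<psi>t t x =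
      - (1 / 2) * (of_real h)\<^sup>2 * \<psi>xx t x
      + of_real (convolve (potential \<kappa> \<epsilon>) (position_density (\<psi> t)) x) * \<psi> t x"
begin

text \<open>The density is written as a product with the conjugate so that the Leibniz rule for
  quotients applies to it.\<close>

definition mean_field :: "real \<Rightarrow> real \<Rightarrow> complex" where
  "mean_field t = complex_convolve (potential \<kappa> \<epsilon>) (\<lambda>x. \<psi> t x * cnj (\<psi> t x))"

lemma mean_field_eq: "mean_field t x = of_real (convolve (potential \<kappa> \<epsilon>) (position_density (\<psi> t)) x)"
  unfolding mean_field_def of_real_convolve
  by (simp add: position_density_def complex_norm_square[symmetric])

lemma Im_mean_field [simp]: "Im (mean_field t x) = 0"
  by (simp add: mean_field_eq)

lemma sup_bounded_mean_field:
  assumes "0 \<le> t"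
  shows "\<exists>B. sup_bounded (mean_field t) B"
proof -
  have "L2_bounded (\<psi> t) (L2_norm (\<psi> t))" "L2_bounded (\<lambda>x. cnj (\<psi> t x)) (L2_norm (\<psi> t))"
    using \<psi>[OF assms] by (simp_all add: L2_bounded_def square_integrable_cnj L2_norm_cnj)
  from sup_bounded_complex_convolve[OF measurable_potential potential_bound[OF \<kappa> \<epsilon>] L2_bounded_mult_L2_bounded[OF this]]
  show ?thesis unfolding mean_field_def by blast
qed

lemma square_integrable_mean_field_mult:
  assumes "0 \<le> t" "square_integrable f"
  shows "square_integrable (\<lambda>x. mean_field t x * f x)"
  using sup_bounded_mean_field[OF assms(1)] square_integrable_mult_bounded[OF assms(2)]
  by (auto simp: sup_bounded_def)

lemma equation_\<psi>t:
  assumes "0 \<le> t"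
  shows "AE x in lborel. \<psi>t t x = \<i> * of_real (h / 2) * \<psi>xx t x + (- \<i> / of_real h) * (mean_field t x * \<psi> t x)"
  using equation[OF assms]
proof eventually_elim
  case (elim x)
  have "\<psi>t t x = (- \<i> / of_real h) * (\<i> * of_real h * \<psi>t t x)" using h by (simp add: field_simps)
  also have "\<dots> = \<i> * of_real (h / 2) * \<psi>xx t x + (- \<i> / of_real h) * (mean_field t x * \<psi> t x)"
    unfolding elim mean_field_eq using h by (simp add: field_simps power2_eq_square)
  finally show ?case .
qed

text \<open>The Laplacian contributes the imaginary part of a real number, and so does the principal
  mean field term. What remains is the commutator, whose factor \<open>h\<close> cancels the
  \<open>1 / h\<close> of the equation.\<close>

lemma energy_diff_quots:
  assumes t: "0 \<le> t" and ys: "set ys \<subseteq> {0<..}"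
    and B: "\<And>zs. length zs < length ys \<Longrightarrow> set zs \<subseteq> {0<..} \<Longrightarrow> L2_bounded (diff_quots h zs (\<psi> t)) B"
  shows "Re (L2_inner (diff_quots h ys (\<psi> t)) (diff_quots h ys (\<psi>t t)))
    \<le> L2_norm (diff_quots h ys (\<psi> t)) * (real (length ys) * 4 ^ length ys * B ^ 3)"
proof -
  let ?u = "diff_quots h ys (\<psi> t)" and ?uxx = "diff_quots h ys (\<psi>xx t)" and ?M = "mean_field t"
    and ?K = "real (length ys) * 4 ^ length ys * B ^ 3"
  have u: "square_integrable ?u" and ux: "square_integrable (diff_quots h ys (\<psi>x t))" and uxx: "square_integrable ?uxx"
    by (intro square_integrable_diff_quots \<psi> \<psi>x \<psi>xx t)+
  obtain R where R: "L2_bounded R (h * ?K)"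
    and R_eq: "\<forall>x. diff_quots h ys (\<lambda>x. ?M x * \<psi> t x) x = ?M x * ?u x + R x"
    using Hartree_commutator[OF measurable_potential potential_bound[OF \<kappa> \<epsilon>] potential_lipschitz[OF \<kappa> \<epsilon>] B \<psi>[OF t] ys] h
    unfolding mean_field_def by force
  have Rs: "square_integrable R" using R by (simp add: L2_bounded_def)
  have Mu: "square_integrable (\<lambda>x. ?M x * ?u x)" by (rule square_integrable_mean_field_mult[OF t u])
  have MuR: "square_integrable (\<lambda>x. ?M x * ?u x + R x)" by (rule square_integrable_add[OF Mu Rs])
  have s1: "square_integrable (\<lambda>x. \<i> * of_real (h / 2) * ?uxx x)" by (rule square_integrable_scale[OF uxx])
  have s2: "square_integrable (\<lambda>x. (- \<i> / of_real h) * (?M x * ?u x + R x))" by (rule square_integrable_scale[OF MuR])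
  have ut: "square_integrable (diff_quots h ys (\<psi>t t))" by (intro square_integrable_diff_quots \<psi>t t)
  have "AE x in lborel. diff_quots h ys (\<psi>t t) x
      = diff_quots h ys (\<lambda>x. \<i> * of_real (h / 2) * \<psi>xx t x + (- \<i> / of_real h) * (?M x * \<psi> t x)) x"
    by (rule AE_diff_quots_cong[OF equation_\<psi>t[OF t]])
  then have AE: "AE x in lborel. diff_quots h ys (\<psi>t t) x
      = \<i> * of_real (h / 2) * ?uxx x + (- \<i> / of_real h) * (?M x * ?u x + R x)"
    unfolding diff_quots_add diff_quots_scale using R_eq by simp
  have "L2_inner ?u (diff_quots h ys (\<psi>t t))
      = L2_inner ?u (\<lambda>x. \<i> * of_real (h / 2) * ?uxx x + (- \<i> / of_real h) * (?M x * ?u x + R x))"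
    by (rule L2_inner_cong_AE[OF AE square_integrable_measurable[OF ut]
        square_integrable_measurable[OF square_integrable_add[OF s1 s2]] square_integrable_measurable[OF u]])
  also have "\<dots> = \<i> * of_real (h / 2) * L2_inner ?u ?uxx
      + (- \<i> / of_real h) * (L2_inner ?u (\<lambda>x. ?M x * ?u x) + L2_inner ?u R)"
    by (simp only: L2_inner_add_right[OF u s1 s2] L2_inner_scale_right L2_inner_add_right[OF u Mu Rs])
  finally have eq: "Re (L2_inner ?u (diff_quots h ys (\<psi>t t)))
      = - (h / 2) * Im (L2_inner ?u ?uxx) + Im (L2_inner ?u (\<lambda>x. ?M x * ?u x)) / h + Im (L2_inner ?u R) / h"
    by (simp only: Re_Schroedinger) (simp add: add_divide_distrib)
  have "Im (L2_inner ?u ?uxx) = 0"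
    by (rule Im_L2_inner_second_deriv_self[OF u ux uxx])
      (intro has_weak_deriv_diff_quots \<psi> \<psi>x \<psi>xx deriv_x deriv_xx t)+
  moreover have "Im (L2_inner ?u (\<lambda>x. ?M x * ?u x)) = 0"
    using Im_L2_inner_real_multiplier[of "\<lambda>x. 1" ?M ?u] by simp
  moreover have "Im (L2_inner ?u R) \<le> L2_norm ?u * (h * ?K)"
    using abs_Im_le_cmod[of "L2_inner ?u R"] norm_L2_inner_le[OF u Rs] R mult_left_mono[OF _ L2_norm_nonneg, of "L2_norm R" "h * ?K" ?u]
    by (auto simp: L2_bounded_def)
  ultimately show ?thesis using h unfolding eq by (simp add: field_simps)
qed

text \<open>Induction on the order, for all times and step lists together; at order 0 the energy
  rate is 0.\<close>

lemma L2_norm_diff_quots_solution: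
  assumes C: "0 \<le> C"
    and init: "\<And>ys. set ys \<subseteq> {0<..} \<Longrightarrow> L2_norm (diff_quots h ys (\<psi> 0)) \<le> C ^ length ys * real (length ys) ^ length ys"
  shows "0 \<le> t \<Longrightarrow> set ys \<subseteq> {0<..} \<Longrightarrow> length ys \<le> n \<Longrightarrow> L2_norm (diff_quots h ys (\<psi> t)) \<le> diff_quot_bound C n t"
proof (induction n arbitrary: t ys)
  case 0
  have "L2_norm (diff_quots h [] (\<psi> t)) \<le> L2_norm (diff_quots h [] (\<psi> 0)) + t * 0"
    using energy_diff_quots[of _ "[]" 0] 0
    by (intro L2_norm_growth[where u' = "\<lambda>t. diff_quots h [] (\<psi>t t)"] has_L2_derivative_on_diff_quots square_integrable_diff_quots \<psi> \<psi>t deriv_t) auto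
  with 0 init[of "[]"] show ?case by simp
next
  case (Suc n)
  show ?case
  proof (cases "length ys \<le> n")
    case True
    then show ?thesis
      using Suc.IH[of t ys] Suc.prems diff_quot_bound_mono_nat[OF C Suc.prems(1), of n "Suc n"] by linarith
  next
    case False
    then have len: "length ys = Suc n" using Suc.prems by simp
    let ?b = "diff_quot_bound C n t"
    have b: "0 \<le> ?b" by (rule diff_quot_bound_nonneg[OF C Suc.prems(1)])
    have "L2_norm (diff_quots h ys (\<psi> t)) \<le> L2_norm (diff_quots h ys (\<psi> 0)) + t * (real (Suc n) * 4 ^ Suc n * ?b ^ 3)"
    proof (intro L2_norm_growth[where u' = "\<lambda>t. diff_quots h ys (\<psi>t t)"] has_L2_derivative_on_diff_quots square_integrable_diff_quots \<psi> \<psi>t deriv_t)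
      fix s assume s: "0 < s" "s < t"
      \<comment> \<open>The induction hypothesis holds with the constant at time \<open>s\<close>;
        monotonicity in time replaces it by the one at \<open>t\<close>, so that the growth rate is
        constant on \<open>[0, t]\<close>.\<close>
      have "L2_bounded (diff_quots h zs (\<psi> s)) ?b" if zs: "length zs < length ys" "set zs \<subseteq> {0<..}" for zs
        using Suc.IH[of s zs] diff_quot_bound_mono[OF C, of s t n] s zs len \<psi>[of s]
        by (auto simp: L2_bounded_def square_integrable_diff_quots)
      from energy_diff_quots[OF _ Suc.prems(2) this] s len
      show "Re (L2_inner (diff_quots h ys (\<psi> s)) (diff_quots h ys (\<psi>t s)))
        \<le> L2_norm (diff_quots h ys (\<psi> s)) * (real (Suc n) * 4 ^ Suc n * ?b ^ 3)" by simp
    qed (use Suc.prems b in auto)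
    also have "\<dots> \<le> diff_quot_bound C (Suc n) t"
      using init[OF Suc.prems(2)] b by (simp add: len)
    finally show ?thesis .
  qed
qed

text \<open>The rate of \<open>|w psi|^2\<close> comes only from commuting \<open>w^2\<close> with
  the Laplacian, at a cost of one derivative of \<open>psi\<close>. The increment bound
  \<open>D / h\<close> meets the factor \<open>h\<close> of the kinetic term, so neither
  \<open>h\<close> nor the height \<open>M\<close> of the cutoff appears in the result.\<close>

lemma L2_norm_weight_solution:
  assumes w [measurable]: "w \<in> borel_measurable borel" and w0: "\<And>x. 0 \<le> w x" and wM: "\<And>x. w x \<le> M"
    and lip: "\<And>x y. \<bar>w x - w y\<bar> \<le> \<bar>x - y\<bar>" and T: "0 \<le> T" and D: "0 \<le> D"
    and D_le: "\<And>t y. 0 \<le> t \<Longrightarrow> t \<le> T \<Longrightarrow> 0 < y \<Longrightarrow> L2_norm (diff_quot h y (\<psi> t)) \<le> D"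
  shows "L2_norm (\<lambda>x. of_real (w x) * \<psi> T x) \<le> L2_norm (\<lambda>x. of_real (w x) * \<psi> 0 x) + T * D"
proof (rule L2_norm_growth[where u = "\<lambda>t x. of_real (w x) * \<psi> t x" and u' = "\<lambda>t x. of_real (w x) * \<psi>t t x"])
  have M: "0 \<le> M" using w0[of 0] wM[of 0] by linarith
  have wb: "cmod (of_real (w x)) \<le> M" for x using w0 wM by (simp add: abs_of_nonneg)
  have wm: "(\<lambda>x. complex_of_real (w x)) \<in> borel_measurable borel" by measurable
  show "square_integrable (\<lambda>x. of_real (w x) * \<psi> t x)" "square_integrable (\<lambda>x. of_real (w x) * \<psi>t t x)" if "0 \<le> t" for t
    using square_integrable_mult_bounded[OF \<psi>[OF that] wm wb] square_integrable_mult_bounded[OF \<psi>t[OF that] wm wb] by auto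
  show "has_L2_derivative_on (\<lambda>t x. of_real (w x) * \<psi> t x) (\<lambda>t x. of_real (w x) * \<psi>t t x) {0..}"
    by (rule has_L2_derivative_on_bounded_operator[OF \<psi> \<psi>t deriv_t L2_norm_mult_bounded[OF _ wm wb]])
      (auto simp: algebra_simps diff_divide_distrib)
  fix t assume "0 < t" "t < T"
  then have t: "0 \<le> t" "t \<le> T" by auto
  let ?u = "\<psi> t" and ?M = "mean_field t"
  \<comment> \<open>Both weights are moved to the left factor, giving \<open>v = w^2 psi\<close> and
    leaving \<open>\<psi>xx\<close> bare, so that its pairing with \<open>v\<close> can be read off
    from increments.\<close>
  define W where "W x = complex_of_real ((w x)\<^sup>2)" for x
  define v where "v x = W x * ?u x" for x
  have u: "square_integrable ?u" by (rule \<psi>[OF t(1)])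
  have wu: "square_integrable (\<lambda>x. of_real (w x) * ?u x)" by (rule square_integrable_mult_bounded[OF u wm wb])
  have Wb: "cmod (W x) \<le> M\<^sup>2" for x unfolding W_def norm_of_real using w0 wM by (auto intro!: power_mono)
  have Wm: "W \<in> borel_measurable borel" unfolding W_def[abs_def] by measurable
  have v: "square_integrable v" unfolding v_def[abs_def] by (rule square_integrable_mult_bounded[OF u Wm Wb])
  have du: "square_integrable (\<lambda>x. ?u (x + y) - ?u x)" for y
    using square_integrable_diff[OF square_integrable_shift[OF u] u] by simp
  have du_le: "L2_norm (\<lambda>x. ?u (x + y) - ?u x) \<le> D / h * y" if "0 < y" for y
    using D_le[OF t that] h that by (simp add: L2_norm_diff_quot[OF u] field_simps)
  have dW_eq: "W (x + y) - W x = of_real ((w (x + y) - w x) * (w (x + y) + w x))" for x y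
    by (simp add: W_def power2_eq_square algebra_simps)
  have dv_eq: "v (x + y) - v x = W x * (?u (x + y) - ?u x) + (W (x + y) - W x) * ?u (x + y)" for x y
    by (simp add: v_def algebra_simps)
  have dW_le: "cmod (W (x + y) - W x) \<le> y * (w (x + y) + w x)" if "0 \<le> y" for x y
  proof -
    have "\<bar>w (x + y) - w x\<bar> \<le> y" using lip[of "x + y" x] that by simp
    then have "\<bar>w (x + y) - w x\<bar> * (w (x + y) + w x) \<le> y * (w (x + y) + w x)"
      using w0 by (intro mult_right_mono) auto
    then show ?thesis unfolding dW_eq norm_of_real abs_mult using w0[of x] w0[of "x + y"] by simp
  qed
  have cross_m: "(\<lambda>x. (W (x + y) - W x) * ?u (x + y)) \<in> borel_measurable borel" for y
    using Wm square_integrable_measurable[OF u] by simp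
  \<comment> \<open>The second estimate is the sharp one: it keeps one weight on \<open>psi\<close>
    and determines the final rate. The third, with \<open>M\<close>, merely shows that
    \<open>v\<close> is Lipschitz under translations, where any constant will do.\<close>
  have cross: "square_integrable (\<lambda>x. (W (x + y) - W x) * ?u (x + y))"
    "L2_norm (\<lambda>x. (W (x + y) - W x) * ?u (x + y)) \<le> y * (2 * L2_norm (\<lambda>x. of_real (w x) * ?u x) + y * L2_norm ?u)"
    "L2_norm (\<lambda>x. (W (x + y) - W x) * ?u (x + y)) \<le> y * (2 * M) * L2_norm ?u"
    if y: "0 \<le> y" for y
  proof -
    define g where "g x = 2 * (of_real (w x) * ?u x) + of_real y * ?u x" for x
    have g: "square_integrable g"
      unfolding g_def[abs_def] by (intro square_integrable_add square_integrable_scale wu u)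
    have g_le: "L2_norm g \<le> 2 * L2_norm (\<lambda>x. of_real (w x) * ?u x) + y * L2_norm ?u"
      using L2_norm_triangle[OF square_integrable_scale[OF wu, of 2] square_integrable_scale[OF u, of "of_real y"]] y
      by (simp add: g_def[abs_def] L2_norm_scale[OF wu] L2_norm_scale[OF u])
    have sg: "square_integrable (shift y g)" by (rule square_integrable_shift[OF g])
    have su: "square_integrable (shift y ?u)" by (rule square_integrable_shift[OF u])
    have "cmod ((W (x + y) - W x) * ?u (x + y)) \<le> y * cmod (shift y g x)" for x
    proof -
      \<comment> \<open>The weight is re-centred at \<open>x + y\<close>, where \<open>psi\<close>
        is evaluated, so that the whole bound is a translate of \<open>g\<close>; the extra
        \<open>y\<close> is of higher order.\<close>
      have "w x \<le> w (x + y) + y" using lip[of "x + y" x] y by (simp add: abs_le_iff)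
      then have "y * (w (x + y) + w x) \<le> y * (2 * w (x + y) + y)" using y by (intro mult_left_mono) auto
      then have "cmod (W (x + y) - W x) \<le> y * (2 * w (x + y) + y)" using dW_le[OF y, of x] by linarith
      then have "cmod (W (x + y) - W x) * cmod (?u (x + y)) \<le> y * (2 * w (x + y) + y) * cmod (?u (x + y))"
        by (rule mult_right_mono) simp
      moreover have "shift y g x = of_real (2 * w (x + y) + y) * ?u (x + y)"
        by (simp add: g_def algebra_simps)
      moreover have "0 \<le> 2 * w (x + y) + y" using w0 y by (intro add_nonneg_nonneg) auto
      ultimately show ?thesis by (simp only: norm_mult norm_of_real abs_of_nonneg mult.assoc)
    qed
    then have AE: "AE x in lborel. cmod ((W (x + y) - W x) * ?u (x + y)) \<le> y * cmod (shift y g x)" by simp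
    show "square_integrable (\<lambda>x. (W (x + y) - W x) * ?u (x + y))"
      by (rule square_integrable_bound[OF sg cross_m AE y])
    have "L2_norm (\<lambda>x. (W (x + y) - W x) * ?u (x + y)) \<le> y * L2_norm (shift y g)"
      by (rule L2_norm_bound[OF sg cross_m AE y])
    also have "\<dots> \<le> y * (2 * L2_norm (\<lambda>x. of_real (w x) * ?u x) + y * L2_norm ?u)"
      unfolding L2_norm_shift[OF g] using g_le y by (rule mult_left_mono)
    finally show "L2_norm (\<lambda>x. (W (x + y) - W x) * ?u (x + y)) \<le> y * (2 * L2_norm (\<lambda>x. of_real (w x) * ?u x) + y * L2_norm ?u)" .
    have "cmod (W (x + y) - W x) \<le> y * (2 * M)" for x
      using dW_le[OF y, of x] wM[of x] wM[of "x + y"] mult_left_mono[OF _ y, of "w (x + y) + w x" "2 * M"] by linarith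
    then have AE': "AE x in lborel. cmod ((W (x + y) - W x) * ?u (x + y)) \<le> y * (2 * M) * cmod (shift y ?u x)"
      by (auto simp: norm_mult intro!: mult_right_mono)
    show "L2_norm (\<lambda>x. (W (x + y) - W x) * ?u (x + y)) \<le> y * (2 * M) * L2_norm ?u"
      using L2_norm_bound[OF su cross_m AE'] y M by (simp add: L2_norm_shift[OF u] del: shift_apply)
  qed
  have Wdu: "square_integrable (\<lambda>x. W x * (?u (x + y) - ?u x))"
    "L2_norm (\<lambda>x. W x * (?u (x + y) - ?u x)) \<le> M\<^sup>2 * L2_norm (\<lambda>x. ?u (x + y) - ?u x)" for y
    by (rule square_integrable_mult_bounded[OF du Wm Wb] L2_norm_mult_bounded[OF du Wm Wb])+
  \<comment> \<open>The leading coefficient: \<open>D / h\<close> from the increment of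
    \<open>psi\<close> and \<open>2 w\<close> from the increment of \<open>w^2\<close>. The term
    \<open>W\<close> times the increment of \<open>psi\<close> is paired with that increment and is
    real.\<close>
  let ?A = "2 * L2_norm (\<lambda>x. of_real (w x) * ?u x) * (D / h)"
  have Im: "\<bar>Im (L2_inner v (\<psi>xx t))\<bar> \<le> ?A"
  proof (rule Im_L2_inner_second_deriv_le[OF u \<psi>x[OF t(1)] \<psi>xx[OF t(1)] deriv_x[OF t(1)] deriv_xx[OF t(1)] v])
    fix s :: real assume s: "0 \<le> s"
    show "L2_norm (\<lambda>x. v (x + s) - v x) \<le> (M\<^sup>2 * (D / h) + 2 * M * L2_norm ?u) * s"
    proof (cases "s = 0")
      case False
      then have "0 < s" using s by simp
      have "L2_norm (\<lambda>x. v (x + s) - v x) \<le> M\<^sup>2 * L2_norm (\<lambda>x. ?u (x + s) - ?u x) + s * (2 * M) * L2_norm ?u"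
        unfolding dv_eq
        by (rule order_trans[OF L2_norm_triangle[OF Wdu(1) cross(1)[OF s]] add_mono[OF Wdu(2) cross(3)[OF s]]])
      also have "\<dots> \<le> M\<^sup>2 * (D / h * s) + s * (2 * M) * L2_norm ?u"
        using du_le[OF \<open>0 < s\<close>] by (intro add_right_mono mult_left_mono) auto
      finally show ?thesis by (simp add: algebra_simps)
    qed simp
  next
    fix y :: real assume y: "0 < y"
    let ?du = "\<lambda>x. ?u (x + y) - ?u x" and ?c = "\<lambda>x. (W (x + y) - W x) * ?u (x + y)"
    have c: "square_integrable ?c" using cross(1) y by simp
    have "L2_inner ?du (\<lambda>x. v (x + y) - v x) = L2_inner ?du (\<lambda>x. W x * ?du x) + L2_inner ?du ?c"
      unfolding dv_eq by (rule L2_inner_add_right[OF du Wdu(1) c])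
    moreover have "Im (L2_inner ?du (\<lambda>x. W x * ?du x)) = 0"
      using Im_L2_inner_real_multiplier[of "\<lambda>x. 1" W ?du] by (simp add: W_def)
    ultimately have "\<bar>Im (L2_inner ?du (\<lambda>x. v (x + y) - v x))\<bar> = \<bar>Im (L2_inner ?du ?c)\<bar>" by simp
    also have "\<dots> \<le> L2_norm ?du * L2_norm ?c"
      using abs_Im_le_cmod norm_L2_inner_le[OF du c] by (rule order_trans)
    also have "\<dots> \<le> (D / h * y) * (y * (2 * L2_norm (\<lambda>x. of_real (w x) * ?u x) + y * L2_norm ?u))"
      using y D h by (intro mult_mono du_le cross(2)) auto
    finally show "\<bar>Im (L2_inner (\<lambda>x. v (x + y) - v x) ?du)\<bar> \<le> y\<^sup>2 * (?A + D / h * L2_norm ?u * y)"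
      using L2_inner_commute[of "\<lambda>x. v (x + y) - v x" ?du] by (simp add: power2_eq_square algebra_simps)
  qed
  have s1: "square_integrable (\<lambda>x. \<i> * of_real (h / 2) * \<psi>xx t x)" by (rule square_integrable_scale[OF \<psi>xx[OF t(1)]])
  have Mu: "square_integrable (\<lambda>x. ?M x * ?u x)" by (rule square_integrable_mean_field_mult[OF t(1) u])
  have s2: "square_integrable (\<lambda>x. (- \<i> / of_real h) * (?M x * ?u x))" by (rule square_integrable_scale[OF Mu])
  have "L2_inner (\<lambda>x. of_real (w x) * ?u x) (\<lambda>x. of_real (w x) * \<psi>t t x) = L2_inner v (\<psi>t t)"
    by (simp add: L2_inner_def v_def W_def power2_eq_square mult_ac)
  also have "\<dots> = L2_inner v (\<lambda>x. \<i> * of_real (h / 2) * \<psi>xx t x + (- \<i> / of_real h) * (?M x * ?u x))"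
    by (rule L2_inner_cong_AE[OF equation_\<psi>t[OF t(1)] square_integrable_measurable[OF \<psi>t[OF t(1)]]
        square_integrable_measurable[OF square_integrable_add[OF s1 s2]] square_integrable_measurable[OF v]])
  also have "\<dots> = \<i> * of_real (h / 2) * L2_inner v (\<psi>xx t) + (- \<i> / of_real h) * L2_inner v (\<lambda>x. ?M x * ?u x)"
    by (simp only: L2_inner_add_right[OF v s1 s2] L2_inner_scale_right)
  finally have eq: "Re (L2_inner (\<lambda>x. of_real (w x) * ?u x) (\<lambda>x. of_real (w x) * \<psi>t t x))
      = - (h / 2) * Im (L2_inner v (\<psi>xx t)) + Im (L2_inner v (\<lambda>x. ?M x * ?u x)) / h"
    by (simp only: Re_Schroedinger)
  have "Im (L2_inner v (\<lambda>x. ?M x * ?u x)) = 0"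
    unfolding v_def[abs_def] by (rule Im_L2_inner_real_multiplier) (simp_all add: W_def)
  then have "Re (L2_inner (\<lambda>x. of_real (w x) * ?u x) (\<lambda>x. of_real (w x) * \<psi>t t x)) \<le> h / 2 * \<bar>Im (L2_inner v (\<psi>xx t))\<bar>"
    unfolding eq using mult_left_mono[OF abs_ge_minus_self[of "Im (L2_inner v (\<psi>xx t))"], of "h / 2"] h by simp
  also have "\<dots> \<le> h / 2 * ?A" using Im h by (intro mult_left_mono) auto
  finally show "Re (L2_inner (\<lambda>x. of_real (w x) * ?u x) (\<lambda>x. of_real (w x) * \<psi>t t x))
      \<le> L2_norm (\<lambda>x. of_real (w x) * ?u x) * D"
    using h by simp
qed (use T D in auto)

end


section \<open>Weights and passage to the limit\<close>

text \<open>Quotients are moved from \<open>u\<close> to \<open>v\<close> one at a time, by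
  summation by parts. Each move also hits the weight, and that remainder is unweighted and costs at
  most \<open>B * B\<close>. Once \<open>u\<close> is bare, \<open>A\<close> takes up the weight.
  Leaving \<open>v\<close> arbitrary is what makes the induction run.\<close>

lemma weighted_interpolation:
  assumes w [measurable]: "w \<in> borel_measurable borel" and wM: "\<And>x. \<bar>w x\<bar> \<le> K"
    and lip: "\<And>x y. \<bar>w x - w y\<bar> \<le> \<bar>x - y\<bar>" and h: "0 \<le> h" "h \<le> 1"
    and u: "square_integrable u" and A: "L2_norm (\<lambda>x. of_real (w x) * u x) \<le> A" and zs: "set zs \<subseteq> {0<..}"
    and uB: "\<And>ys. length ys \<le> length zs \<Longrightarrow> set ys \<subseteq> {0<..} \<Longrightarrow> L2_norm (diff_quots h ys u) \<le> B"
    and v: "square_integrable v"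
    and vB: "\<And>ys. length ys \<le> length zs \<Longrightarrow> set ys \<subseteq> {0<..} \<Longrightarrow> L2_norm (diff_quots h ys v) \<le> B"
  shows "cmod (LINT x|lborel. of_real (w x) * diff_quots h zs u x * v x) \<le> A * B + real (length zs) * B\<^sup>2"
  using zs uB v vB
proof (induction zs arbitrary: v)
  case Nil
  have wu: "square_integrable (\<lambda>x. of_real (w x) * u x)"
    by (rule square_integrable_mult_bounded[OF u, of _ K]) (use wM in auto)
  have "cmod (LINT x|lborel. of_real (w x) * u x * v x) \<le> L2_norm (\<lambda>x. of_real (w x) * u x) * L2_norm v"
    by (rule norm_integral_mult_le[OF wu Nil(3)])
  also have "\<dots> \<le> A * B"
    using A Nil(4)[of "[]"] order_trans[OF L2_norm_nonneg A] by (intro mult_mono) auto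
  finally show ?case by simp
next
  case (Cons z zs)
  have z: "0 < z" using Cons.prems(1) by simp
  let ?U = "diff_quots h zs u" and ?v = "shift (- z) v" and ?v' = "shift (- z) (diff_quot h z v)"
    and ?c = "complex_of_real (h / z)"
  have B0: "0 \<le> B" using order_trans[OF L2_norm_nonneg Cons.prems(2)[of "[]"]] by simp
  have U: "square_integrable ?U" by (rule square_integrable_diff_quots[OF u])
  have sv: "square_integrable ?v" by (rule square_integrable_shift[OF Cons.prems(3)])
  have v': "square_integrable ?v'" by (intro square_integrable_shift square_integrable_diff_quot Cons.prems(3))
  have wU: "square_integrable (\<lambda>x. of_real (w x) * f x)" if "square_integrable f" for f
    by (rule square_integrable_mult_bounded[OF that, of _ K]) (use wM in auto)
  \<comment> \<open>The difference quotient of the weight, at most \<open>h <= 1\<close> by the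
    Lipschitz bound, with no dependence on the step or on the height \<open>K\<close>.\<close>
  define r where "r x = ?c * of_real (w x - w (x - z))" for x
  have rb: "cmod (r x) \<le> 1" for x
  proof -
    have "h / z * \<bar>w x - w (x - z)\<bar> \<le> h / z * z"
      using lip[of x "x - z"] h z by (intro mult_left_mono) auto
    also have "\<dots> \<le> 1" using h z by simp
    finally have "h / z * \<bar>w x - w (x - z)\<bar> \<le> 1" .
    then show ?thesis unfolding r_def norm_mult norm_of_real using h z by simp
  qed
  have rm: "r \<in> borel_measurable borel" unfolding r_def[abs_def] by measurable
  have rv: "square_integrable (\<lambda>x. r x * ?v x)" "L2_norm (\<lambda>x. r x * ?v x) \<le> 1 * L2_norm ?v"
    by (rule square_integrable_mult_bounded[OF sv rm rb] L2_norm_mult_bounded[OF sv rm rb])+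
  have i1: "integrable lborel (\<lambda>x. of_real (w x) * ?U x * ?v' x)" by (rule integrable_mult[OF wU[OF U] v'])
  have i2: "integrable lborel (\<lambda>x. ?U x * (r x * ?v x))" by (rule integrable_mult[OF U rv(1)])
  have i3: "integrable lborel (\<lambda>x. of_real (w x) * ?U x * v x)" by (rule integrable_mult[OF wU[OF U] Cons.prems(3)])
  have i4: "integrable lborel (\<lambda>x. of_real (w x) * ?U (x + z) * v x)"
    using integrable_mult[OF wU[OF square_integrable_shift[OF U, of z]] Cons.prems(3)] by simp
  have i5: "integrable lborel (\<lambda>x. of_real (w (x - z)) * ?U x * v (x - z))"
    using integrable_lborel_shift[of "\<lambda>x. of_real (w (x - z)) * ?U x * v (x - z)" z] i4 by simp
  have "(LINT x|lborel. of_real (w x) * diff_quots h (z # zs) u x * v x)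
      = (LINT x|lborel. ?c * (of_real (w x) * ?U (x + z) * v x) - ?c * (of_real (w x) * ?U x * v x))"
    by (simp add: diff_quot_def algebra_simps)
  also have "\<dots> = ?c * (LINT x|lborel. of_real (w x) * ?U (x + z) * v x) - ?c * (LINT x|lborel. of_real (w x) * ?U x * v x)"
    using i3 i4 by (simp del: of_real_divide)
  also have "(LINT x|lborel. of_real (w x) * ?U (x + z) * v x) = (LINT x|lborel. of_real (w (x - z)) * ?U x * v (x - z))"
    using integral_lborel_shift[of "\<lambda>x. of_real (w (x - z)) * ?U x * v (x - z)" z] by simp
  also have "?c * (LINT x|lborel. of_real (w (x - z)) * ?U x * v (x - z)) - ?c * (LINT x|lborel. of_real (w x) * ?U x * v x)
      = (LINT x|lborel. ?c * (of_real (w (x - z)) * ?U x * v (x - z)) - ?c * (of_real (w x) * ?U x * v x))"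
    using i3 i5 by (simp del: of_real_divide)
  also have "\<dots> = (LINT x|lborel. - (of_real (w x) * ?U x * ?v' x) - ?U x * (r x * ?v x))"
    by (intro Bochner_Integration.integral_cong) (simp_all add: diff_quot_def r_def algebra_simps)
  also have "\<dots> = - (LINT x|lborel. of_real (w x) * ?U x * ?v' x) - (LINT x|lborel. ?U x * (r x * ?v x))"
    using i1 i2 by (simp del: shift_apply)
  finally have eq: "(LINT x|lborel. of_real (w x) * diff_quots h (z # zs) u x * v x)
      = - (LINT x|lborel. of_real (w x) * ?U x * ?v' x) - (LINT x|lborel. ?U x * (r x * ?v x))" .
  have 1: "cmod (LINT x|lborel. of_real (w x) * ?U x * ?v' x) \<le> A * B + real (length zs) * B\<^sup>2"
  proof (rule Cons.IH[OF _ _ v'])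
    fix ys :: "real list" assume ys: "length ys \<le> length zs" "set ys \<subseteq> {0<..}"
    show "L2_norm (diff_quots h ys u) \<le> B" using Cons.prems(2)[of ys] ys by simp
    show "L2_norm (diff_quots h ys ?v') \<le> B"
      unfolding diff_quots_shift diff_quots_diff_quot L2_norm_shift[OF square_integrable_diff_quots[OF Cons.prems(3)]]
      using ys z by (intro Cons.prems(4)) auto
  qed (use Cons.prems(1) in simp)
  have "cmod (LINT x|lborel. ?U x * (r x * ?v x)) \<le> L2_norm ?U * L2_norm (\<lambda>x. r x * ?v x)"
    by (rule norm_integral_mult_le[OF U rv(1)])
  also have "\<dots> \<le> B * B"
  proof (intro mult_mono B0 L2_norm_nonneg)
    show "L2_norm ?U \<le> B" using Cons.prems(1) by (intro Cons.prems(2)) auto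
    show "L2_norm (\<lambda>x. r x * ?v x) \<le> B"
      using rv(2) Cons.prems(4)[of "[]"] by (simp add: L2_norm_shift[OF Cons.prems(3)] del: shift_apply)
  qed
  finally have "cmod (LINT x|lborel. ?U x * (r x * ?v x)) \<le> B * B" .
  with 1 have "cmod (- (LINT x|lborel. of_real (w x) * ?U x * ?v' x) - (LINT x|lborel. ?U x * (r x * ?v x)))
      \<le> (A * B + real (length zs) * B\<^sup>2) + B * B"
    by (intro norm_triangle_le_diff[OF add_mono]) (simp_all del: shift_apply)
  then show ?case unfolding eq by (simp add: power2_eq_square algebra_simps)
qed

section \<open>The weight and its truncations\<close>

lemma jbracket_ge_1: "1 \<le> jbracket x"
  by (simp add: jbracket_def)

text \<open>\<open><x>\<close> is the Euclidean norm of \<open>(1, x)\<close>, so this is the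
  reverse triangle inequality in the plane.\<close>

lemma jbracket_lipschitz: "\<bar>jbracket x - jbracket y\<bar> \<le> \<bar>x - y\<bar>"
  using norm_triangle_ineq3[of "(1::real, x)" "(1, y)"] by (simp add: jbracket_def norm_Pair)

lemma measurable_jbracket [measurable]: "jbracket \<in> borel_measurable borel"
  unfolding jbracket_def[abs_def] by measurable

text \<open>Cutting at height \<open>n\<close> makes the weight bounded, as the energy argument
  requires of it, and preserves the Lipschitz constant 1 on which the estimates depend.\<close>

lemma
  fixes n :: nat
  defines "w \<equiv> \<lambda>x. min (jbracket x) (real n)"
  shows measurable_cut_jbracket: "w \<in> borel_measurable borel" and cut_jbracket_nonneg: "0 \<le> w x"
    and cut_jbracket_le: "w x \<le> real n" and cut_jbracket_le_jbracket: "w x \<le> jbracket x"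
    and cut_jbracket_lipschitz: "\<bar>w x - w y\<bar> \<le> \<bar>x - y\<bar>"
  using jbracket_lipschitz[of x y] jbracket_ge_1[of x] unfolding w_def by auto

lemma cut_jbracket_tendsto: "(\<lambda>n. min (jbracket x) (real n)) \<longlonglongrightarrow> jbracket x"
proof (rule tendsto_eventually)
  obtain N where N: "jbracket x \<le> real N" using real_arch_simple by blast
  show "\<forall>\<^sub>F n in sequentially. min (jbracket x) (real n) = jbracket x"
    using eventually_ge_at_top[of N] by eventually_elim (use N in auto)
qed

text \<open>The squared norm with weight \<open>sqrt w\<close> is the pairing of
  \<open>w D^k f\<close> with the conjugate of \<open>D^k f\<close>. Taking the latter as
  \<open>v\<close> in \<open>weighted_interpolation\<close> explains the orders up to
  \<open>2 k\<close>; Fatou removes the cutoff.\<close>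

lemma weighted_diff_quots_bound:
  assumes f: "square_integrable f" and h: "0 \<le> h" "h \<le> 1"
    and A: "L2_bounded (\<lambda>x. of_real (jbracket x) * f x) A"
    and B: "\<And>ys. length ys \<le> 2 * length zs \<Longrightarrow> set ys \<subseteq> {0<..} \<Longrightarrow> L2_norm (diff_quots h ys f) \<le> B"
    and zs: "set zs \<subseteq> {0<..}"
  shows "L2_bounded (\<lambda>x. of_real (sqrt (jbracket x)) * diff_quots h zs f x) (sqrt (A * B + real (length zs) * B\<^sup>2))"
proof -
  let ?w = "\<lambda>n x. min (jbracket x) (real n)" and ?g = "diff_quots h zs f"
  let ?F = "\<lambda>n x. of_real (sqrt (?w n x)) * ?g x"
  have g: "square_integrable ?g" by (rule square_integrable_diff_quots[OF f])
  have gc: "square_integrable (\<lambda>x. cnj (?g x))" by (rule square_integrable_cnj[OF g])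
  have F: "square_integrable (?F n)" for n
  proof (rule square_integrable_mult_bounded[OF g])
    show "(\<lambda>x. complex_of_real (sqrt (?w n x))) \<in> borel_measurable borel" by measurable
    show "cmod (complex_of_real (sqrt (?w n x))) \<le> sqrt (real n)" for x
      unfolding norm_of_real using jbracket_ge_1[of x] by simp
  qed
  have le: "L2_norm (?F n) \<le> sqrt (A * B + real (length zs) * B\<^sup>2)" for n
  proof (rule real_le_rsqrt)
    have "L2_norm (\<lambda>x. of_real (?w n x) * f x) \<le> 1 * L2_norm (\<lambda>x. of_real (jbracket x) * f x)"
    proof (rule L2_norm_bound)
      show "square_integrable (\<lambda>x. of_real (jbracket x) * f x)" using A by (simp add: L2_bounded_def)
      show "(\<lambda>x. complex_of_real (?w n x) * f x) \<in> borel_measurable borel"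
        using square_integrable_measurable[OF f] by measurable
      show "AE x in lborel. cmod (of_real (?w n x) * f x) \<le> 1 * cmod (of_real (jbracket x) * f x)"
        using cut_jbracket_nonneg[of _ n] cut_jbracket_le_jbracket[of _ n] 
        unfolding norm_mult norm_of_real mult_1
        by (intro AE_I2 mult_right_mono) (auto simp: abs_of_nonneg order_trans[OF zero_le_one jbracket_ge_1])
    qed simp
    also have "\<dots> \<le> A" using A by (simp add: L2_bounded_def)
    finally have Aw: "L2_norm (\<lambda>x. of_real (?w n x) * f x) \<le> A" .
    have wle: "\<bar>?w n x\<bar> \<le> real n" for x using jbracket_ge_1[of x] by auto
    have "cmod (LINT x|lborel. of_real (?w n x) * ?g x * cnj (?g x)) \<le> A * B + real (length zs) * B\<^sup>2"
    proof (rule weighted_interpolation[OF measurable_cut_jbracket wle cut_jbracket_lipschitz h f Aw zs _ gc])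
      fix ys :: "real list" assume ys: "length ys \<le> length zs" "set ys \<subseteq> {0<..}"
      show "L2_norm (diff_quots h ys f) \<le> B" using ys by (intro B) auto
      have app: "diff_quots h ys (diff_quots h zs f) = diff_quots h (ys @ zs) f"
        by (induction ys) auto
      have "L2_norm (diff_quots h ys (\<lambda>x. cnj (?g x))) = L2_norm (diff_quots h (ys @ zs) f)"
        unfolding diff_quots_cnj app by (rule L2_norm_cnj[OF square_integrable_diff_quots[OF f]])
      also have "\<dots> \<le> B" using ys zs by (intro B) auto
      finally show "L2_norm (diff_quots h ys (\<lambda>x. cnj (?g x))) \<le> B" .
    qed
    moreover have "(LINT x|lborel. of_real (?w n x) * ?g x * cnj (?g x)) = of_real ((L2_norm (?F n))\<^sup>2)"
      unfolding L2_norm_power2 integral_complex_of_real[symmetric]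
    proof (intro Bochner_Integration.integral_cong refl)
      fix x
      have "(cmod (?F n x))\<^sup>2 = ?w n x * (cmod (?g x))\<^sup>2"
        unfolding norm_mult norm_of_real power_mult_distrib power2_abs using cut_jbracket_nonneg[of x n] by simp
      then show "of_real (?w n x) * ?g x * cnj (?g x) = complex_of_real ((cmod (?F n x))\<^sup>2)"
        by (simp only: of_real_mult complex_norm_square mult.assoc)
    qed
    ultimately show "(L2_norm (?F n))\<^sup>2 \<le> A * B + real (length zs) * B\<^sup>2"
      by (simp only: norm_of_real abs_power2)
  qed
  have lim: "AE x in lborel. (\<lambda>n. ?F n x) \<longlonglongrightarrow> of_real (sqrt (jbracket x)) * ?g x"
    by (intro AE_I2 tendsto_mult tendsto_of_real tendsto_real_sqrt cut_jbracket_tendsto tendsto_const)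
  have m: "(\<lambda>x. of_real (sqrt (jbracket x)) * ?g x) \<in> borel_measurable borel"
    using square_integrable_measurable[OF g] by measurable
  show ?thesis
    unfolding L2_bounded_def using L2_fatou[OF F m lim le] by simp
qed

text \<open>Completeness of \<open>L^2\<close> in a quantitative form that also yields almost
  everywhere convergence of the whole sequence, which is what \<open>L2_fatou\<close> takes as
  input.\<close>

lemma L2_geometric_limit:
  fixes a :: "nat \<Rightarrow> real \<Rightarrow> complex"
  assumes a: "\<And>n. square_integrable (a n)"
    and K: "\<And>n. L2_norm (\<lambda>x. a n x - a (Suc n) x) \<le> K * (1 / 2) ^ n"
  obtains g where "square_integrable g" "AE x in lborel. (\<lambda>n. a n x) \<longlonglongrightarrow> g x"
    "(\<lambda>n. L2_norm (\<lambda>x. a n x - g x)) \<longlonglongrightarrow> 0"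
proof -
  note [measurable] = square_integrable_measurable[OF a]
  define b where "b n x = a n x - a (Suc n) x" for n x
  have b: "square_integrable (b n)" for n unfolding b_def[abs_def] by (rule square_integrable_diff[OF a a])
  note [measurable] = square_integrable_measurable[OF b]
  have K0: "0 \<le> K" using order_trans[OF L2_norm_nonneg K[of 0]] by simp
  \<comment> \<open>The squared norms of \<open>b n\<close> decay like \<open>4^(-n)\<close>, so the
    factor \<open>2 ^ n\<close> can be afforded; it is needed below for pointwise
    summability.\<close>
  have int: "(\<integral>\<^sup>+x. ennreal (2 ^ n * (cmod (b n x))\<^sup>2) \<partial>lborel) \<le> ennreal (K\<^sup>2 * (1 / 2) ^ n)" for n
  proof -
    have "(\<integral>\<^sup>+x. ennreal (2 ^ n * (cmod (b n x))\<^sup>2) \<partial>lborel) = ennreal (2 ^ n * (L2_norm (b n))\<^sup>2)"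
      using square_integrable_integrable[OF b] by (simp add: nn_integral_eq_integral L2_norm_power2)
    also have "2 ^ n * (L2_norm (b n))\<^sup>2 \<le> 2 ^ n * (K * (1 / 2) ^ n)\<^sup>2"
      using K[of n] unfolding b_def[abs_def] by (intro mult_left_mono power_mono) auto
    also have "\<dots> = K\<^sup>2 * (1 / 2) ^ n"
      by (simp add: power_mult_distrib power2_eq_square power_one_over)
    finally show ?thesis by (simp add: ennreal_leI)
  qed
  have "(\<integral>\<^sup>+x. (\<Sum>n. ennreal (2 ^ n * (cmod (b n x))\<^sup>2)) \<partial>lborel) = (\<Sum>n. \<integral>\<^sup>+x. ennreal (2 ^ n * (cmod (b n x))\<^sup>2) \<partial>lborel)"
    by (rule nn_integral_suminf) measurable
  also have "\<dots> \<le> (\<Sum>n. ennreal (K\<^sup>2 * (1 / 2) ^ n))"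
    by (intro suminf_le int) auto
  also have "\<dots> = ennreal (\<Sum>n. K\<^sup>2 * (1 / 2) ^ n)"
    by (intro suminf_ennreal2 summable_mult summable_geometric) auto
  also have "\<dots> < \<infinity>" by simp
  finally have "AE x in lborel. (\<Sum>n. ennreal (2 ^ n * (cmod (b n x))\<^sup>2)) \<noteq> \<infinity>"
    by (intro nn_integral_noteq_infinite) auto
  then have conv: "AE x in lborel. convergent (\<lambda>n. a n x)"
  proof eventually_elim
    case (elim x)
    have s: "summable (\<lambda>n. 2 ^ n * (cmod (b n x))\<^sup>2)"
      by (rule summable_suminf_not_top) (use elim in auto)
    have "summable (\<lambda>n. b n x)"
    proof (rule summable_comparison_test'[OF summable_add[OF summable_geometric[of "1/2::real"] s], of 0])
      fix n :: nat
      \<comment> \<open>The inequality between means bounds \<open>|b n x|\<close> by a geometric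
        term plus the weighted square that is already known to be summable.\<close>
      have "0 \<le> (1 - 2 ^ n * cmod (b n x))\<^sup>2 / 2 ^ n" by simp
      also have "\<dots> = (1 / 2) ^ n + 2 ^ n * (cmod (b n x))\<^sup>2 - 2 * cmod (b n x)"
        by (simp add: power2_eq_square field_simps)
      finally show "norm (b n x) \<le> (1 / 2) ^ n + 2 ^ n * (cmod (b n x))\<^sup>2"
        using norm_ge_zero[of "b n x"] by linarith
    qed simp
    then have "(\<lambda>n. a 0 x - (\<Sum>i<n. b i x)) \<longlonglongrightarrow> a 0 x - (\<Sum>n. b n x)"
      by (intro tendsto_diff tendsto_const summable_LIMSEQ)
    moreover have "a 0 x - (\<Sum>i<n. b i x) = a n x" for n
      using sum_lessThan_telescope'[of "\<lambda>i. a i x" n] by (simp add: b_def)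
    ultimately show ?case by (auto simp: convergent_def)
  qed
  define g where "g x = lim (\<lambda>n. a n x)" for x
  have g [measurable]: "g \<in> borel_measurable borel"
    unfolding g_def[abs_def] by (rule borel_measurable_lim_metric) measurable
  have lim: "AE x in lborel. (\<lambda>n. a n x) \<longlonglongrightarrow> g x"
    using conv by eventually_elim (simp add: g_def convergent_LIMSEQ_iff)
  have tail: "L2_norm (\<lambda>x. a n x - a (n + k) x) \<le> 2 * K * (1 / 2) ^ n" for n k
  proof -
    \<comment> \<open>The exact partial geometric sum is kept because the cruder bound asserted
      outside is not inductive in \<open>k\<close>.\<close>
    have "L2_norm (\<lambda>x. a n x - a (n + k) x) \<le> 2 * K * ((1 / 2) ^ n - (1 / 2) ^ (n + k))"
    proof (induction k)
      case (Suc k)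
      have "L2_norm (\<lambda>x. a n x - a (n + Suc k) x) = L2_norm (\<lambda>x. (a n x - a (n + k) x) + b (n + k) x)"
        by (simp add: b_def)
      also have "\<dots> \<le> L2_norm (\<lambda>x. a n x - a (n + k) x) + L2_norm (b (n + k))"
        by (rule L2_norm_triangle[OF square_integrable_diff[OF a a] b])
      also have "\<dots> \<le> 2 * K * ((1 / 2) ^ n - (1 / 2) ^ (n + k)) + K * (1 / 2) ^ (n + k)"
        using Suc K[of "n + k"] unfolding b_def[abs_def] by (rule add_mono)
      also have "\<dots> = 2 * K * ((1 / 2) ^ n - (1 / 2) ^ (n + Suc k))" by (simp add: algebra_simps)
      finally show ?case .
    qed simp
    also have "\<dots> \<le> 2 * K * (1 / 2) ^ n" using K0 by (intro mult_left_mono) auto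
    finally show ?thesis .
  qed
  have dist: "square_integrable (\<lambda>x. a n x - g x)" "L2_norm (\<lambda>x. a n x - g x) \<le> 2 * K * (1 / 2) ^ n" for n
  proof -
    have si: "square_integrable (\<lambda>x. a n x - a (n + k) x)" for k by (rule square_integrable_diff[OF a a])
    have m: "(\<lambda>x. a n x - g x) \<in> borel_measurable borel" by measurable
    have AE: "AE x in lborel. (\<lambda>k. a n x - a (n + k) x) \<longlonglongrightarrow> a n x - g x"
      using lim
    proof eventually_elim
      case (elim x)
      have "(\<lambda>k. a (k + n) x) \<longlonglongrightarrow> g x" by (rule LIMSEQ_ignore_initial_segment[OF elim])
      then show ?case by (intro tendsto_diff tendsto_const) (simp add: add.commute)
    qed
    show "square_integrable (\<lambda>x. a n x - g x)" "L2_norm (\<lambda>x. a n x - g x) \<le> 2 * K * (1 / 2) ^ n"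
      using L2_fatou[OF si m AE tail] by auto
  qed
  have "square_integrable (\<lambda>x. a 0 x - (a 0 x - g x))" by (rule square_integrable_diff[OF a dist(1)])
  then have gs: "square_integrable g" by simp
  have "(\<lambda>n. 2 * K * (1 / 2) ^ n) \<longlonglongrightarrow> 2 * K * 0"
    by (intro tendsto_mult tendsto_const LIMSEQ_power_zero) auto
  then have z: "(\<lambda>n. 2 * K * (1 / 2) ^ n) \<longlonglongrightarrow> 0" by simp
  have "(\<lambda>n. L2_norm (\<lambda>x. a n x - g x)) \<longlonglongrightarrow> 0"
    by (rule Lim_null_comparison[OF _ z]) (use dist(2) in auto)
  with gs lim show ?thesis by (rule that)
qed

lemma AE_diff_quots_tendsto:
  assumes "AE x in lborel. (\<lambda>n. F n x) \<longlonglongrightarrow> f x"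
  shows "AE x in lborel. (\<lambda>n::nat. diff_quots h ys (F n) x) \<longlonglongrightarrow> diff_quots h ys f x"
proof (induction ys)
  case (Cons y ys)
  show ?case
    using Cons AE_lborel_shift[OF Cons, of y]
    by eventually_elim (auto simp: diff_quot_def simp del: of_real_divide intro!: tendsto_intros)
qed (use assms in simp)

text \<open>Dyadic difference quotients form a Cauchy sequence in \<open>L\<^sup>2\<close>, since
  \<open>D\<^sub>2\<^sub>y - D\<^sub>y = (y / 2 h) D\<^sub>y D\<^sub>y\<close>.\<close>

lemma weak_deriv_from_diff_quots:
  assumes f: "square_integrable f" and h: "0 < h"
    and M: "\<And>ys. set ys \<subseteq> {0<..} \<Longrightarrow> L2_norm (diff_quots h ys f) \<le> M (length ys)"
    and p [measurable]: "p \<in> borel_measurable borel"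
    and N: "\<And>ys. set ys \<subseteq> {0<..} \<Longrightarrow> L2_bounded (\<lambda>x. p x * diff_quots h ys f x) (N (length ys))"
  obtains g where "square_integrable g" "has_weak_deriv (Suc 0) f (\<lambda>x. of_real (1 / h) * g x)"
    "\<And>ys. set ys \<subseteq> {0<..} \<Longrightarrow> L2_norm (diff_quots h ys g) \<le> M (Suc (length ys))"
    "\<And>ys. set ys \<subseteq> {0<..} \<Longrightarrow> L2_bounded (\<lambda>x. p x * diff_quots h ys g x) (N (Suc (length ys)))"
proof -
  \<comment> \<open>Halving the step makes the dyadic identity compare neighbours, with distance at
    most \<open>M 2 / (4 * h)\<close> times \<open>(1/2)^n\<close>. The \<open>1 / h\<close> is
    harmless, as it is used for convergence only.\<close>
  define y where "y n = (1 / 2 :: real) ^ n" for n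
  have y: "0 < y n" "y n = 2 * y (Suc n)" for n by (simp_all add: y_def)
  define a where "a n = diff_quot h (y n) f" for n
  have a: "square_integrable (a n)" for n unfolding a_def by (rule square_integrable_diff_quot[OF f])
  have dyadic: "diff_quot h (2 * z) f x - diff_quot h z f x = of_real (z / (2 * h)) * diff_quots h [z, z] f x"
    if "0 < z" for z x
    using that h by (simp add: diff_quot_def field_simps)
  have K: "L2_norm (\<lambda>x. a n x - a (Suc n) x) \<le> M 2 / (4 * h) * (1 / 2) ^ n" for n
  proof -
    let ?z = "y (Suc n)"
    have "(\<lambda>x. a n x - a (Suc n) x) = (\<lambda>x. of_real (?z / (2 * h)) * diff_quots h [?z, ?z] f x)"
      unfolding a_def y(2)[of n] using dyadic[OF y(1)] by blast
    then have "L2_norm (\<lambda>x. a n x - a (Suc n) x) = ?z / (2 * h) * L2_norm (diff_quots h [?z, ?z] f)"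
      unfolding L2_norm_scale[OF square_integrable_diff_quots[OF f]] norm_of_real using h y(1)[of "Suc n"]
      by (metis L2_norm_scale[OF square_integrable_diff_quots[OF f]] abs_of_pos divide_pos_pos mult_pos_pos norm_of_real zero_less_numeral)
    also have "\<dots> \<le> ?z / (2 * h) * M 2"
      using M[of "[?z, ?z]"] y(1)[of "Suc n"] h by (intro mult_left_mono) (auto simp: numeral_2_eq_2)
    finally show ?thesis by (simp add: y_def field_simps)
  qed
  obtain g where g: "square_integrable g" and lim: "AE x in lborel. (\<lambda>n. a n x) \<longlonglongrightarrow> g x"
    and norm_lim: "(\<lambda>n. L2_norm (\<lambda>x. a n x - g x)) \<longlonglongrightarrow> 0"
    by (rule L2_geometric_limit[OF a K])
  show ?thesis
  proof (rule that[OF g])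
    fix ys :: "real list" assume ys: "set ys \<subseteq> {0<..}"
    have eq: "diff_quots h ys (a n) = diff_quots h (y n # ys) f" for n
      unfolding a_def by (rule diff_quots_diff_quot)
    have pos: "set (y n # ys) \<subseteq> {0<..}" for n using ys y(1) by simp
    note AE = AE_diff_quots_tendsto[OF lim, of h ys]
    show "L2_norm (diff_quots h ys g) \<le> M (Suc (length ys))"
    proof (rule L2_fatou(2)[OF square_integrable_diff_quots[OF a] _ AE])
      show "diff_quots h ys g \<in> borel_measurable borel"
        using square_integrable_measurable[OF square_integrable_diff_quots[OF g]] .
      show "L2_norm (diff_quots h ys (a n)) \<le> M (Suc (length ys))" for n
        using M[OF pos[of n]] unfolding eq by simp
    qed
    \<comment> \<open>The weighted bound passes to the limit along the same sequence. As only
      pointwise convergence and Fatou enter, \<open>p\<close> may be unbounded.\<close>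
    have AEp: "AE x in lborel. (\<lambda>n. p x * diff_quots h ys (a n) x) \<longlonglongrightarrow> p x * diff_quots h ys g x"
      using AE by eventually_elim (intro tendsto_intros)
    have pa: "square_integrable (\<lambda>x. p x * diff_quots h ys (a n) x)"
      "L2_norm (\<lambda>x. p x * diff_quots h ys (a n) x) \<le> N (Suc (length ys))" for n
      using N[OF pos[of n]] unfolding eq by (simp_all add: L2_bounded_def)
    have m: "(\<lambda>x. p x * diff_quots h ys g x) \<in> borel_measurable borel"
      using square_integrable_measurable[OF square_integrable_diff_quots[OF g]] by measurable
    show "L2_bounded (\<lambda>x. p x * diff_quots h ys g x) (N (Suc (length ys)))"
      unfolding L2_bounded_def using L2_fatou[OF pa(1) m AEp pa(2)] by blast
  next
    have "(LINT x|lborel. f x * of_real (deriv \<phi> x)) = - (LINT x|lborel. of_real (1 / h) * g x * of_real (\<phi> x))"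
      if \<phi>: "test_function \<phi>" for \<phi>
    proof -
      let ?\<phi> = "\<lambda>x. complex_of_real (\<phi> x)"
      have \<phi>2: "square_integrable ?\<phi>" by (rule square_integrable_test_function[OF \<phi>])
      have 1: "(\<lambda>n. LINT x|lborel. a n x * ?\<phi> x) \<longlonglongrightarrow> (LINT x|lborel. g x * ?\<phi> x)"
      proof (rule LIM_zero_cancel, rule Lim_null_comparison)
        have "(\<lambda>n. L2_norm (\<lambda>x. a n x - g x) * L2_norm ?\<phi>) \<longlonglongrightarrow> 0 * L2_norm ?\<phi>"
          by (intro tendsto_mult norm_lim tendsto_const)
        then show "(\<lambda>n. L2_norm (\<lambda>x. a n x - g x) * L2_norm ?\<phi>) \<longlonglongrightarrow> 0" by simp
        have "(LINT x|lborel. a n x * ?\<phi> x) - (LINT x|lborel. g x * ?\<phi> x) = (LINT x|lborel. (a n x - g x) * ?\<phi> x)" for n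
          using integrable_mult[OF a \<phi>2] integrable_mult[OF g \<phi>2] by (simp add: left_diff_distrib)
        then show "\<forall>\<^sub>F n in sequentially. norm ((LINT x|lborel. a n x * ?\<phi> x) - (LINT x|lborel. g x * ?\<phi> x))
            \<le> L2_norm (\<lambda>x. a n x - g x) * L2_norm ?\<phi>"
          using norm_integral_mult_le[OF square_integrable_diff[OF a g] \<phi>2] by simp
      qed
      have "y \<longlonglongrightarrow> 0" unfolding y_def[abs_def] by (rule LIMSEQ_power_zero) simp
      then have "filterlim y (at 0) sequentially"
        using y(1) by (auto simp: filterlim_at less_imp_neq[symmetric])
      from tendsto_mult[OF tendsto_const filterlim_compose[OF test_function_quotient_limit[OF f \<phi>] this], of "of_real h"]
      have 2: "(\<lambda>n. of_real h * (LINT x|lborel. f x * of_real ((\<phi> (x - y n) - \<phi> x) / y n)))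
        \<longlonglongrightarrow> of_real h * - (LINT x|lborel. f x * of_real (deriv \<phi> x))" .
      \<comment> \<open>A translation of the integration variable moves the forward quotient on
        \<open>f\<close> to a backward quotient on \<open>\<phi>\<close>, which tends to minus its
        derivative.\<close>
      have "(LINT x|lborel. a n x * ?\<phi> x) = of_real h * (LINT x|lborel. f x * of_real ((\<phi> (x - y n) - \<phi> x) / y n))" for n
      proof -
        let ?c = "complex_of_real (h / y n)"
        have t: "test_function (\<lambda>x. \<phi> (x - y n))" using test_function_shift[OF \<phi>, of "- y n"] by simp
        have i: "integrable lborel (\<lambda>x. f (x + y n) * ?\<phi> x)" "integrable lborel (\<lambda>x. f x * ?\<phi> x)"
          "integrable lborel (\<lambda>x. f x * of_real (\<phi> (x - y n)))"
          using integrable_mult[OF square_integrable_shift[OF f, of "y n"] \<phi>2] integrable_mult[OF f \<phi>2]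
            integrable_mult[OF f square_integrable_test_function[OF t]] by simp_all
        have "(LINT x|lborel. a n x * ?\<phi> x) = (LINT x|lborel. ?c * (f (x + y n) * ?\<phi> x - f x * ?\<phi> x))"
          by (simp add: a_def diff_quot_def algebra_simps)
        also have "\<dots> = ?c * ((LINT x|lborel. f (x + y n) * ?\<phi> x) - (LINT x|lborel. f x * ?\<phi> x))"
          using i by (simp del: of_real_divide)
        also have "(LINT x|lborel. f (x + y n) * ?\<phi> x) = (LINT x|lborel. f x * of_real (\<phi> (x - y n)))"
          using integral_lborel_shift[of "\<lambda>x. f x * of_real (\<phi> (x - y n))" "y n"] by simp
        also have "?c * ((LINT x|lborel. f x * of_real (\<phi> (x - y n))) - (LINT x|lborel. f x * ?\<phi> x))
            = (LINT x|lborel. ?c * (f x * of_real (\<phi> (x - y n)) - f x * ?\<phi> x))"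
          using i by (simp del: of_real_divide)
        also have "\<dots> = (LINT x|lborel. of_real h * (f x * of_real ((\<phi> (x - y n) - \<phi> x) / y n)))"
          by (intro Bochner_Integration.integral_cong) (simp_all add: algebra_simps diff_divide_distrib)
        finally show ?thesis by simp
      qed
      with 1 2 have "(LINT x|lborel. g x * ?\<phi> x) = of_real h * - (LINT x|lborel. f x * of_real (deriv \<phi> x))"
        using LIMSEQ_unique by simp
      then show ?thesis using h by (simp add: mult.assoc)
    qed
    then show "has_weak_deriv (Suc 0) f (\<lambda>x. of_real (1 / h) * g x)"
      by (auto simp: has_weak_deriv_def simp del: of_real_divide
          intro!: locally_integrable_square_integrable f square_integrable_scale g)
  qed
qed

text \<open>Here \<open>g\<close> is \<open>h^k\<close> times the \<open>k\<close>-th derivative.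
  Bounds for all further quotients of \<open>g\<close> are carried along, with the index advanced by
  \<open>k\<close>, because the next derivative is extracted from them.\<close>

lemma weak_derivs_from_diff_quots:
  assumes f: "square_integrable f" and h: "0 < h"
    and M: "\<And>ys. set ys \<subseteq> {0<..} \<Longrightarrow> L2_norm (diff_quots h ys f) \<le> M (length ys)"
    and p: "p \<in> borel_measurable borel"
    and N: "\<And>ys. set ys \<subseteq> {0<..} \<Longrightarrow> L2_bounded (\<lambda>x. p x * diff_quots h ys f x) (N (length ys))"
  shows "\<exists>g. square_integrable g \<and> has_weak_deriv k f (\<lambda>x. of_real (1 / h ^ k) * g x) \<and>
    (\<forall>ys. set ys \<subseteq> {0<..} \<longrightarrow> L2_norm (diff_quots h ys g) \<le> M (k + length ys)) \<and>
    (\<forall>ys. set ys \<subseteq> {0<..} \<longrightarrow> L2_bounded (\<lambda>x. p x * diff_quots h ys g x) (N (k + length ys)))"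
proof (induction k)
  case 0
  show ?case
    using assms has_weak_deriv_0[OF locally_integrable_square_integrable[OF f]] by (intro exI[of _ f]) auto
next
  case (Suc k)
  then obtain g where g: "square_integrable g" "has_weak_deriv k f (\<lambda>x. of_real (1 / h ^ k) * g x)"
    "\<And>ys. set ys \<subseteq> {0<..} \<Longrightarrow> L2_norm (diff_quots h ys g) \<le> M (k + length ys)"
    "\<And>ys. set ys \<subseteq> {0<..} \<Longrightarrow> L2_bounded (\<lambda>x. p x * diff_quots h ys g x) (N (k + length ys))" by blast
  obtain g' where g': "square_integrable g'" "has_weak_deriv (Suc 0) g (\<lambda>x. of_real (1 / h) * g' x)"
    "\<And>ys. set ys \<subseteq> {0<..} \<Longrightarrow> L2_norm (diff_quots h ys g') \<le> M (k + Suc (length ys))"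
    "\<And>ys. set ys \<subseteq> {0<..} \<Longrightarrow> L2_bounded (\<lambda>x. p x * diff_quots h ys g' x) (N (k + Suc (length ys)))"
    using weak_deriv_from_diff_quots[OF g(1) h, of "\<lambda>n. M (k + n)" p "\<lambda>n. N (k + n)"] g(3,4) p by blast
  have "has_weak_deriv (Suc 0) (\<lambda>x. of_real (1 / h ^ k) * g x) (\<lambda>x. of_real (1 / h ^ k) * (of_real (1 / h) * g' x))"
    by (intro has_weak_deriv_scale square_integrable_scale g' g)
  from has_weak_deriv_Suc[OF g(2) this]
  have "has_weak_deriv (Suc k) f (\<lambda>x. of_real (1 / h ^ Suc k) * g' x)"
    by (simp add: mult.commute)
  then show ?case using g' by (intro exI[of _ g']) simp
qed

section \<open>Consequences of the assumptions on the data and the solution\<close>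

lemma admissible_data_initial_bound:
  assumes ad: "admissible_data C h \<psi>0" and h: "0 < h" and ys: "set ys \<subseteq> {0<..}"
  shows "L2_norm (diff_quots h ys \<psi>0) \<le> C ^ length ys * real (length ys) ^ length ys"
proof (cases "ys = []")
  case True
  then show ?thesis using ad by (simp add: admissible_data_def)
next
  case False
  have \<psi>0: "square_integrable \<psi>0" using ad by (simp add: admissible_data_def)
  obtain G where G: "\<And>k. has_weak_deriv k \<psi>0 (G k)" "\<And>k. square_integrable (G k)"
    "\<And>k. L2_norm (\<lambda>x. of_real (h ^ k) * G k x) \<le> C ^ k * real k ^ k"
    using ad unfolding admissible_data_def by metis
  \<comment> \<open>The zeroth weak derivative supplied by the data agrees with
    \<open>\<psi>0\<close> only almost everywhere, while the chain of derivatives has to start at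
    \<open>\<psi>0\<close> itself.\<close>
  define F where "F k = (if k = 0 then \<psi>0 else G k)" for k
  have F: "has_weak_deriv k \<psi>0 (F k)" "square_integrable (F k)" for k
    using G \<psi>0 has_weak_deriv_0[OF locally_integrable_square_integrable[OF \<psi>0]] by (auto simp: F_def)
  let ?n = "length ys"
  have "L2_norm (diff_quots h ys (F 0)) \<le> h ^ ?n * L2_norm (F ?n)"
    using F has_weak_deriv_1_of_Suc[OF F(1) F(1)] h ys by (intro L2_norm_diff_quots_le) auto
  also have "\<dots> = L2_norm (\<lambda>x. of_real (h ^ ?n) * G ?n x)"
    unfolding L2_norm_scale[OF G(2)] norm_of_real using h False by (simp add: F_def)
  also have "\<dots> \<le> C ^ ?n * real ?n ^ ?n" by (rule G(3))
  finally show ?thesis by (simp add: F_def)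
qed

lemma jbracket_power2: "(jbracket x)\<^sup>2 = 1 + x\<^sup>2"
  by (simp add: jbracket_def add_nonneg_nonneg)

text \<open>\<open><x>^2 = 1 + x^2\<close> splits the squared norm into the mass 1 and the second
  moment.\<close>

lemma jbracket_weight_initial:
  assumes ad: "admissible_data C h \<psi>0"
  shows "L2_bounded (\<lambda>x. of_real (jbracket x) * \<psi>0 x) (sqrt (1 + C\<^sup>2))"
proof -
  have si: "square_integrable \<psi>0" "square_integrable (\<lambda>x. of_real \<bar>x\<bar> * \<psi>0 x)"
    and n: "L2_norm \<psi>0 = 1" "L2_norm (\<lambda>x. of_real \<bar>x\<bar> * \<psi>0 x) \<le> C"
    using ad by (simp_all add: admissible_data_def)
  have eq: "(\<lambda>x. (cmod (of_real (jbracket x) * \<psi>0 x))\<^sup>2)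
      = (\<lambda>x. (cmod (\<psi>0 x))\<^sup>2 + (cmod (of_real \<bar>x\<bar> * \<psi>0 x))\<^sup>2)"
    by (simp add: norm_mult power_mult_distrib jbracket_power2 algebra_simps)
  have i: "integrable lborel (\<lambda>x. (cmod (\<psi>0 x))\<^sup>2 + (cmod (of_real \<bar>x\<bar> * \<psi>0 x))\<^sup>2)"
    using si[THEN square_integrable_integrable] by (rule Bochner_Integration.integrable_add)
  have "(\<lambda>x. of_real (jbracket x) * \<psi>0 x) \<in> borel_measurable borel"
    using square_integrable_measurable[OF si(1)] by measurable
  then have s: "square_integrable (\<lambda>x. of_real (jbracket x) * \<psi>0 x)"
    using i unfolding square_integrable_def eq by simp
  have "(L2_norm (\<lambda>x. of_real (jbracket x) * \<psi>0 x))\<^sup>2 = (L2_norm \<psi>0)\<^sup>2 + (L2_norm (\<lambda>x. of_real \<bar>x\<bar> * \<psi>0 x))\<^sup>2"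
    unfolding L2_norm_power2 eq by (rule Bochner_Integration.integral_add) (intro square_integrable_integrable si)+
  also have "\<dots> \<le> 1 + C\<^sup>2" using n by (auto intro: power_mono)
  finally show ?thesis using s real_le_rsqrt by (auto simp: L2_bounded_def)
qed

lemma Hartree_solution_of_nls_solution:
  assumes "nls_solution \<kappa> h \<epsilon> \<psi>0 \<psi>" "\<kappa> \<in> {1, -1}" "0 < h" "0 < \<epsilon>"
  shows "\<exists>\<psi>t \<psi>x \<psi>xx. Hartree_solution \<kappa> h \<epsilon> \<psi> \<psi>t \<psi>x \<psi>xx"
proof -
  obtain \<psi>t \<psi>x \<psi>xx where *: "L2_continuous_on {0..} \<psi>" "L2_continuous_on {0..} \<psi>x" "L2_continuous_on {0..} \<psi>xx"
    "L2_continuous_on {0..} \<psi>t" "has_L2_derivative_on \<psi> \<psi>t {0..}"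
    and w: "\<And>t. 0 \<le> t \<Longrightarrow> has_weak_deriv 1 (\<psi> t) (\<psi>x t)" "\<And>t. 0 \<le> t \<Longrightarrow> has_weak_deriv 2 (\<psi> t) (\<psi>xx t)"
    and eq: "\<And>t. 0 \<le> t \<Longrightarrow> AE x in lborel. \<i> * of_real h * \<psi>t t x = - (1 / 2) * (of_real h)\<^sup>2 * \<psi>xx t x
      + of_real (convolve (potential \<kappa> \<epsilon>) (position_density (\<psi> t)) x) * \<psi> t x"
    using assms(1) unfolding nls_solution_def by blast
  have "has_weak_deriv (Suc 0) (\<psi>x t) (\<psi>xx t)" if "0 \<le> t" for t
    using has_weak_deriv_1_of_Suc[of 1 "\<psi> t" "\<psi>x t" "\<psi>xx t"] w[OF that] by (simp add: numeral_2_eq_2)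
  then have "Hartree_solution \<kappa> h \<epsilon> \<psi> \<psi>t \<psi>x \<psi>xx"
    using * w(1) eq assms(2-) by unfold_locales (auto simp: L2_continuous_on_def)
  then show ?thesis by blast
qed

section \<open>Final bounds for a solution with admissible data\<close>

context Hartree_solution
begin

context
  fixes C :: real and \<psi>0 :: "real \<Rightarrow> complex"
  assumes C: "0 \<le> C" and ad: "admissible_data C h \<psi>0" and init: "AE x in lborel. \<psi> 0 x = \<psi>0 x"
begin

lemma diff_quots_bound:
  assumes "0 \<le> t" "set ys \<subseteq> {0<..}" "length ys \<le> n"
  shows "L2_norm (diff_quots h ys (\<psi> t)) \<le> diff_quot_bound C n t"
proof (rule L2_norm_diff_quots_solution[OF C _ assms])
  fix zs :: "real list" assume zs: "set zs \<subseteq> {0<..}"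
  have "square_integrable \<psi>0" using ad by (simp add: admissible_data_def)
  then have "L2_norm (diff_quots h zs (\<psi> 0)) = L2_norm (diff_quots h zs \<psi>0)"
    using \<psi>[of 0] init
    by (intro L2_norm_cong_AE AE_diff_quots_cong) (auto intro: square_integrable_diff_quots square_integrable_measurable)
  then show "L2_norm (diff_quots h zs (\<psi> 0)) \<le> C ^ length zs * real (length zs) ^ length zs"
    using admissible_data_initial_bound[OF ad h zs] by simp
qed

text \<open>The estimate for the truncated weights is uniform in \<open>n\<close> because both the
  initial weight and the rate \<open>diff_quot_bound C 1 t\<close> are; Fatou then supplies the
  decay of \<open>\<psi> t\<close> that was not assumed.\<close>

lemma jbracket_weight_bound:
  assumes t: "0 \<le> t"
  shows "L2_bounded (\<lambda>x. of_real (jbracket x) * \<psi> t x) (sqrt (1 + C\<^sup>2) + t * diff_quot_bound C 1 t)"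
proof -
  let ?w = "\<lambda>n x. min (jbracket x) (real n)" and ?D = "diff_quot_bound C 1 t"
  have w\<psi>: "square_integrable (\<lambda>x. of_real (?w n x) * \<psi> t x)" for n
  proof (rule square_integrable_mult_bounded[OF \<psi>[OF t]])
    show "cmod (of_real (?w n x)) \<le> real n" for x
      unfolding norm_of_real using jbracket_ge_1[of x] by simp
  qed measurable
  have w\<psi>_le: "L2_norm (\<lambda>x. of_real (?w n x) * \<psi> t x) \<le> sqrt (1 + C\<^sup>2) + t * ?D" for n
  proof -
    have "L2_norm (\<lambda>x. of_real (?w n x) * \<psi> t x) \<le> L2_norm (\<lambda>x. of_real (?w n x) * \<psi> 0 x) + t * ?D"
    proof (rule L2_norm_weight_solution[OF measurable_cut_jbracket cut_jbracket_nonneg cut_jbracket_le cut_jbracket_lipschitz t])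
      show "0 \<le> ?D" by (rule diff_quot_bound_nonneg[OF C t])
      fix s y :: real assume s: "0 \<le> s" "s \<le> t" "0 < y"
      show "L2_norm (diff_quot h y (\<psi> s)) \<le> ?D"
        using diff_quots_bound[of s "[y]" 1] diff_quot_bound_mono[OF C s(1,2), of 1] s by simp
    qed
    also have "L2_norm (\<lambda>x. of_real (?w n x) * \<psi> 0 x) \<le> 1 * L2_norm (\<lambda>x. of_real (jbracket x) * \<psi>0 x)"
    proof (rule L2_norm_bound)
      show "square_integrable (\<lambda>x. of_real (jbracket x) * \<psi>0 x)"
        using jbracket_weight_initial[OF ad] by (simp add: L2_bounded_def)
      show "(\<lambda>x. complex_of_real (?w n x) * \<psi> 0 x) \<in> borel_measurable borel"
        using square_integrable_measurable[OF \<psi>[of 0]] by simp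
      show "AE x in lborel. cmod (of_real (?w n x) * \<psi> 0 x) \<le> 1 * cmod (of_real (jbracket x) * \<psi>0 x)"
        using init
      proof eventually_elim
        case (elim x)
        show ?case
          unfolding norm_mult norm_of_real mult_1 elim
          using jbracket_ge_1[of x] by (intro mult_right_mono) auto
      qed
    qed simp
    also have "1 * L2_norm (\<lambda>x. of_real (jbracket x) * \<psi>0 x) \<le> sqrt (1 + C\<^sup>2)"
      using jbracket_weight_initial[OF ad] by (simp add: L2_bounded_def)
    finally show ?thesis by simp
  qed
  have m: "(\<lambda>x. of_real (jbracket x) * \<psi> t x) \<in> borel_measurable borel"
    using square_integrable_measurable[OF \<psi>[OF t]] by measurable
  have lim: "AE x in lborel. (\<lambda>n. of_real (?w n x) * \<psi> t x) \<longlonglongrightarrow> of_real (jbracket x) * \<psi> t x"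
    by (intro AE_I2 tendsto_mult tendsto_of_real cut_jbracket_tendsto tendsto_const)
  show ?thesis
    unfolding L2_bounded_def using L2_fatou[OF w\<psi> m lim w\<psi>_le] by simp
qed

lemma second_moment_bound:
  assumes t: "0 \<le> t"
  shows "integrable lborel (\<lambda>x. (jbracket x)\<^sup>2 * position_density (\<psi> t) x)"
    and "(LINT x|lborel. \<bar>(jbracket x)\<^sup>2 * position_density (\<psi> t) x\<bar>) \<le> (sqrt (1 + C\<^sup>2) + t * diff_quot_bound C 1 t)\<^sup>2"
proof -
  let ?f = "\<lambda>x. of_real (jbracket x) * \<psi> t x"
  have eq: "(jbracket x)\<^sup>2 * position_density (\<psi> t) x = (cmod (?f x))\<^sup>2" for x
    by (simp add: position_density_def norm_mult power_mult_distrib)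
  have f: "square_integrable ?f" "L2_norm ?f \<le> sqrt (1 + C\<^sup>2) + t * diff_quot_bound C 1 t"
    using jbracket_weight_bound[OF t] by (auto simp: L2_bounded_def)
  show "integrable lborel (\<lambda>x. (jbracket x)\<^sup>2 * position_density (\<psi> t) x)"
    unfolding eq by (rule square_integrable_integrable[OF f(1)])
  show "(LINT x|lborel. \<bar>(jbracket x)\<^sup>2 * position_density (\<psi> t) x\<bar>) \<le> (sqrt (1 + C\<^sup>2) + t * diff_quot_bound C 1 t)\<^sup>2"
    unfolding eq abs_power2 L2_norm_power2[symmetric] by (rule power_mono[OF f(2) L2_norm_nonneg])
qed

text \<open>For the empty list of steps, the weighted bound transported to the limit is exactly the
  claim; the powers of \<open>h\<close> cancel in the weak derivative
  \<open>g / h^k\<close>.\<close>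

lemma weighted_deriv_bound:
  assumes t: "0 \<le> t" and h1: "h \<le> 1"
  defines "A \<equiv> sqrt (1 + C\<^sup>2) + t * diff_quot_bound C 1 t"
  shows "\<exists>g. has_weak_deriv k (\<psi> t) g \<and>
    square_integrable (\<lambda>x. of_real (jbracket x powr (1 / 2) * h ^ k) * g x) \<and>
    L2_norm (\<lambda>x. of_real (jbracket x powr (1 / 2) * h ^ k) * g x)
      \<le> sqrt (A * diff_quot_bound C (2 * k) t + real k * (diff_quot_bound C (2 * k) t)\<^sup>2)"
proof -
  let ?N = "\<lambda>n. sqrt (A * diff_quot_bound C (2 * n) t + real n * (diff_quot_bound C (2 * n) t)\<^sup>2)"
    and ?p = "\<lambda>x. complex_of_real (sqrt (jbracket x))"
  have p: "?p \<in> borel_measurable borel" by measurable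
  have "L2_bounded (\<lambda>x. ?p x * diff_quots h ys (\<psi> t) x) (?N (length ys))" if "set ys \<subseteq> {0<..}" for ys
    using h h1 by (intro weighted_diff_quots_bound \<psi> t jbracket_weight_bound[OF t, folded A_def] diff_quots_bound that) auto
  from weak_derivs_from_diff_quots[OF \<psi>[OF t] h diff_quots_bound[OF t _ order_refl] p this, of k]
  obtain g where g: "square_integrable g" "has_weak_deriv k (\<psi> t) (\<lambda>x. of_real (1 / h ^ k) * g x)"
    and "\<And>ys. set ys \<subseteq> {0<..} \<Longrightarrow> L2_bounded (\<lambda>x. ?p x * diff_quots h ys g x) (?N (k + length ys))"
    by blast
  from this(3)[of "[]"] have "L2_bounded (\<lambda>x. ?p x * g x) (?N k)" by simp
  moreover have "(\<lambda>x. of_real (jbracket x powr (1 / 2) * h ^ k) * (of_real (1 / h ^ k) * g x)) = (\<lambda>x. ?p x * g x)"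
    using h order_trans[OF zero_le_one jbracket_ge_1] by (simp add: powr_half_sqrt)
  ultimately show ?thesis
    using g(2) by (intro exI[of _ "\<lambda>x. of_real (1 / h ^ k) * g x"]) (simp only: L2_bounded_def simp_thms)
qed

end

end

theorem lemma3p1:
  fixes C0 :: real
  shows "\<exists>(C :: real \<Rightarrow> real) (CK :: nat \<Rightarrow> real \<Rightarrow> real).
    \<forall>\<kappa>\<in>{1, -1 :: real}.
    \<forall>(\<psi>in :: real \<Rightarrow> real \<Rightarrow> complex) (\<psi> :: real \<Rightarrow> real \<Rightarrow> real \<Rightarrow> real \<Rightarrow> complex).
      (\<forall>h\<in>{0<..1}. admissible_data C0 h (\<psi>in h)) \<longrightarrow>
      (\<forall>h\<in>{0<..1}. \<forall>\<epsilon>\<in>{0<..1}. nls_solution \<kappa> h \<epsilon> (\<psi>in h) (\<psi> h \<epsilon>)) \<longrightarrow>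
      (\<forall>h\<in>{0<..1}. \<forall>\<epsilon>\<in>{0<..1}. \<forall>t\<ge>0.
         (integrable lborel (\<lambda>x. (jbracket x)\<^sup>2 * position_density (\<psi> h \<epsilon> t) x) \<and>
          (LINT x|lborel. \<bar>(jbracket x)\<^sup>2 * position_density (\<psi> h \<epsilon> t) x\<bar>) \<le> C t) \<and>
         (\<forall>k\<ge>1. \<exists>g. has_weak_deriv k (\<psi> h \<epsilon> t) g \<and>
            square_integrable (\<lambda>x. of_real (jbracket x powr (1 / 2) * h ^ k) * g x) \<and>
            L2_norm (\<lambda>x. of_real (jbracket x powr (1 / 2) * h ^ k) * g x) \<le> CK k t))"
proof -
  \<comment> \<open>Both constants are chosen before the sign, the data, \<open>h\<close> and
    \<open>\<epsilon>\<close> are introduced, which is the uniformity claimed.\<close>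
  define A where "A t = sqrt (1 + C0\<^sup>2) + t * diff_quot_bound C0 1 t" for t
  define CK where "CK k t = sqrt (A t * diff_quot_bound C0 (2 * k) t + real k * (diff_quot_bound C0 (2 * k) t)\<^sup>2)" for k t
  show ?thesis
  proof (intro exI[of _ "\<lambda>t. (A t)\<^sup>2"] exI[of _ CK] ballI allI impI)
    fix \<kappa> :: real and \<psi>in :: "real \<Rightarrow> real \<Rightarrow> complex" and \<psi> :: "real \<Rightarrow> real \<Rightarrow> real \<Rightarrow> real \<Rightarrow> complex"
      and h \<epsilon> t :: real
    assume \<kappa>: "\<kappa> \<in> {1, -1}" and "\<forall>h\<in>{0<..1}. admissible_data C0 h (\<psi>in h)"
      and "\<forall>h\<in>{0<..1}. \<forall>\<epsilon>\<in>{0<..1}. nls_solution \<kappa> h \<epsilon> (\<psi>in h) (\<psi> h \<epsilon>)"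
      and h: "h \<in> {0<..1}" and \<epsilon>: "\<epsilon> \<in> {0<..1}" and t: "0 \<le> t"
    then have ad: "admissible_data C0 h (\<psi>in h)" and sol: "nls_solution \<kappa> h \<epsilon> (\<psi>in h) (\<psi> h \<epsilon>)" by auto
    have h1: "h \<le> 1" using h by simp
    obtain \<psi>t \<psi>x \<psi>xx where "Hartree_solution \<kappa> h \<epsilon> (\<psi> h \<epsilon>) \<psi>t \<psi>x \<psi>xx"
      using Hartree_solution_of_nls_solution[OF sol \<kappa>] h \<epsilon> by auto
    then interpret Hartree_solution \<kappa> h \<epsilon> "\<psi> h \<epsilon>" \<psi>t \<psi>x \<psi>xx .
    have init: "AE x in lborel. \<psi> h \<epsilon> 0 x = \<psi>in h x" using sol by (simp add: nls_solution_def)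
    \<comment> \<open>The sign of \<open>C0\<close> is not prescribed in the statement; it follows
      from the moment bound on the data.\<close>
    have "L2_norm (\<lambda>x. of_real \<bar>x\<bar> * \<psi>in h x) \<le> C0" using ad by (simp add: admissible_data_def)
    then have C0: "0 \<le> C0" using L2_norm_nonneg order_trans by blast
    show "(integrable lborel (\<lambda>x. (jbracket x)\<^sup>2 * position_density (\<psi> h \<epsilon> t) x) \<and>
          (LINT x|lborel. \<bar>(jbracket x)\<^sup>2 * position_density (\<psi> h \<epsilon> t) x\<bar>) \<le> (A t)\<^sup>2) \<and>
         (\<forall>k\<ge>1. \<exists>g. has_weak_deriv k (\<psi> h \<epsilon> t) g \<and>
            square_integrable (\<lambda>x. of_real (jbracket x powr (1 / 2) * h ^ k) * g x) \<and>
            L2_norm (\<lambda>x. of_real (jbracket x powr (1 / 2) * h ^ k) * g x) \<le> CK k t)"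
      unfolding A_def CK_def
      using second_moment_bound[OF C0 ad init t] weighted_deriv_bound[OF C0 ad init t h1] by blast
  qed
qed

end
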